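(* Let $b\in BMO^1_\alpha(\mathbb B_n,\mathcal L(\ell^2))$ be such that $\widetilde b\in L^\infty(\mathbb B_n,\mathcal L(\ell^2))$. For every positive integer $d$, the operator $M_{I^{(d)}}T_bM_{I^{(d)}}$ belongs to $\mathcal T_{L^\infty_{fin}}$. Furthermore, if $$\lim_{d\to\infty}\|T_bM_{I_{(d)}}\|_{\mathcal L(A^2_\alpha(\mathbb B_n,\ell^2))}=\lim_{d\to\infty}\|M_{I_{(d)}}T_b\|_{\mathcal L(A^2_\alpha(\mathbb B_n,\ell^2))}=0,$$ then the operator $T_b$ belongs to $\mathcal T_{L^\infty_{fin}}$.
   Context: Fix an integer $n\ge 1$ and a real $\alpha>-1$. $\mathbb B_n$ is the open unit ball of $\mathbb C^n$, $\langle z,w\rangle=\sum_k z_k\overline{w_k}$, and $d\nu_\alpha(z)=c_\alpha(1-|z|^2)^\alpha d\nu(z)$, where $\nu$ is Lebesgue measure and $c_\alpha$ is the constant making $\nu_\alpha$ a probability measure on $\mathbb B_n$. For a complex Banach space $E$ and $1\le p<\infty$, $L^p_\alpha(\mathbb B_n,E)$ is the Bochner–Lebesgue space of measurable $f:\mathbb B_n\to E$ with $\|f\|^p=\int_{\mathbb B_n}\|f(z)\|_E^p\,d\nu_\alpha(z)<\infty$; $L^\infty(\mathbb B_n,E)$ is the space of essentially bounded measurable functions; $A^p_\alpha(\mathbb B_n,E)$ is the subspace of holomorphic functions in $L^p_\alpha(\mathbb B_n,E)$; $H^\infty(\mathbb B_n,E)$ is the space of bounded holomorphic functions, which is dense in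 $A^2_\alpha(\mathbb B_n,E)$. $\mathcal L(E,F)$ denotes bounded linear operators and $\mathcal L(E)=\mathcal L(E,E)$. Kernels: $K^\alpha_z(w)=(1-\langle w,z\rangle)^{-(n+1+\alpha)}$, $k^\alpha_z(w)=(1-|z|^2)^{(n+1+\alpha)/2}(1-\langle w,z\rangle)^{-(n+1+\alpha)}$. For $a\in\mathbb B_n\setminus\{0\}$, $\varphi_a(z)=\dfrac{a-P_a(z)-\sqrt{1-|a|^2}\,Q_a(z)}{1-\langle z,a\rangle}$ with $P_a(z)=\frac{\langle z,a\rangle}{|a|^2}a$, $Q_a=I-P_a$; $\varphi_0(z)=-z$. For $b\in L^1_\alpha(\mathbb B_n,E)$ the Berezin transform is $\widetilde b(z)=\int_{\mathbb B_n}|k^\alpha_z(w)|^2b(w)\,d\nu_\alpha(w)$, and $b\in BMO^1_\alpha(\mathbb B_n,E)$ if $\|b\|_{BMO^1_\alpha(\mathbb B_n,E)}:=\sup_{z\in\mathbb B_n}\|b\circ\varphi_z-\widetilde b(z)\|_{L^1_\alpha(\mathbb B_n,E)}<\infty$. For $b\in L^1_\alpha(\mathbb B_n,\mathcal L(E,F))$ the Toeplitz operator $T_b$ is densely defined on $A^2_\alpha(\mathbb B_n,E)$ by $T_bf(z)=\int_{\mathbb B_n}b(w)(f(w))\overline{K^\alpha_z(w)}\,d\nu_\alpha(w)$, $f\in H^\infty(\mathbb B_n,E)$. It is known that if $b\in BMO^1_\alpha(\mathbb B_n,\mathcal L(E,F))$ and $\widetilde b\in L^\infty(\mathbb B_n,\mathcal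 L(E,F))$, then $T_b$ extends to a bounded operator $A^2_\alpha(\mathbb B_n,E)\to A^2_\alpha(\mathbb B_n,F)$, still denoted $T_b$. Fix an orthonormal basis $\{e_j\}_{j\ge1}$ of $\ell^2$. On $A^2_\alpha(\mathbb B_n,\ell^2)$ define $M_{I^{(d)}}f(z)=\sum_{j=1}^d\langle f(z),e_j\rangle_{\ell^2}e_j$ and $M_{I_{(d)}}f(z)=\sum_{j=d+1}^\infty\langle f(z),e_j\rangle_{\ell^2}e_j$. A function $u:\mathbb B_n\to\mathcal L(\ell^2)$ is in $L^\infty_{fin}$ if $\langle u(\cdot)e_j,e_k\rangle_{\ell^2}$ is non-zero for only finitely many pairs $(j,k)$ and each function $z\mapsto\langle u(z)e_j,e_k\rangle_{\ell^2}$ is bounded (and measurable) on $\mathbb B_n$. The Toeplitz algebra $\mathcal T_{L^\infty_{fin}}$ is the operator-norm closure in $\mathcal L(A^2_\alpha(\mathbb B_n,\ell^2))$ of the set of operators $\sum_{l=1}^L\prod_{j=1}^JT_{u_{j,l}}$ with $u_{j,l}\in L^\infty_{fin}$ and $J,L<\infty$. *)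

theory Defs
  imports "HOL-Analysis.Analysis"
begin

text \<open>
  The complex Hilbert space of square-summable sequences.  Its \<^const>\<open>inner\<close> is the real part of
  the Hermitian inner product \<open>ell2_cinner\<close>, which is linear in the first argument.
\<close>

typedef ell2 = "{x :: nat \<Rightarrow> complex. summable (\<lambda>i. (cmod (x i))\<^sup>2)}"
  morphisms ell2_nth Abs_ell2
  by (rule exI[of _ "\<lambda>_. 0"]) simp

setup_lifting type_definition_ell2

lemma ell2_eqI: "(\<And>i. ell2_nth x i = ell2_nth y i) \<Longrightarrow> x = y"
  by (simp add: ell2_nth_inject[symmetric] ext)

lemma summable_ell2: "summable (\<lambda>i. (cmod (ell2_nth x i))\<^sup>2)"
  using ell2_nth[of x] by simp

lemma square_summable_mult:
  fixes x y :: "nat \<Rightarrow> complex"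
  assumes "summable (\<lambda>i. (cmod (x i))\<^sup>2)" "summable (\<lambda>i. (cmod (y i))\<^sup>2)"
  shows "summable (\<lambda>i. x i * cnj (y i))"
proof (rule summable_comparison_test'[OF summable_add[OF assms], of 0])
  fix n :: nat
  have "0 \<le> (cmod (x n) - cmod (y n))\<^sup>2" by simp
  then have "2 * (cmod (x n) * cmod (y n)) \<le> (cmod (x n))\<^sup>2 + (cmod (y n))\<^sup>2"
    by (simp add: power2_diff)
  moreover have "0 \<le> cmod (x n) * cmod (y n)" by simp
  ultimately show "norm (x n * cnj (y n)) \<le> (cmod (x n))\<^sup>2 + (cmod (y n))\<^sup>2"
    unfolding norm_mult complex_mod_cnj real_norm_def by linarith
qed

lemma square_summable_add:
  fixes x y :: "nat \<Rightarrow> complex"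
  assumes "summable (\<lambda>i. (cmod (x i))\<^sup>2)" "summable (\<lambda>i. (cmod (y i))\<^sup>2)"
  shows "summable (\<lambda>i. (cmod (x i + y i))\<^sup>2)"
proof (rule summable_comparison_test'[OF summable_mult[OF summable_add[OF assms], of 2], of 0])
  fix n :: nat
  have "(cmod (x n + y n))\<^sup>2 \<le> (cmod (x n) + cmod (y n))\<^sup>2"
    by (intro power_mono norm_triangle_ineq norm_ge_zero)
  moreover have "0 \<le> (cmod (x n) - cmod (y n))\<^sup>2" by simp
  ultimately show "norm ((cmod (x n + y n))\<^sup>2) \<le> 2 * ((cmod (x n))\<^sup>2 + (cmod (y n))\<^sup>2)"
    by (simp add: power2_diff power2_sum)
qed

lemma square_summable_mult_left:
  fixes x :: "nat \<Rightarrow> complex"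
  assumes "summable (\<lambda>i. (cmod (x i))\<^sup>2)"
  shows "summable (\<lambda>i. (cmod (c * x i))\<^sup>2)"
  using summable_mult[OF assms, of "(cmod c)\<^sup>2"] by (simp add: norm_mult power_mult_distrib)

lift_definition ell2_scaleC :: "complex \<Rightarrow> ell2 \<Rightarrow> ell2" (infixr "*\<^sub>C" 75)
  is "\<lambda>c x i. c * x i"
  by (rule square_summable_mult_left)

definition ell2_cinner :: "ell2 \<Rightarrow> ell2 \<Rightarrow> complex"
  where "ell2_cinner x y = (\<Sum>i. ell2_nth x i * cnj (ell2_nth y i))"

lemma summable_ell2_cinner: "summable (\<lambda>i. ell2_nth x i * cnj (ell2_nth y i))"
  by (rule square_summable_mult[OF summable_ell2 summable_ell2])

instantiation ell2 :: real_vector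
begin

lift_definition zero_ell2 :: ell2 is "\<lambda>_. 0" by simp

lift_definition plus_ell2 :: "ell2 \<Rightarrow> ell2 \<Rightarrow> ell2" is "\<lambda>x y i. x i + y i"
  by (rule square_summable_add)

lift_definition uminus_ell2 :: "ell2 \<Rightarrow> ell2" is "\<lambda>x i. - x i" by simp

definition minus_ell2 :: "ell2 \<Rightarrow> ell2 \<Rightarrow> ell2" where "x - y = x + - (y :: ell2)"

definition scaleR_ell2 :: "real \<Rightarrow> ell2 \<Rightarrow> ell2" where "r *\<^sub>R x = of_real r *\<^sub>C x"

instance
proof
  fix x y z :: ell2 and r t :: real
  note rep = plus_ell2.rep_eq zero_ell2.rep_eq uminus_ell2.rep_eq ell2_scaleC.rep_eq scaleR_ell2_def
  show "x + y + z = x + (y + z)" by (rule ell2_eqI) (simp add: rep)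
  show "x + y = y + x" by (rule ell2_eqI) (simp add: rep)
  show "0 + x = x" by (rule ell2_eqI) (simp add: rep)
  show "- x + x = 0" by (rule ell2_eqI) (simp add: rep)
  show "x - y = x + - y" by (rule minus_ell2_def)
  show "r *\<^sub>R (x + y) = r *\<^sub>R x + r *\<^sub>R y" by (rule ell2_eqI) (simp add: rep distrib_left)
  show "(r + t) *\<^sub>R x = r *\<^sub>R x + t *\<^sub>R x" by (rule ell2_eqI) (simp add: rep distrib_right)
  show "r *\<^sub>R t *\<^sub>R x = (r * t) *\<^sub>R x" by (rule ell2_eqI) (simp add: rep)
  show "1 *\<^sub>R x = x" by (rule ell2_eqI) (simp add: rep)
qed

end

lemma ell2_nth_minus: "ell2_nth (x - y) i = ell2_nth x i - ell2_nth y i"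
  by (simp only: minus_ell2_def plus_ell2.rep_eq uminus_ell2.rep_eq) simp

instantiation ell2 :: real_inner
begin

definition inner_ell2 :: "ell2 \<Rightarrow> ell2 \<Rightarrow> real" where "inner x y = Re (ell2_cinner x y)"
definition norm_ell2 :: "ell2 \<Rightarrow> real" where "norm x = sqrt (inner x (x :: ell2))"
definition sgn_ell2 :: "ell2 \<Rightarrow> ell2" where "sgn x = inverse (norm x) *\<^sub>R (x :: ell2)"
definition dist_ell2 :: "ell2 \<Rightarrow> ell2 \<Rightarrow> real" where "dist x y = norm (x - y :: ell2)"
definition uniformity_ell2 :: "(ell2 \<times> ell2) filter"
  where "uniformity_ell2 = (INF e\<in>{0<..}. principal {(x, y). dist x y < e})"
definition open_ell2 :: "ell2 set \<Rightarrow> bool"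
  where "open_ell2 U \<longleftrightarrow> (\<forall>x\<in>U. eventually (\<lambda>(x', y). x' = x \<longrightarrow> y \<in> U) uniformity)"

lemma inner_ell2_alt: "inner x (y :: ell2) = (\<Sum>i. Re (ell2_nth x i * cnj (ell2_nth y i)))"
  unfolding inner_ell2_def ell2_cinner_def by (rule Re_suminf[OF summable_ell2_cinner])

lemma summable_inner_ell2: "summable (\<lambda>i. Re (ell2_nth x i * cnj (ell2_nth y i)))"
  by (rule summable_Re[OF summable_ell2_cinner])

lemma inner_ell2_self: "inner x (x :: ell2) = (\<Sum>i. (cmod (ell2_nth x i))\<^sup>2)"
  unfolding inner_ell2_alt by (simp only: cmod_power2) (simp add: power2_eq_square)

instance
proof
  fix x y z :: ell2 and r :: real
  show "inner x y = inner y x"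
    unfolding inner_ell2_alt by (simp add: mult.commute)
  show "inner (x + y) z = inner x z + inner y z"
    unfolding inner_ell2_alt
    by (subst suminf_add[OF summable_inner_ell2 summable_inner_ell2])
      (simp add: plus_ell2.rep_eq algebra_simps)
  show "inner (r *\<^sub>R x) y = r * inner x y"
    unfolding inner_ell2_alt
    by (subst suminf_mult[OF summable_inner_ell2, symmetric])
      (simp add: scaleR_ell2_def ell2_scaleC.rep_eq algebra_simps)
  show "0 \<le> inner x x"
    unfolding inner_ell2_self by (rule suminf_nonneg[OF summable_ell2]) simp
  show "inner x x = 0 \<longleftrightarrow> x = 0"
    unfolding inner_ell2_self using suminf_eq_zero_iff[OF summable_ell2[of x]]
    by (auto intro!: ell2_eqI simp: zero_ell2.rep_eq)
qed (simp_all add: norm_ell2_def sgn_ell2_def dist_ell2_def uniformity_ell2_def open_ell2_def)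

end

lemma norm_ell2_sq: "(norm (x :: ell2))\<^sup>2 = (\<Sum>i. (cmod (ell2_nth x i))\<^sup>2)"
  by (simp add: power2_norm_eq_inner inner_ell2_self)

lemma cmod_ell2_nth_le: "cmod (ell2_nth x i) \<le> norm x"
proof -
  have "(cmod (ell2_nth x i))\<^sup>2 \<le> (norm x)\<^sup>2"
    unfolding norm_ell2_sq using sum_le_suminf[OF summable_ell2, of "{i}" x] by simp
  then show ?thesis by (simp add: power2_le_iff_abs_le)
qed

instance ell2 :: banach
proof
  fix X :: "nat \<Rightarrow> ell2"
  assume C: "Cauchy X"
  have "\<exists>l. (\<lambda>k. ell2_nth (X k) i) \<longlonglongrightarrow> l" for i
  proof -
    have "Cauchy (\<lambda>k. ell2_nth (X k) i)"
    proof (rule CauchyI)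
      fix e :: real assume "e > 0"
      with C obtain M where "\<forall>m\<ge>M. \<forall>n\<ge>M. norm (X m - X n) < e"
        by (meson CauchyD)
      then show "\<exists>M. \<forall>m\<ge>M. \<forall>n\<ge>M. cmod (ell2_nth (X m) i - ell2_nth (X n) i) < e"
        by (metis cmod_ell2_nth_le ell2_nth_minus le_less_trans)
    qed
    then show ?thesis by (simp add: Cauchy_convergent_iff convergent_def)
  qed
  then obtain l where l: "\<And>i. (\<lambda>k. ell2_nth (X k) i) \<longlonglongrightarrow> l i" by metis
  have *: "\<exists>M. \<forall>m\<ge>M. \<forall>K. (\<Sum>i<K. (cmod (ell2_nth (X m) i - l i))\<^sup>2) \<le> e\<^sup>2" if "e > 0" for e
  proof -
    from C \<open>e > 0\<close> obtain M where M: "\<forall>m\<ge>M. \<forall>n\<ge>M. norm (X m - X n) < e"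
      by (meson CauchyD)
    have "(\<Sum>i<K. (cmod (ell2_nth (X m) i - l i))\<^sup>2) \<le> e\<^sup>2" if "m \<ge> M" for m K
    proof (rule LIMSEQ_le_const2)
      show "(\<lambda>n. \<Sum>i<K. (cmod (ell2_nth (X m) i - ell2_nth (X n) i))\<^sup>2)
              \<longlonglongrightarrow> (\<Sum>i<K. (cmod (ell2_nth (X m) i - l i))\<^sup>2)"
        by (intro tendsto_intros l)
      have "(\<Sum>i<K. (cmod (ell2_nth (X m) i - ell2_nth (X n) i))\<^sup>2) \<le> e\<^sup>2" if "n \<ge> M" for n
      proof -
        have "(\<Sum>i<K. (cmod (ell2_nth (X m - X n) i))\<^sup>2) \<le> (norm (X m - X n))\<^sup>2"
          unfolding norm_ell2_sq by (rule sum_le_suminf[OF summable_ell2]) auto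
        also have "\<dots> \<le> e\<^sup>2"
          using M \<open>m \<ge> M\<close> that by (intro power_mono) (auto intro: less_imp_le)
        finally show ?thesis by (simp add: ell2_nth_minus)
      qed
      then show "\<exists>N. \<forall>n\<ge>N. (\<Sum>i<K. (cmod (ell2_nth (X m) i - ell2_nth (X n) i))\<^sup>2) \<le> e\<^sup>2"
        by blast
    qed
    then show ?thesis by blast
  qed
  have sm: "summable (\<lambda>i. (cmod (ell2_nth (X m) i - l i))\<^sup>2)"
    if "\<forall>K. (\<Sum>i<K. (cmod (ell2_nth (X m) i - l i))\<^sup>2) \<le> B" for m B
  proof (rule bounded_imp_summable[of _ B])
    show "(\<Sum>i\<le>n. (cmod (ell2_nth (X m) i - l i))\<^sup>2) \<le> B" for n
      using that by (metis lessThan_Suc_atMost)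
  qed simp
  from *[of 1] obtain m where m: "\<forall>K. (\<Sum>i<K. (cmod (ell2_nth (X m) i - l i))\<^sup>2) \<le> 1" by auto
  have "summable (\<lambda>i. (cmod (ell2_nth (X m) i + - (ell2_nth (X m) i - l i)))\<^sup>2)"
    by (rule square_summable_add[OF summable_ell2]) (simp only: norm_minus_cancel sm[OF m])
  then have L: "ell2_nth (Abs_ell2 l) = l" by (simp add: Abs_ell2_inverse)
  have "X \<longlonglongrightarrow> Abs_ell2 l"
  proof (rule LIMSEQ_I)
    fix r :: real assume "r > 0"
    then obtain M where M: "\<forall>m\<ge>M. \<forall>K. (\<Sum>i<K. (cmod (ell2_nth (X m) i - l i))\<^sup>2) \<le> (r/2)\<^sup>2"
      using *[of "r/2"] by auto
    have "norm (X n - Abs_ell2 l) < r" if "n \<ge> M" for n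
    proof -
      have "(norm (X n - Abs_ell2 l))\<^sup>2 \<le> (r/2)\<^sup>2"
        unfolding norm_ell2_sq
        by (rule suminf_le_const[OF summable_ell2]) (use M that in \<open>simp add: ell2_nth_minus L\<close>)
      then have "norm (X n - Abs_ell2 l) \<le> r/2"
        using \<open>r > 0\<close> by (simp add: power2_le_iff_abs_le)
      with \<open>r > 0\<close> show ?thesis by simp
    qed
    then show "\<exists>no. \<forall>n\<ge>no. norm (X n - Abs_ell2 l) < r" by blast
  qed
  then show "convergent X" by (rule convergentI)
qed

lift_definition ell2_of_list :: "(rat \<times> rat) list \<Rightarrow> ell2"
  is "\<lambda>qs i. if i < length qs then Complex (of_rat (fst (qs ! i))) (of_rat (snd (qs ! i))) else 0"
  by (rule summable_finite[of "{..<length _}"]) auto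

lemma rat_approx_complex:
  assumes "e > 0"
  shows "\<exists>q. cmod (c - Complex (of_rat (fst q)) (of_rat (snd q))) < e"
proof -
  obtain p q where pq: "Re c < of_rat p" "of_rat p < Re c + e/2" "Im c < of_rat q" "of_rat q < Im c + e/2"
    using of_rat_dense[of "Re c" "Re c + e/2"] of_rat_dense[of "Im c" "Im c + e/2"] assms by auto
  have "cmod (c - Complex (of_rat p) (of_rat q)) \<le> \<bar>Re c - of_rat p\<bar> + \<bar>Im c - of_rat q\<bar>"
    using cmod_le[of "c - Complex (of_rat p) (of_rat q)"] by simp
  with pq show ?thesis by (intro exI[of _ "(p, q)"]) auto
qed

lemma ell2_of_list_dense:
  assumes "e > 0"
  shows "\<exists>qs. norm (x - ell2_of_list qs) < e"
proof -
  have "(\<lambda>n. suminf (\<lambda>k. (cmod (ell2_nth x (k + n)))\<^sup>2)) \<longlonglongrightarrow> 0"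
    by (rule suminf_exist_split2[OF summable_ell2])
  from order_tendstoD(2)[OF this, of "e\<^sup>2 / 2"] assms
  obtain N where N: "suminf (\<lambda>k. (cmod (ell2_nth x (k + N)))\<^sup>2) < e\<^sup>2 / 2"
    by (auto simp: eventually_sequentially)
  define d where "d = sqrt (e\<^sup>2 / (2 * (real N + 1)))"
  have d: "d > 0" "d\<^sup>2 = e\<^sup>2 / (2 * (real N + 1))" using assms by (simp_all add: d_def)
  obtain q where q: "\<And>i. cmod (ell2_nth x i - Complex (of_rat (fst (q i))) (of_rat (snd (q i)))) < d"
    using choice[of "\<lambda>i q. cmod (ell2_nth x i - Complex (of_rat (fst q)) (of_rat (snd q))) < d"]
      rat_approx_complex[OF d(1)] by blast
  let ?qs = "map q [0..<N]"
  have nth: "ell2_nth (x - ell2_of_list ?qs) i =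
      (if i < N then ell2_nth x i - Complex (of_rat (fst (q i))) (of_rat (snd (q i))) else ell2_nth x i)" for i
    by (simp add: ell2_nth_minus ell2_of_list.rep_eq)
  have "(norm (x - ell2_of_list ?qs))\<^sup>2 =
      (\<Sum>k. (cmod (ell2_nth (x - ell2_of_list ?qs) (k + N)))\<^sup>2) +
      (\<Sum>i<N. (cmod (ell2_nth (x - ell2_of_list ?qs) i))\<^sup>2)"
    unfolding norm_ell2_sq by (rule suminf_split_initial_segment[OF summable_ell2])
  also have "(\<Sum>k. (cmod (ell2_nth (x - ell2_of_list ?qs) (k + N)))\<^sup>2) < e\<^sup>2 / 2"
    using N by (simp add: nth)
  also have "(\<Sum>i<N. (cmod (ell2_nth (x - ell2_of_list ?qs) i))\<^sup>2) \<le> (\<Sum>i<N. d\<^sup>2)"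
    by (intro sum_mono power_mono) (auto simp: nth intro: less_imp_le[OF q])
  also have "(\<Sum>i<N. d\<^sup>2) \<le> e\<^sup>2 / 2"
    using d(1) by (simp add: d(2) field_simps)
  finally have "(norm (x - ell2_of_list ?qs))\<^sup>2 < e\<^sup>2" by simp
  then have "norm (x - ell2_of_list ?qs) < e"
    using assms by (simp add: power2_less_imp_less)
  then show ?thesis by blast
qed

instance ell2 :: second_countable_topology
proof
  define B where "B = (\<lambda>(qs, r). ball (ell2_of_list qs) (of_rat r)) ` (UNIV :: ((rat \<times> rat) list \<times> rat) set)"
  have "countable B" unfolding B_def by auto
  moreover have "topological_basis B"
  proof (rule topological_basisI)
    show "open b" if "b \<in> B" for b using that by (auto simp: B_def)
    fix U and x :: ell2
    assume "open U" "x \<in> U"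
    then obtain e where e: "e > 0" "ball x e \<subseteq> U" by (auto simp: open_contains_ball)
    obtain r where r: "e / 4 < of_rat r" "of_rat r < e / 2"
      using of_rat_dense[of "e / 4" "e / 2"] e by auto
    from ell2_of_list_dense[of "e / 4" x] e obtain qs where qs: "norm (x - ell2_of_list qs) < e / 4"
      by auto
    let ?b = "ball (ell2_of_list qs) (of_rat r)"
    have "x \<in> ?b" using qs r by (simp add: dist_norm norm_minus_commute)
    moreover have "?b \<subseteq> ball x e"
    proof
      fix y assume "y \<in> ?b"
      then have "dist x y \<le> dist x (ell2_of_list qs) + dist (ell2_of_list qs) y"
        and "dist (ell2_of_list qs) y < of_rat r"
        by (simp_all add: dist_triangle)
      with qs r have "dist x y < e" by (simp add: dist_norm)
      then show "y \<in> ball x e" by simp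
    qed
    moreover have "?b \<in> B" by (auto simp: B_def)
    ultimately show "\<exists>B'\<in>B. x \<in> B' \<and> B' \<subseteq> U" using e by blast
  qed
  ultimately show "\<exists>B :: ell2 set set. countable B \<and> open = generate_topology B"
    using topological_basis_imp_subbasis by blast
qed


text \<open>
  Since \<^typ>\<open>ell2 \<Rightarrow>\<^sub>L ell2\<close> consists of the real-linear bounded operators, the complex-linear ones are
  singled out as a (closed) subset; the operator norm is the same.
\<close>

definition clinear_operators :: "(ell2 \<Rightarrow>\<^sub>L ell2) set"
  where "clinear_operators =
    {A. \<forall>c x. blinfun_apply A (c *\<^sub>C x) = c *\<^sub>C blinfun_apply A x}"

definition orthonormal_basis :: "(nat \<Rightarrow> ell2) \<Rightarrow> bool"
  where "orthonormal_basis e \<longleftrightarrow>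
    (\<forall>j k. ell2_cinner (e j) (e k) = (if j = k then 1 else 0)) \<and>
    (\<forall>x. (\<lambda>j. ell2_cinner x (e j) *\<^sub>C e j) sums x)"


text \<open>
  The Bochner integral of the library is restricted to second countable spaces, which excludes
  the space of bounded operators on \<open>\<ell>\<^sup>2\<close>.  Here is the usual definition for strongly
  measurable functions (almost everywhere limits of simple functions) into a Banach space.
\<close>

definition strongly_measurable :: "'a measure \<Rightarrow> ('a \<Rightarrow> 'e::banach) \<Rightarrow> bool"
  where "strongly_measurable M f \<longleftrightarrow>
    (\<exists>s. (\<forall>i. simple_function M (s i)) \<and> (AE x in M. (\<lambda>i. s i x) \<longlonglongrightarrow> f x))"

definition strong_bochner_integral :: "'a measure \<Rightarrow> ('a \<Rightarrow> 'e::banach) \<Rightarrow> 'e"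
  where "strong_bochner_integral M f = (THE I. strongly_measurable M f \<and>
    (\<exists>s. (\<forall>i. Bochner_Integration.simple_bochner_integrable M (s i)) \<and>
         (\<lambda>i. \<integral>\<^sup>+x. ennreal (norm (f x - s i x)) \<partial>M) \<longlonglongrightarrow> 0 \<and>
         (\<lambda>i. Bochner_Integration.simple_bochner_integral M (s i)) \<longlonglongrightarrow> I))"


abbreviation unit_ball :: "(complex^'n::finite) set"
  where "unit_ball \<equiv> ball 0 1"

definition cdot :: "complex^'n::finite \<Rightarrow> complex^'n \<Rightarrow> complex"
  where "cdot z w = (\<Sum>k\<in>UNIV. z $ k * cnj (w $ k))"

definition normalizing_constant :: "'n::finite itself \<Rightarrow> real \<Rightarrow> real"
  where "normalizing_constant _ \<alpha> =
    1 / (LINT z|lebesgue_on (unit_ball :: (complex^'n) set). (1 - (norm z)\<^sup>2) powr \<alpha>)"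

definition nu :: "real \<Rightarrow> (complex^'n::finite) measure"
  where "nu \<alpha> = density (lebesgue_on unit_ball)
    (\<lambda>z. ennreal (normalizing_constant TYPE('n) \<alpha> * (1 - (norm z)\<^sup>2) powr \<alpha>))"

definition Lp :: "real \<Rightarrow> real \<Rightarrow> (complex^'n::finite \<Rightarrow> 'e::banach) set"
  where "Lp \<alpha> p = {f. strongly_measurable (nu \<alpha>) f \<and>
    (\<integral>\<^sup>+z. ennreal (norm (f z) powr p) \<partial>nu \<alpha>) < \<infinity>}"

definition Lp_norm :: "real \<Rightarrow> real \<Rightarrow> (complex^'n::finite \<Rightarrow> 'e::banach) \<Rightarrow> real"
  where "Lp_norm \<alpha> p f = (LINT z|nu \<alpha>. norm (f z) powr p) powr (1 / p)"

definition Linfty :: "real \<Rightarrow> (complex^'n::finite \<Rightarrow> 'e::banach) set"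
  where "Linfty \<alpha> = {f. strongly_measurable (nu \<alpha>) f \<and> (\<exists>C. AE z in nu \<alpha>. norm (f z) \<le> C)}"

definition holomorphic_on_ball :: "(complex^'n::finite \<Rightarrow> ell2) \<Rightarrow> bool"
  where "holomorphic_on_ball f \<longleftrightarrow> (\<forall>z\<in>unit_ball. \<exists>D.
    (f has_derivative D) (at z) \<and> (\<forall>c v. D (c *s v) = c *\<^sub>C D v))"


text \<open>
  Functions on the ball are represented by total functions; elements of the following spaces of
  holomorphic functions are normalised to vanish off the ball, so that equality of elements is
  equality of functions.
\<close>

definition A2 :: "real \<Rightarrow> (complex^'n::finite \<Rightarrow> ell2) set"
  where "A2 \<alpha> = {f \<in> Lp \<alpha> 2. holomorphic_on_ball f \<and> (\<forall>z. z \<notin> unit_ball \<longrightarrow> f z = 0)}"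

definition Hinfty :: "(complex^'n::finite \<Rightarrow> ell2) set"
  where "Hinfty = {f. holomorphic_on_ball f \<and> bounded (f ` unit_ball) \<and>
    (\<forall>z. z \<notin> unit_ball \<longrightarrow> f z = 0)}"

type_synonym 'n operator = "(complex^'n \<Rightarrow> ell2) \<Rightarrow> complex^'n \<Rightarrow> ell2"

text \<open>
  Bounded complex-linear operators on \<^term>\<open>A2 \<alpha>\<close>; only the values on \<^term>\<open>A2 \<alpha>\<close> matter,
  and likewise for the operator norm.
\<close>

definition bounded_operators :: "real \<Rightarrow> 'n::finite operator set"
  where "bounded_operators \<alpha> = {T.
    (\<forall>f\<in>A2 \<alpha>. T f \<in> A2 \<alpha>) \<and>
    (\<forall>f\<in>A2 \<alpha>. \<forall>g\<in>A2 \<alpha>. T (\<lambda>z. f z + g z) = (\<lambda>z. T f z + T g z)) \<and>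
    (\<forall>c. \<forall>f\<in>A2 \<alpha>. T (\<lambda>z. c *\<^sub>C f z) = (\<lambda>z. c *\<^sub>C T f z)) \<and>
    (\<exists>C. \<forall>f\<in>A2 \<alpha>. Lp_norm \<alpha> 2 (T f) \<le> C * Lp_norm \<alpha> 2 f)}"

definition operator_norm :: "real \<Rightarrow> 'n::finite operator \<Rightarrow> real"
  where "operator_norm \<alpha> T = (SUP f\<in>A2 \<alpha>. Lp_norm \<alpha> 2 (T f) / Lp_norm \<alpha> 2 f)"


text \<open>
  The powers use the principal branch; \<^term>\<open>1 - cdot w z\<close> has positive real part for
  \<^term>\<open>z\<close> and \<^term>\<open>w\<close> in the ball.
\<close>

definition bergman_kernel :: "real \<Rightarrow> complex^'n::finite \<Rightarrow> complex^'n \<Rightarrow> complex"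
  where "bergman_kernel \<alpha> z w = (1 - cdot w z) powr (- of_real (real CARD('n) + 1 + \<alpha>))"

definition normalized_kernel :: "real \<Rightarrow> complex^'n::finite \<Rightarrow> complex^'n \<Rightarrow> complex"
  where "normalized_kernel \<alpha> z w =
    of_real ((1 - (norm z)\<^sup>2) powr ((real CARD('n) + 1 + \<alpha>) / 2)) *
    (1 - cdot w z) powr (- of_real (real CARD('n) + 1 + \<alpha>))"

definition phi :: "complex^'n::finite \<Rightarrow> complex^'n \<Rightarrow> complex^'n"
  where "phi a z = (if a = 0 then - z else
    (let P = (cdot z a / of_real ((norm a)\<^sup>2)) *s a; Q = z - P
     in (1 / (1 - cdot z a)) *s (a - P - of_real (sqrt (1 - (norm a)\<^sup>2)) *s Q)))"

definition berezin :: "real \<Rightarrow> (complex^'n::finite \<Rightarrow> 'e::banach) \<Rightarrow> complex^'n \<Rightarrow> 'e"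
  where "berezin \<alpha> b z =
    strong_bochner_integral (nu \<alpha>) (\<lambda>w. (cmod (normalized_kernel \<alpha> z w))\<^sup>2 *\<^sub>R b w)"

definition BMO1 :: "real \<Rightarrow> (complex^'n::finite \<Rightarrow> 'e::banach) set"
  where "BMO1 \<alpha> = {b \<in> Lp \<alpha> 1.
    (\<forall>z\<in>unit_ball. (\<lambda>w. b (phi z w) - berezin \<alpha> b z) \<in> Lp \<alpha> 1) \<and>
    bdd_above ((\<lambda>z. Lp_norm \<alpha> 1 (\<lambda>w. b (phi z w) - berezin \<alpha> b z)) ` unit_ball)}"

definition toeplitz_integral :: "real \<Rightarrow> (complex^'n::finite \<Rightarrow> ell2 \<Rightarrow>\<^sub>L ell2) \<Rightarrow> 'n operator"
  where "toeplitz_integral \<alpha> b f z = (if z \<in> unit_ball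
    then LINT w|nu \<alpha>. cnj (bergman_kernel \<alpha> z w) *\<^sub>C blinfun_apply (b w) (f w) else 0)"

text \<open>
  The bounded extension of the densely defined operator \<^term>\<open>toeplitz_integral \<alpha> b\<close>.  It is unique
  by density of \<^term>\<open>Hinfty\<close> in \<^term>\<open>A2 \<alpha>\<close>; it is set to zero off \<^term>\<open>A2 \<alpha>\<close> to make it unique
  as a HOL function.
\<close>

definition toeplitz :: "real \<Rightarrow> (complex^'n::finite \<Rightarrow> ell2 \<Rightarrow>\<^sub>L ell2) \<Rightarrow> 'n operator"
  where "toeplitz \<alpha> b = (THE T. T \<in> bounded_operators \<alpha> \<and>
    (\<forall>f\<in>Hinfty. T f = toeplitz_integral \<alpha> b f) \<and>
    (\<forall>f. f \<notin> A2 \<alpha> \<longrightarrow> T f = (\<lambda>_. 0)))"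


text \<open>The basis is indexed from 0: \<^term>\<open>e j\<close> is the basis vector number \<open>j + 1\<close>.\<close>

definition M_head :: "(nat \<Rightarrow> ell2) \<Rightarrow> nat \<Rightarrow> 'n::finite operator"
  where "M_head e d f z = (\<Sum>j<d. ell2_cinner (f z) (e j) *\<^sub>C e j)"

definition M_tail :: "(nat \<Rightarrow> ell2) \<Rightarrow> nat \<Rightarrow> 'n::finite operator"
  where "M_tail e d f z = (\<Sum>j. ell2_cinner (f z) (e (d + j)) *\<^sub>C e (d + j))"

definition Linfty_fin :: "(nat \<Rightarrow> ell2) \<Rightarrow> (complex^'n::finite \<Rightarrow> ell2 \<Rightarrow>\<^sub>L ell2) set"
  where "Linfty_fin e = {u.
    (\<forall>z\<in>unit_ball. u z \<in> clinear_operators) \<and>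
    finite {(j, k). \<exists>z\<in>unit_ball. ell2_cinner (blinfun_apply (u z) (e j)) (e k) \<noteq> 0} \<and>
    (\<forall>j k. bounded ((\<lambda>z. ell2_cinner (blinfun_apply (u z) (e j)) (e k)) ` unit_ball) \<and>
      (\<lambda>z. ell2_cinner (blinfun_apply (u z) (e j)) (e k))
        \<in> borel_measurable (lebesgue_on unit_ball))}"

definition toeplitz_polynomials :: "real \<Rightarrow> (nat \<Rightarrow> ell2) \<Rightarrow> 'n::finite operator set"
  where "toeplitz_polynomials \<alpha> e = {S. \<exists>(L::nat) (J::nat) u. L \<ge> 1 \<and> J \<ge> 1 \<and>
    (\<forall>l<L. \<forall>j<J. u j l \<in> Linfty_fin e) \<and>
    S = (\<lambda>f z. \<Sum>l<L. foldr (\<circ>) (map (\<lambda>j. toeplitz \<alpha> (u j l)) [0..<J]) id f z)}"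

definition toeplitz_algebra :: "real \<Rightarrow> (nat \<Rightarrow> ell2) \<Rightarrow> 'n::finite operator set"
  where "toeplitz_algebra \<alpha> e = {T \<in> bounded_operators \<alpha>.
    \<forall>\<epsilon>>0. \<exists>S\<in>toeplitz_polynomials \<alpha> e. operator_norm \<alpha> (\<lambda>f z. T f z - S f z) < \<epsilon>}"

end

(*
  By the boundedness of the Berezin transform, the BMO condition says that |b| nu is a Carleson
  measure: the integral of |b| against |k_z|^2 is bounded for almost every z.  Hence the form
  (f, h) |-> int <b f, h> is bounded on A2, and with the Bergman projection (a contraction by the
  reproducing property) this gives the bounded extension of T_b.

  The compression of T_b to the first d coordinates is a Toeplitz operator with finitely many
  scalar entries c, each of them Carleson.  Let u(z) be the weighted mean of c over the hyperbolic ball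
  phi_z(eB).  Then u is bounded and, by Fubini and the change of variables phi_w, int (c - u) f
  conj(g) is the integral of c(w) times the difference between f conj(g) at w and its mean over
  phi_w(eB).  By Schwarz's lemma and the sub-mean value property the latter is e times a local L2
  average of |f|^2 + |g|^2, so T_u tends to the compression in norm as e -> 0.  No products of
  Toeplitz operators are needed.  The second claim follows from T - MTM = T M' + M' T M with
  M = M_head, M' = M_tail.
*)
theory Submission
  imports Defs "HOL-Complex_Analysis.Complex_Analysis"
begin

section \<open>The automorphisms of the ball\<close>

text \<open>The obstacle is that an entry c of the symbol is only Carleson, hence possibly
  unbounded, whereas the symbols in \<open>Linfty_fin\<close> are bounded at every point. The
  averaging kernel is therefore normalised in its first variable: for fixed w it is the density of
  the normalised measure on the ball of radius \<epsilon> carried over by phi_w. Its adjoint is then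
  the exact mean over phi_w(\<epsilon> B), and the oscillation falls on the holomorphic functions,
  never on c. The Carleson condition enters twice with the same constant: it bounds u, and it turns
  local L2 averages into global norms. It holds only for almost every centre, so it is always
  applied under an integral over the centre, and u is corrected on a null set. The radii 1/4 and 1/2
  are fixed because a hyperbolic ball of radius 1/4 about a point of the ball of radius 1/4 stays in
  the ball of radius 1/2, where exchanging the arguments of the kernel costs 4^N. Operator bounds
  come from forms: if the form is at most A + |h|^2 / 2 for all h, the projected function has
  squared norm at most 2 A. The vector-valued Carleson embedding is obtained coordinate by
  coordinate.\<close>

lemma complex_scaleR: "r *\<^sub>R (z :: complex) = of_real r * z"
  by (rule scaleR_conv_of_real)

section \<open>Hermitian algebra on complex n-space\<close>

lemma cdot_add_left: "cdot (x + y) z = cdot x z + cdot y z"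
  by (simp add: cdot_def sum.distrib distrib_right)

lemma cdot_add_right: "cdot x (y + z) = cdot x y + cdot x z"
  by (simp add: cdot_def sum.distrib distrib_left)

lemma cdot_scale_left: "cdot (c *s x) z = c * cdot x z"
  by (simp add: cdot_def sum_distrib_left mult.assoc)

lemma cdot_scale_right: "cdot x (c *s y) = cnj c * cdot x y"
  by (simp add: cdot_def sum_distrib_left mult.left_commute)

lemma cdot_cnj: "cnj (cdot x y) = cdot y x"
  by (simp add: cdot_def mult.commute)

lemma scaleR_vec_complex: "r *\<^sub>R (x :: complex^'n::finite) = complex_of_real r *s x"
  by (simp add: vec_eq_iff complex_scaleR)

lemma cdot_scaleR_left: "cdot (r *\<^sub>R x) z = of_real r * cdot x z"
  by (simp add: scaleR_vec_complex cdot_scale_left)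

lemma cdot_scaleR_right: "cdot x (r *\<^sub>R z) = of_real r * cdot x z"
  by (simp add: scaleR_vec_complex cdot_scale_right)

lemma cdot_diff_left: "cdot (x - y) z = cdot x z - cdot y z"
  by (simp add: cdot_def sum_subtractf left_diff_distrib)

lemma cdot_diff_right: "cdot x (y - z) = cdot x y - cdot x z"
  by (simp add: cdot_def sum_subtractf right_diff_distrib)

lemma cdot_zero [simp]: "cdot 0 x = 0" "cdot x 0 = 0"
  by (simp_all add: cdot_def)

lemma Re_cdot: "Re (cdot x y) = inner x y"
  by (simp add: cdot_def inner_vec_def inner_complex_def)

lemma Im_cdot: "Im (cdot x y) = inner x (\<i> *s y)"
  by (simp add: cdot_scale_right flip: Re_cdot)

lemma cdot_self: "cdot x x = of_real ((norm x)\<^sup>2)"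
proof (rule complex_eqI)
  have "cdot x x \<in> \<real>"
    unfolding Reals_cnj_iff by (rule cdot_cnj)
  then show "Im (cdot x x) = Im (of_real ((norm x)\<^sup>2))"
    by (simp add: complex_is_Real_iff)
qed (simp add: Re_cdot power2_norm_eq_inner)

lemma norm_scale_vec: "norm (c *s (x :: complex^'n::finite)) = cmod c * norm x"
  unfolding norm_vec_def L2_set_def
  by (simp add: norm_mult power_mult_distrib real_sqrt_mult flip: sum_distrib_left)

text \<open>Multiplying \<open>x\<close> by the unimodular \<open>c\<close> makes the Hermitian
  product real and positive, which reduces the claim to the real Cauchy-Schwarz inequality.\<close>

lemma norm_cdot_le: "cmod (cdot x y) \<le> norm x * norm y"
proof (cases "cdot x y = 0")
  case False
  define c where "c = cnj (cdot x y) / cmod (cdot x y)"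
  have c: "cmod c = 1" using False by (simp add: c_def norm_divide)
  have "cmod (cdot x y) = Re (cdot (c *s x) y)"
    using False by (simp add: c_def cdot_scale_left complex_norm_square[symmetric] mult.commute
        power2_eq_square)
  also have "\<dots> \<le> norm (c *s x) * norm y"
    unfolding Re_cdot by (rule norm_cauchy_schwarz)
  finally show ?thesis by (simp add: norm_scale_vec c)
qed simp

lemma cmod_cdot_less_1:
  assumes "norm x < 1" "norm y < 1" shows "cmod (cdot x y) < 1"
proof -
  have "cmod (cdot x y) \<le> norm x * norm y" by (rule norm_cdot_le)
  also have "\<dots> \<le> norm x * 1" using assms by (intro mult_left_mono) auto
  finally show ?thesis using assms by simp
qed

lemma Re_one_minus_cdot_pos:
  assumes "norm x < 1" "norm y < 1" shows "Re (1 - cdot x y) > 0"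
  using cmod_cdot_less_1[OF assms] complex_Re_le_cmod[of "cdot x y"] by simp

lemma one_minus_cdot_nonpos:
  assumes "norm x < 1" "norm y < 1"
  shows "1 - cdot x y \<notin> \<real>\<^sub>\<le>\<^sub>0" and "1 - cdot x y \<noteq> 0" and "cmod (1 - cdot x y) > 0"
  using Re_one_minus_cdot_pos[OF assms] by (auto simp: complex_nonpos_Reals_iff)

lemma one_minus_cdot_ge: "1 - norm x * norm y \<le> cmod (1 - cdot x y)"
  using norm_cdot_le[of x y] norm_triangle_ineq2[of 1 "cdot x y"] by simp

lemma one_minus_cdot_le: "cmod (1 - cdot x y) \<le> 1 + norm x * norm y"
  using norm_cdot_le[of x y] norm_triangle_ineq4[of 1 "cdot x y"] by simp

lemma bounded_linear_cdot_left: "bounded_linear (\<lambda>x. cdot x y)"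
  by (rule bounded_linear_intro[where K="norm y"])
    (auto simp: cdot_add_left cdot_scaleR_left complex_scaleR norm_cdot_le)

lemma bounded_bilinear_cdot: "bounded_bilinear (cdot :: complex^'n::finite \<Rightarrow> _)"
proof (rule bounded_bilinear.intro)
  show "\<exists>K. \<forall>a b :: complex^'n. norm (cdot a b) \<le> norm a * norm b * K"
    by (rule exI[of _ 1]) (simp add: norm_cdot_le)
qed (auto simp: cdot_add_left cdot_add_right cdot_scaleR_left cdot_scaleR_right complex_scaleR)

lemma bounded_bilinear_scale_vec: "bounded_bilinear (\<lambda>c (x :: complex^'n::finite). c *s x)"
proof (rule bounded_bilinear.intro)
  show "\<exists>K. \<forall>a (b :: complex^'n). norm (a *s b) \<le> norm a * norm b * K"
    by (rule exI[of _ 1]) (simp add: norm_scale_vec)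
qed (simp_all add: vec_eq_iff algebra_simps complex_scaleR)

lemmas continuous_on_cdot [continuous_intros] =
  bounded_bilinear.continuous_on[OF bounded_bilinear_cdot]

lemmas continuous_on_scale_vec [continuous_intros] =
  bounded_bilinear.continuous_on[OF bounded_bilinear_scale_vec]

text \<open>Since division by zero is zero, this also covers the case \<open>a = 0\<close>.\<close>

lemma phi_altdef:
  "phi a z = (1 / (1 - cdot z a)) *s
     ((1 - (1 - of_real (sqrt (1 - (norm a)\<^sup>2))) * (cdot z a / of_real ((norm a)\<^sup>2))) *s a
      - of_real (sqrt (1 - (norm a)\<^sup>2)) *s z)"
proof (cases "a = 0")
  case True
  show ?thesis unfolding True by (simp add: phi_def vec_eq_iff)
next
  case False
  then show ?thesis unfolding phi_def Let_def if_not_P[OF False] by (simp add: vec_eq_iff algebra_simps)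
qed

section \<open>The involutions of the ball and their derivative\<close>

locale ball_point =
  fixes a :: "complex^'n::finite"
  assumes a: "norm a < 1"
begin

definition s :: real where "s = sqrt (1 - (norm a)\<^sup>2)"

lemma norm_a_sq: "(norm a)\<^sup>2 < 1"
  using a by (simp add: abs_square_less_1)

lemma s: "s > 0" "s\<^sup>2 = 1 - (norm a)\<^sup>2" "(of_real s :: complex)\<^sup>2 = 1 - of_real ((norm a)\<^sup>2)"
proof -
  show "s > 0" "s\<^sup>2 = 1 - (norm a)\<^sup>2" using norm_a_sq by (simp_all add: s_def)
  then show "(of_real s :: complex)\<^sup>2 = 1 - of_real ((norm a)\<^sup>2)"
    by (metis of_real_1 of_real_diff of_real_power)
qed

definition t :: "complex^'n \<Rightarrow> complex" where "t z = cdot z a / of_real ((norm a)\<^sup>2)"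

lemma t: "t z * of_real ((norm a)\<^sup>2) = cdot z a"
  by (cases "a = 0") (simp_all add: t_def)

lemma phi_eq: "phi a z = (1 / (1 - cdot z a)) *s ((1 - (1 - of_real s) * t z) *s a - of_real s *s z)"
  unfolding phi_altdef s_def t_def ..

lemma cdot_phi:
  assumes "norm z < 1"
  shows "cdot (phi a z) a = (of_real ((norm a)\<^sup>2) - cdot z a) / (1 - cdot z a)"
proof -
  have "cdot (phi a z) a = ((1 - (1 - of_real s) * t z) * of_real ((norm a)\<^sup>2) - of_real s * cdot z a) / (1 - cdot z a)"
    by (simp add: phi_eq cdot_scale_left cdot_diff_left cdot_self diff_divide_distrib left_diff_distrib)
  also have "(1 - (1 - of_real s) * t z) * of_real ((norm a)\<^sup>2) - of_real s * cdot z a = of_real ((norm a)\<^sup>2) - cdot z a"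
    by (simp add: t[symmetric] algebra_simps)
  finally show ?thesis .
qed

lemma one_minus_cdot_phi:
  assumes "norm z < 1"
  shows "1 - cdot (phi a z) a = of_real (1 - (norm a)\<^sup>2) / (1 - cdot z a)"
  using one_minus_cdot_nonpos(2)[OF assms a] by (simp add: cdot_phi[OF assms] field_simps)

text \<open>This identity gives the invariance of the ball and, later, the algebraic description of
  hyperbolic balls in \<open>near\<close>.\<close>

lemma norm_phi:
  assumes z: "norm z < 1"
  shows "1 - (norm (phi a z))\<^sup>2 = (1 - (norm a)\<^sup>2) * (1 - (norm z)\<^sup>2) / (cmod (1 - cdot z a))\<^sup>2"
proof -
  define T A S Z C where "T = t z" and "A = (of_real ((norm a)\<^sup>2) :: complex)"
    and "S = (of_real s :: complex)" and "Z = (of_real ((norm z)\<^sup>2) :: complex)" and "C = cnj (t z)"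
  define N where "N = (1 - (1 - S) * T) *s a - S *s z"
  have za: "cdot z a = T * A" "cdot a z = C * A" "cdot a a = A" "cdot z z = Z"
    using t[of z] unfolding T_def A_def C_def Z_def
    by (simp_all only: cdot_self) (metis cdot_cnj complex_cnj_complex_of_real complex_cnj_mult)
  have cnj: "cnj S = S" "cnj T = C" by (simp_all add: S_def T_def C_def)
  have S: "S\<^sup>2 = 1 - A" unfolding S_def A_def by (rule s)
  have "cdot N N = (1 - (1 - S) * T) * (1 - (1 - S) * C) * A - (1 - (1 - S) * T) * S * (C * A)
     - S * (1 - (1 - S) * C) * (T * A) + S * S * Z"
    unfolding N_def
    by (simp add: cdot_diff_left cdot_diff_right cdot_scale_left cdot_scale_right za cnj)
      (simp add: algebra_simps)
  \<comment> \<open>With the conjugate \<open>C\<close> treated as a letter independent of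
    \<open>T\<close>, this is a polynomial identity modulo the relation S^2 = 1 - A.\<close>
  then have N: "cdot N N = (1 - T * A) * (1 - C * A) - (1 - A) * (1 - Z)"
    using S by algebra
  have "of_real ((cmod (1 - cdot z a))\<^sup>2) = (1 - T * A) * cnj (1 - T * A)"
    unfolding complex_norm_square za by simp
  also have "cnj (1 - T * A) = 1 - C * A"
    by (simp add: T_def C_def A_def)
  finally have M: "complex_of_real ((cmod (1 - cdot z a))\<^sup>2) = (1 - T * A) * (1 - C * A)" .
  have "complex_of_real ((norm N)\<^sup>2) = of_real ((cmod (1 - cdot z a))\<^sup>2 - (1 - (norm a)\<^sup>2) * (1 - (norm z)\<^sup>2))"
    unfolding cdot_self[symmetric] N of_real_diff M of_real_mult A_def Z_def by simp
  then have "(norm N)\<^sup>2 = (cmod (1 - cdot z a))\<^sup>2 - (1 - (norm a)\<^sup>2) * (1 - (norm z)\<^sup>2)"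
    using of_real_eq_iff by blast
  moreover have "(norm (phi a z))\<^sup>2 = (norm N)\<^sup>2 / (cmod (1 - cdot z a))\<^sup>2"
    unfolding phi_eq N_def S_def T_def by (simp add: norm_scale_vec norm_divide power_divide
      del: vector_sub_rdistrib vector_ssub_ldistrib)
  ultimately show ?thesis
    using one_minus_cdot_nonpos(3)[OF z a] by (simp add: field_simps)
qed

lemma phi_in_ball:
  assumes z: "norm z < 1" shows "norm (phi a z) < 1"
proof -
  have "1 - (norm (phi a z))\<^sup>2 > 0"
    unfolding norm_phi[OF z] using one_minus_cdot_nonpos(3)[OF z a] a z
    by (intro divide_pos_pos mult_pos_pos) (auto simp: abs_square_less_1)
  then show ?thesis by (simp add: abs_square_less_1)
qed

lemma phi_phi:
  assumes z: "norm z < 1" shows "phi a (phi a z) = z"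
proof -
  define S A T where "S = (of_real s :: complex)" and "A = (of_real ((norm a)\<^sup>2) :: complex)"
    and "T = t z"
  define \<tau> where "\<tau> = cdot z a"
  have S: "S\<^sup>2 = 1 - A" unfolding S_def A_def by (rule s)
  have TA: "T * A = \<tau>" unfolding T_def A_def \<tau>_def by (rule t)
  have nz: "1 - \<tau> \<noteq> 0" unfolding \<tau>_def using one_minus_cdot_nonpos[OF z a] by simp
  have A1: "1 - A \<noteq> 0"
    using norm_a_sq unfolding A_def by (metis less_irrefl of_real_1 of_real_eq_iff right_minus_eq)
  have \<tau>': "1 - cdot (phi a z) a = (1 - A) / (1 - \<tau>)"
    using one_minus_cdot_phi[OF z] by (simp add: A_def \<tau>_def)
  have t': "t (phi a z) * A = (A - \<tau>) / (1 - \<tau>)"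
    using cdot_phi[OF z] t[of "phi a z"] by (simp add: A_def \<tau>_def)
  \<comment> \<open>This is, up to a factor, the coefficient of \<open>a\<close> in
    \<open>phi a (phi a z)\<close>, which must vanish. Multiplying by \<open>A\<close> removes the
    quotients hidden in \<open>t\<close>; for a = 0 the coefficient multiplies the zero
    vector.\<close>
  have *: "(1 - (1 - S) * t (phi a z)) * (1 - \<tau>) - S * (1 - (1 - S) * T) = 0" if "a \<noteq> 0"
  proof -
    have A0: "A \<noteq> 0" using that by (simp add: A_def)
    have t'': "t (phi a z) * A * (1 - \<tau>) = A - \<tau>" using t' nz by (simp add: field_simps)
    have "A * ((1 - (1 - S) * t (phi a z)) * (1 - \<tau>) - S * (1 - (1 - S) * T))
        = A * (1 - \<tau>) - (1 - S) * (A - \<tau>) - S * A + S * (1 - S) * \<tau>"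
      using t'' TA by algebra
    also have "\<dots> = 0" using S by algebra
    finally show ?thesis using A0 by simp
  qed
  have "phi a (phi a z) = ((1 - \<tau>) / (1 - A)) *s ((1 - (1 - S) * t (phi a z)) *s a - S *s
      ((1 / (1 - \<tau>)) *s ((1 - (1 - S) * T) *s a - S *s z)))"
    unfolding phi_eq[of "phi a z"] \<tau>' unfolding phi_eq[of z] \<tau>_def S_def T_def by simp
  also have "\<dots> = (1 / (1 - A)) *s (((1 - (1 - S) * t (phi a z)) * (1 - \<tau>) - S * (1 - (1 - S) * T)) *s a + S\<^sup>2 *s z)"
    using nz A1 by (simp add: vec_eq_iff divide_simps power2_eq_square) (simp add: algebra_simps)
  also have "\<dots> = (1 / (1 - A)) *s (S\<^sup>2 *s z)"
    using * by (cases "a = 0") (auto simp: vec_eq_iff)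
  also have "\<dots> = z"
    using A1 unfolding S by (simp add: vector_smult_assoc del: vector_sub_rdistrib)
  finally show ?thesis .
qed

lemma phi_0 [simp]: "phi a 0 = a"
  by (simp add: phi_eq t_def)

text \<open>The derivative is a scalar times v + <v,a> c, a rank-one perturbation of the identity;
  this form makes its determinant explicit. The vector c is \<open>dphi_vec z\<close>.\<close>

definition dphi_vec :: "complex^'n \<Rightarrow> complex^'n" where
  "dphi_vec z = ((1 / of_real s - 1) / of_real ((norm a)\<^sup>2)) *s a
      - (1 / (of_real s * (1 - cdot z a))) *s ((1 - (1 - of_real s) * t z) *s a - of_real s *s z)"

definition dphi :: "complex^'n \<Rightarrow> complex^'n \<Rightarrow> complex^'n" where
  "dphi z v = (- of_real s / (1 - cdot z a)) *s (v + cdot v a *s dphi_vec z)"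

text \<open>This is the complex determinant of the rank-one factor of \<open>dphi z\<close>.\<close>

lemma one_plus_cdot_dphi_vec:
  assumes z: "norm z < 1"
  shows "1 + cdot (dphi_vec z) a = of_real s / (1 - cdot z a)"
proof -
  define S A where "S = (of_real s :: complex)" and "A = (of_real ((norm a)\<^sup>2) :: complex)"
  define \<tau> where "\<tau> = cdot z a"
  have S: "S\<^sup>2 = 1 - A" unfolding S_def A_def by (rule s)
  have nz: "1 - \<tau> \<noteq> 0" unfolding \<tau>_def using one_minus_cdot_nonpos[OF z a] by simp
  have S0: "S \<noteq> 0" using s(1) by (simp add: S_def)
  have TA: "t z * A = \<tau>" unfolding A_def \<tau>_def by (rule t)
  have 1: "(1 - (1 - S) * t z) * A - S * \<tau> = A - \<tau>"
    by (simp add: TA[symmetric] algebra_simps)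
  \<comment> \<open>For a = 0 both sides vanish: the left one because division by zero gives 0, the
    right one because then S = 1.\<close>
  have 2: "(1 / S - 1) / A * A = 1 / S - 1"
  proof (cases "a = 0")
    case True
    have "s = 1" unfolding s_def using True by simp
    then have "S = 1" by (simp add: S_def)
    then show ?thesis by simp
  qed (simp add: A_def)
  have "1 + cdot (dphi_vec z) a = 1 + (1 / S - 1) / A * A - (1 / (S * (1 - \<tau>))) * ((1 - (1 - S) * t z) * A - S * \<tau>)"
    unfolding dphi_vec_def cdot_diff_left cdot_scale_left cdot_self A_def[symmetric] S_def[symmetric] \<tau>_def[symmetric]
    by (simp only: add_diff_eq)
  also have "\<dots> = 1 / S - (A - \<tau>) / (S * (1 - \<tau>))"
    unfolding 1 2 by simp
  also have "\<dots> = (1 - A) / (S * (1 - \<tau>))" using S0 nz by (simp add: field_simps)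
  also have "\<dots> = S / (1 - \<tau>)" using S0 nz by (simp add: S[symmetric] power2_eq_square)
  finally show ?thesis by (simp add: S_def \<tau>_def)
qed

lemma has_derivative_phi:
  assumes z: "norm z < 1"
  shows "(phi a has_derivative dphi z) (at z)"
proof -
  note bl = bounded_linear_cdot_left
  have d: "((\<lambda>z. cdot z a) has_derivative (\<lambda>v. cdot v a)) (at z)"
    by (rule bounded_linear_imp_has_derivative[OF bl])
  have nz: "1 - cdot z a \<noteq> 0" using one_minus_cdot_nonpos[OF z a] by simp
  have dt: "(t has_derivative t) (at z)"
    unfolding t_def[abs_def]
    by (rule bounded_linear_imp_has_derivative[OF bounded_linear_divide[THEN bounded_linear_compose, OF bl]])
  have dta: "((\<lambda>z. (1 - (1 - of_real s) * t z) *s a) has_derivative (\<lambda>v. (0 - (1 - of_real s) * t v) *s a)) (at z)"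
    by (rule bounded_linear.has_derivative[OF bounded_bilinear.bounded_linear_left[OF bounded_bilinear_scale_vec]])
      (intro derivative_intros dt)
  have dN: "((\<lambda>z. (1 - (1 - of_real s) * t z) *s a - of_real s *s z) has_derivative
      (\<lambda>v. (0 - (1 - of_real s) * t v) *s a - of_real s *s v)) (at z)"
    by (intro has_derivative_diff dta bounded_linear_imp_has_derivative
      bounded_bilinear.bounded_linear_right[OF bounded_bilinear_scale_vec])
  have dq: "((\<lambda>z. 1 / (1 - cdot z a)) has_derivative (\<lambda>v. cdot v a / (1 - cdot z a)\<^sup>2)) (at z)"
    using nz by (auto intro!: derivative_eq_intros d simp: field_simps power2_eq_square)
  have "(phi a has_derivative (\<lambda>v. (1 / (1 - cdot z a)) *s ((0 - (1 - of_real s) * t v) *s a - of_real s *s v)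
     + (cdot v a / (1 - cdot z a)\<^sup>2) *s ((1 - (1 - of_real s) * t z) *s a - of_real s *s z))) (at z)"
    unfolding phi_eq[abs_def]
    by (rule bounded_bilinear.FDERIV[OF bounded_bilinear_scale_vec dq dN])
  moreover have "(1 / (1 - cdot z a)) *s ((0 - (1 - of_real s) * t v) *s a - of_real s *s v)
     + (cdot v a / (1 - cdot z a)\<^sup>2) *s ((1 - (1 - of_real s) * t z) *s a - of_real s *s z) = dphi z v" for v
  proof -
    define X where "X = (1 - (1 - of_real s) * t z) *s a - of_real s *s z"
    have s0: "complex_of_real s \<noteq> 0" using s(1) by simp
    have "dphi z v = (- of_real s / (1 - cdot z a)) *s (v + (t v * (1 / of_real s - 1)) *s a
       - (cdot v a / (of_real s * (1 - cdot z a))) *s X)"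
      unfolding dphi_def dphi_vec_def X_def[symmetric] t_def[of v]
      by (simp add: vec_eq_iff algebra_simps)
    also have "\<dots> = (1 / (1 - cdot z a)) *s ((0 - (1 - of_real s) * t v) *s a - of_real s *s v)
     + (cdot v a / (1 - cdot z a)\<^sup>2) *s X"
      using s0 nz by (simp add: vec_eq_iff divide_simps power2_eq_square)
    finally show ?thesis unfolding X_def ..
  qed
  ultimately show ?thesis by simp
qed

lemma dphi_scale: "dphi z (c *s v) = c *s dphi z v"
  by (simp add: dphi_def cdot_scale_left vec_eq_iff algebra_simps)

lemma continuous_on_phi: "continuous_on (ball 0 1) (phi a)"
  by (intro continuous_at_imp_continuous_on ballI has_derivative_continuous[OF has_derivative_phi]) simp

end

section \<open>Change of variables\<close>

text \<open>Only column \<open>k\<close> differs from the identity matrix, so this is Cramer's rule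
  with the identity as coefficient matrix.\<close>

lemma det_rank_one_axis:
  fixes u :: "real^'n"
  shows "det (matrix (\<lambda>x. x + (x $ k) *\<^sub>R u)) = 1 + u $ k"
proof -
  have "matrix (\<lambda>x. x + (x $ k) *\<^sub>R u) = (\<chi> i j. if j = k then (mat 1 *v (axis k 1 + u)) $ i else mat 1 $ i $ j)"
    unfolding matrix_vector_mul_lid by (auto simp: matrix_def vec_eq_iff mat_def axis_def)
  then show ?thesis
    by (simp only: cramer_lemma) (simp add: axis_def)
qed

lemma det_matrix_compose:
  fixes f g :: "real^'n \<Rightarrow> real^'n"
  assumes "linear f" "linear g"
  shows "det (matrix (f \<circ> g)) = det (matrix f) * det (matrix g)"
  using assms by (simp add: matrix_compose det_mul)

lemma abs_det_orthogonal:
  fixes f :: "real^'n \<Rightarrow> real^'n"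
  shows "orthogonal_transformation f \<Longrightarrow> \<bar>det (matrix f)\<bar> = 1"
  using det_orthogonal_matrix[of "matrix f"]
  by (auto simp: orthogonal_transformation_matrix)

lemma linear_rank_one: "linear (\<lambda>x :: 'a::real_inner. x + inner v x *\<^sub>R u)"
  by (rule linearI) (auto simp: inner_add_right algebra_simps)

text \<open>An orthogonal map taking \<open>v\<close> to a multiple of a coordinate axis reduces
  this to \<open>det_rank_one_axis\<close>. Absolute values appear because that map may reverse
  orientation.\<close>

lemma abs_det_rank_one:
  fixes u v :: "real^'n"
  shows "\<bar>det (matrix (\<lambda>x. x + inner v x *\<^sub>R u))\<bar> = \<bar>1 + inner v u\<bar>"
proof -
  obtain k :: 'n where True by blast
  have "norm v = norm (norm v *\<^sub>R axis k (1::real))" by simp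
  then obtain R where R: "orthogonal_transformation R" "R v = norm v *\<^sub>R axis k (1::real)"
    by (rule orthogonal_transformation_exists) blast
  define R' where "R' = inv R"
  have lR: "linear R" using R(1) by (simp add: orthogonal_transformation_def)
  have "bij R" by (rule orthogonal_transformation_bij[OF R(1)])
  then have R': "orthogonal_transformation R'" "\<And>x. R' (R x) = x" "\<And>x. R (R' x) = x"
    unfolding R'_def by (simp_all add: R(1) orthogonal_transformation_inv bij_is_inj bij_is_surj surj_f_inv_f)
  have inR: "inner v x = norm v * (R x $ k)" for x
  proof -
    have "inner v x = inner (R v) (R x)" using R(1) by (simp add: orthogonal_transformation_def)
    also have "\<dots> = norm v * (R x $ k)" unfolding R(2) by (simp add: inner_axis')
    finally show ?thesis .
  qed
  define f where "f = (\<lambda>x :: real^'n. x + (x $ k) *\<^sub>R (norm v *\<^sub>R R u))"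
  have lf: "linear f"
    unfolding f_def by (rule linearI) (auto simp: algebra_simps vec_eq_iff)
  have lR': "linear R'" using R'(1) by (simp add: orthogonal_transformation_def)
  have "(\<lambda>x. x + inner v x *\<^sub>R u) = R' \<circ> (f \<circ> R)"
    by (auto simp: fun_eq_iff f_def inR linear_add[OF lR'] linear_cmul[OF lR'] R')
  then have "\<bar>det (matrix (\<lambda>x. x + inner v x *\<^sub>R u))\<bar> = \<bar>det (matrix R')\<bar> * (\<bar>det (matrix f)\<bar> * \<bar>det (matrix R)\<bar>)"
    by (simp add: det_matrix_compose linear_compose lR lf lR' abs_mult)
  also have "\<dots> = \<bar>det (matrix f)\<bar>"
    using R R' by (simp add: abs_det_orthogonal)
  also have "\<dots> = \<bar>1 + inner v u\<bar>"
    unfolding f_def det_rank_one_axis inR by simp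
  finally show ?thesis .
qed

lemma abs_det_rank_two:
  fixes v1 v2 c d :: "real^'n"
  assumes nz: "1 + inner v1 c \<noteq> 0"
  shows "\<bar>det (matrix (\<lambda>x. x + inner v1 x *\<^sub>R c + inner v2 x *\<^sub>R d))\<bar> =
    \<bar>(1 + inner v1 c) * (1 + inner v2 d) - inner v1 d * inner v2 c\<bar>"
proof -
  \<comment> \<open>With this choice \<open>f\<close> maps d - \<kappa> c to d, so that f o g is the
    given map. This is an elimination step with pivot 1 + inner v1 c.\<close>
  define \<kappa> where "\<kappa> = inner v1 d / (1 + inner v1 c)"
  define f g where "f = (\<lambda>x. x + inner v1 x *\<^sub>R c)" and "g = (\<lambda>x. x + inner v2 x *\<^sub>R (d - \<kappa> *\<^sub>R c))"
  have k: "\<kappa> * (1 + inner v1 c) = inner v1 d" using nz by (simp add: \<kappa>_def)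
  have "f (g x) = x + inner v1 x *\<^sub>R c + inner v2 x *\<^sub>R d" for x
  proof -
    have "f (g x) = x + inner v2 x *\<^sub>R (d - \<kappa> *\<^sub>R c) + (inner v1 x + inner v2 x * (inner v1 d - \<kappa> * inner v1 c)) *\<^sub>R c"
      by (simp add: f_def g_def inner_add_right inner_diff_right algebra_simps)
    also have "inner v1 d - \<kappa> * inner v1 c = \<kappa>" using k by (simp add: algebra_simps)
    finally show ?thesis by (simp add: algebra_simps)
  qed
  then have "(\<lambda>x. x + inner v1 x *\<^sub>R c + inner v2 x *\<^sub>R d) = f \<circ> g" by (simp add: fun_eq_iff)
  then have "\<bar>det (matrix (\<lambda>x. x + inner v1 x *\<^sub>R c + inner v2 x *\<^sub>R d))\<bar>
     = \<bar>1 + inner v1 c\<bar> * \<bar>1 + inner v2 (d - \<kappa> *\<^sub>R c)\<bar>"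
    by (simp add: det_matrix_compose abs_mult abs_det_rank_one linear_rank_one f_def g_def)
  also have "\<dots> = \<bar>(1 + inner v1 c) * (1 + inner v2 d - \<kappa> * inner v2 c)\<bar>"
    by (simp only: abs_mult inner_diff_right inner_scaleR_right add_diff_eq)
  also have "(1 + inner v1 c) * (1 + inner v2 d - \<kappa> * inner v2 c) = (1 + inner v1 c) * (1 + inner v2 d) - (\<kappa> * (1 + inner v1 c)) * inner v2 c"
    by (simp add: algebra_simps)
  finally show ?thesis by (simp only: k)
qed

text \<open>
  The change of variables theorem is only available on \<open>real ^ 'm\<close> with a well-ordered index type,
  so the space \<open>complex ^ 'n\<close> is identified with \<open>real ^ 'n bit0\<close> by an orthonormal
  change of basis.
\<close>

definition basis_bij :: "complex^'n::finite \<Rightarrow> real^('n bit0)" where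
  "basis_bij = (SOME h. bij_betw h Basis Basis)"

lemma basis_bij: "bij_betw (basis_bij :: complex^'n::finite \<Rightarrow> _) Basis Basis"
proof -
  have "card (Basis :: (complex^'n) set) = card (Basis :: (real^('n bit0)) set)"
    by (simp only: DIM_cart DIM_complex DIM_real card_bit0)
  then have "\<exists>h. bij_betw h (Basis :: (complex^'n) set) (Basis :: (real^('n bit0)) set)"
    by (rule finite_same_card_bij[OF finite_Basis finite_Basis])
  then show ?thesis unfolding basis_bij_def by (rule someI_ex[of "\<lambda>h. bij_betw h Basis Basis"])
qed

definition real_of_vec :: "complex^'n::finite \<Rightarrow> real^('n bit0)" where
  "real_of_vec x = (\<Sum>b\<in>Basis. inner x b *\<^sub>R basis_bij b)"

definition vec_of_real :: "real^('n::finite bit0) \<Rightarrow> complex^'n" where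
  "vec_of_real y = (\<Sum>b\<in>Basis. inner y (basis_bij b) *\<^sub>R b)"

lemma inner_basis_bij:
  assumes "b \<in> Basis" "b' \<in> Basis"
  shows "inner (basis_bij b) (basis_bij b') = (if b = b' then 1 else 0)"
proof -
  have "basis_bij b \<in> Basis" "basis_bij b' \<in> Basis" "basis_bij b = basis_bij b' \<longleftrightarrow> b = b'"
    using assms bij_betwE[OF basis_bij] inj_on_eq_iff[OF bij_betw_imp_inj_on[OF basis_bij]] by auto
  then show ?thesis by (simp add: inner_Basis)
qed

lemma inner_real_of_vec: "b \<in> Basis \<Longrightarrow> inner (real_of_vec x) (basis_bij b) = inner x b"
  by (simp add: real_of_vec_def inner_sum_left inner_basis_bij if_distrib cong: if_cong)

lemma inner_vec_of_real: "b \<in> Basis \<Longrightarrow> inner (vec_of_real y) b = inner y (basis_bij b)"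
  by (simp add: vec_of_real_def inner_sum_left inner_Basis if_distrib cong: if_cong)

lemma vec_of_real_of_vec [simp]: "vec_of_real (real_of_vec x) = x"
  by (rule euclidean_eqI) (simp add: inner_vec_of_real inner_real_of_vec)

lemma real_of_vec_of_real [simp]: "real_of_vec (vec_of_real y) = (y :: real^('n::finite bit0))"
proof (rule euclidean_eqI)
  fix b' :: "real^('n::finite bit0)" assume "b' \<in> Basis"
  then obtain b :: "complex^'n" where "b \<in> Basis" "b' = basis_bij b"
    using basis_bij by (metis bij_betw_imp_surj_on imageE)
  then show "inner (real_of_vec (vec_of_real y)) b' = inner y b'"
    by (simp add: inner_vec_of_real inner_real_of_vec)
qed

lemma vimage_vec_of_real: "vec_of_real -` T = real_of_vec ` T"
proof
  show "vec_of_real -` T \<subseteq> real_of_vec ` T"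
  proof
    fix x assume "x \<in> vec_of_real -` T"
    then show "x \<in> real_of_vec ` T" by (intro image_eqI[of _ _ "vec_of_real x"]) auto
  qed
qed auto

lemma linear_real_of_vec: "linear real_of_vec"
  by (rule linearI) (auto simp: real_of_vec_def inner_add_left scaleR_add_left sum.distrib scaleR_sum_right)

lemma linear_vec_of_real: "linear vec_of_real"
  by (rule linearI) (auto simp: vec_of_real_def inner_add_left scaleR_add_left sum.distrib scaleR_sum_right)

lemma inner_real_of_vec_cong: "inner (real_of_vec x) (real_of_vec y) = inner x y"
proof -
  have "inner (real_of_vec x) (real_of_vec y) = (\<Sum>b\<in>Basis. inner x b * inner (basis_bij b) (real_of_vec y))"
    by (subst (1) real_of_vec_def) (simp add: inner_sum_left)
  also have "\<dots> = (\<Sum>b\<in>Basis. inner x b * inner y b)"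
    by (intro sum.cong refl) (metis inner_commute inner_real_of_vec)
  also have "\<dots> = inner x y" by (rule euclidean_inner[symmetric])
  finally show ?thesis .
qed

lemma inner_vec_of_real_cong: "inner (vec_of_real x) (vec_of_real y) = inner x y"
  using inner_real_of_vec_cong[of "vec_of_real x" "vec_of_real y"] by simp

lemma bounded_linear_real_of_vec: "bounded_linear real_of_vec"
  using linear_real_of_vec linear_linear by blast

lemma bounded_linear_vec_of_real: "bounded_linear vec_of_real"
  using linear_vec_of_real linear_linear by blast

lemma measurable_real_of_vec [measurable]: "real_of_vec \<in> borel_measurable borel"
  by (intro borel_measurable_continuous_onI linear_continuous_on bounded_linear_real_of_vec)

lemma measurable_vec_of_real [measurable]: "vec_of_real \<in> borel_measurable borel"
  by (intro borel_measurable_continuous_onI linear_continuous_on bounded_linear_vec_of_real)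

text \<open>Orthonormal coordinates match boxes with boxes of the same side lengths, and boxes
  determine Lebesgue measure.\<close>

lemma lborel_distr_real_of_vec: "distr lborel borel real_of_vec = (lborel :: (real^('n::finite bit0)) measure)"
proof (rule lborel_eqI[symmetric])
  fix l u :: "real^('n::finite bit0)"
  assume le: "\<And>b. b \<in> Basis \<Longrightarrow> inner l b \<le> inner u b"
  have B: "Basis = basis_bij ` (Basis :: (complex^'n) set)"
    by (rule bij_betw_imp_surj_on[OF basis_bij, symmetric])
  have inj: "inj_on (basis_bij :: complex^'n \<Rightarrow> _) Basis"
    by (rule bij_betw_imp_inj_on[OF basis_bij])
  have "real_of_vec -` box l u = (box (vec_of_real l) (vec_of_real u) :: (complex^'n) set)"
    unfolding box_def B by (auto simp: inner_real_of_vec inner_vec_of_real)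
  then have "emeasure (distr lborel borel real_of_vec) (box l u) =
      emeasure lborel (box (vec_of_real l) (vec_of_real u) :: (complex^'n) set)"
    by (subst emeasure_distr) simp_all
  also have "\<dots> = (\<Prod>b\<in>(Basis :: (complex^'n) set). inner (vec_of_real u - vec_of_real l) b)"
    using le by (intro emeasure_lborel_box) (simp add: B inner_vec_of_real)
  also have "(\<Prod>b\<in>(Basis :: (complex^'n) set). inner (vec_of_real u - vec_of_real l) b) = (\<Prod>b\<in>Basis. inner (u - l) b)"
    unfolding B by (simp add: prod.reindex[OF inj] inner_diff_left inner_vec_of_real)
  finally show "emeasure (distr lborel borel (real_of_vec :: complex^'n \<Rightarrow> _)) (box l u) = (\<Prod>b\<in>Basis. inner (u - l) b)" .
qed simp

lemma emeasure_lborel_vec_of_real: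
  assumes "S \<in> sets borel"
  shows "emeasure lborel (vec_of_real -` S) = emeasure (lborel :: (complex^'n::finite) measure) S"
proof -
  have [measurable]: "vec_of_real -` S \<in> sets borel"
    using measurable_sets[OF measurable_vec_of_real assms] by simp
  have "emeasure lborel (vec_of_real -` S) = emeasure (distr lborel borel (real_of_vec :: complex^'n \<Rightarrow> _)) (vec_of_real -` S)"
    by (simp add: lborel_distr_real_of_vec)
  also have "\<dots> = emeasure lborel (real_of_vec -` (vec_of_real -` S))"
    by (subst emeasure_distr) simp_all
  also have "real_of_vec -` (vec_of_real -` S) = S" by auto
  finally show ?thesis .
qed

text \<open>The real determinant of a complex linear map is the squared modulus of its complex
  determinant. Over the reals the rank-one term has rank two: the real and imaginary parts of <v,a>
  are the inner products with \<open>a\<close> and \<open>\<i> *s a\<close>. Positivity of the real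
  part provides the pivot for \<open>abs_det_rank_two\<close>.\<close>

lemma abs_det_complex_rank_one:
  fixes c a :: "complex^'n::finite"
  assumes "Re (1 + cdot c a) > 0" "m \<noteq> 0"
  shows "\<bar>det (matrix (real_of_vec \<circ> (\<lambda>v. m *s (v + cdot v a *s c)) \<circ> vec_of_real))\<bar> =
    cmod m ^ (2 * CARD('n)) * (cmod (1 + cdot c a))\<^sup>2"
proof -
  define r where "r = cmod m"
  have r: "r > 0" using assms by (simp add: r_def)
  \<comment> \<open>The unimodular part of \<open>m\<close> acts as an orthogonal map, so only |m|
    enters the determinant.\<close>
  define U :: "real^('n::finite bit0) \<Rightarrow> _" where "U = real_of_vec \<circ> (\<lambda>v. (m / r) *s v) \<circ> vec_of_real"
  define M where "M = (\<lambda>x. x + inner (real_of_vec a) x *\<^sub>R real_of_vec c + inner (real_of_vec (\<i> *s a)) x *\<^sub>R real_of_vec (\<i> *s c))"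
  have lin: "linear (\<lambda>v :: complex^'n. c *s v)" for c
    by (rule linearI) (auto simp: vec_eq_iff algebra_simps)
  have lU: "linear U"
    unfolding U_def by (intro linear_compose linear_vec_of_real linear_real_of_vec lin)
  have "inner (c *s x) (c *s y) = inner x y" if "cmod c = 1" for c and x y :: "complex^'n"
  proof -
    have "cdot (c *s x) (c *s y) = (c * cnj c) * cdot x y"
      by (simp add: cdot_scale_left cdot_scale_right)
    also have "c * cnj c = 1" using that by (simp add: complex_norm_square[symmetric])
    finally show ?thesis by (simp flip: Re_cdot)
  qed
  moreover have "cmod (m / r) = 1" using r by (simp add: r_def norm_divide)
  ultimately have oU: "orthogonal_transformation U"
    using lU by (auto simp: orthogonal_transformation_def U_def inner_real_of_vec_cong inner_vec_of_real_cong)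
  have lM: "linear M"
    unfolding M_def by (rule linearI) (auto simp: inner_add_right algebra_simps)
  have lr: "linear (\<lambda>x :: real^('n::finite bit0). r *\<^sub>R x)" by (rule linearI) (auto simp: algebra_simps)
  have "real_of_vec \<circ> (\<lambda>v. m *s (v + cdot v a *s c)) \<circ> vec_of_real = (\<lambda>x. r *\<^sub>R x) \<circ> (U \<circ> M)"
  proof
    fix x :: "real^('n::finite bit0)"
    define v where "v = vec_of_real x"
    have x: "x = real_of_vec v" by (simp add: v_def)
    have e: "cdot v a = of_real (inner v a) + \<i> * of_real (inner v (\<i> *s a))"
      by (simp add: complex_eq_iff Re_cdot Im_cdot)
    have "v + cdot v a *s c = v + inner a v *\<^sub>R c + inner (\<i> *s a) v *\<^sub>R (\<i> *s c)"
      by (simp add: vec_eq_iff complex_scaleR e inner_commute[of a] inner_commute[of "\<i> *s a"] algebra_simps)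
    then have "vec_of_real (M x) = v + cdot v a *s c"
      by (simp add: M_def x inner_real_of_vec_cong linear_add[OF linear_vec_of_real] linear_cmul[OF linear_vec_of_real])
    then have "((\<lambda>x. r *\<^sub>R x) \<circ> (U \<circ> M)) x = real_of_vec (r *\<^sub>R ((m / r) *s (v + cdot v a *s c)))"
      by (simp add: U_def linear_cmul[OF linear_real_of_vec])
    also have "r *\<^sub>R ((m / r) *s (v + cdot v a *s c)) = m *s (v + cdot v a *s c)"
      using r by (simp add: vec_eq_iff complex_scaleR distrib_left)
    finally show "(real_of_vec \<circ> (\<lambda>v. m *s (v + cdot v a *s c)) \<circ> vec_of_real) x = ((\<lambda>x. r *\<^sub>R x) \<circ> (U \<circ> M)) x"
      by (simp add: v_def)
  qed
  then have "\<bar>det (matrix (real_of_vec \<circ> (\<lambda>v. m *s (v + cdot v a *s c)) \<circ> vec_of_real))\<bar>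
      = \<bar>det (matrix (\<lambda>x :: real^('n::finite bit0). r *\<^sub>R x))\<bar> * (\<bar>det (matrix U)\<bar> * \<bar>det (matrix M)\<bar>)"
    by (simp add: det_matrix_compose linear_compose lU lM lr abs_mult)
  also have "\<bar>det (matrix (\<lambda>x :: real^('n::finite bit0). r *\<^sub>R x))\<bar> = r ^ (2 * CARD('n))"
    using r by (simp add: det_matrix_scaleR)
  also have "\<bar>det (matrix U)\<bar> = 1" by (rule abs_det_orthogonal[OF oU])
  also have "\<bar>det (matrix M)\<bar> = (cmod (1 + cdot c a))\<^sup>2"
  proof -
    have 1: "inner a c = Re (cdot c a)" "inner (\<i> *s a) c = Im (cdot c a)"
       "inner a (\<i> *s c) = - Im (cdot c a)" "inner (\<i> *s a) (\<i> *s c) = Re (cdot c a)"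
      using Re_cdot[of c a] Im_cdot[of c a] Re_cdot[of "\<i> *s c" a] Im_cdot[of "\<i> *s c" a]
      by (simp_all add: cdot_scale_left inner_commute)
    show ?thesis
      unfolding M_def
      by (subst abs_det_rank_two)
        (use assms(1) in \<open>simp_all add: inner_real_of_vec_cong 1 cmod_power2\<close>, simp add: power2_eq_square)
  qed
  finally show ?thesis by (simp only: r_def mult_1_left)
qed

section \<open>The real Jacobian of the involutions and the transformation of integrals\<close>

context ball_point
begin

definition jac :: "complex^'n \<Rightarrow> real" where
  "jac z = ((1 - (norm a)\<^sup>2) / (cmod (1 - cdot z a))\<^sup>2) ^ (CARD('n) + 1)"

lemma continuous_on_jac: "continuous_on (ball 0 1) jac"
  unfolding jac_def using one_minus_cdot_nonpos(3)[OF _ a] by (intro continuous_intros) auto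

lemma abs_det_dphi:
  assumes z: "norm z < 1"
  shows "\<bar>det (matrix (real_of_vec \<circ> dphi z \<circ> vec_of_real))\<bar> = jac z"
proof -
  define q where "q = cmod (1 - cdot z a)"
  have q: "q > 0" unfolding q_def by (rule one_minus_cdot_nonpos(3)[OF z a])
  have "Re (of_real s / (1 - cdot z a)) > 0"
    using s(1) Re_one_minus_cdot_pos[OF z a] q by (simp add: Re_divide q_def sum_power2_gt_zero_iff cmod_def)
  then have "\<bar>det (matrix (real_of_vec \<circ> dphi z \<circ> vec_of_real))\<bar> =
     cmod (- of_real s / (1 - cdot z a)) ^ (2 * CARD('n)) * (cmod (of_real s / (1 - cdot z a)))\<^sup>2"
    unfolding dphi_def[abs_def]
    using s(1) one_minus_cdot_nonpos(2)[OF z a]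
    by (subst abs_det_complex_rank_one) (simp_all add: one_plus_cdot_dphi_vec[OF z])
  \<comment> \<open>The scalar contributes s / q once for each of the n complex dimensions, the
    rank-one factor once more, and the real determinant squares everything.\<close>
  also have "\<dots> = (s / q) ^ (2 * (CARD('n) + 1))"
    using s(1) by (simp add: norm_divide q_def power_divide power_add power2_eq_square mult_ac)
  also have "\<dots> = (s\<^sup>2 / q\<^sup>2) ^ (CARD('n) + 1)"
    by (simp only: power_mult power_divide)
  finally show ?thesis unfolding jac_def q_def s .
qed

lemma emeasure_phi_image:
  assumes S: "S \<in> sets borel" "S \<subseteq> ball 0 1"
  shows "emeasure lborel (phi a ` S) = (\<integral>\<^sup>+z\<in>S. jac z \<partial>lborel)"
proof -
  define g where "g = real_of_vec \<circ> phi a \<circ> vec_of_real"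
  define R where "R = vec_of_real -` S"
  have R: "R \<in> sets borel"
    unfolding R_def using measurable_sets[OF measurable_vec_of_real S(1)] by simp
  have RS: "norm (vec_of_real x) < 1" if "x \<in> R" for x using that S(2) by (auto simp: R_def)
  have S1: "norm x < 1" if "x \<in> S" for x using that S(2) by auto
  \<comment> \<open>As \<open>phi a\<close> is its own inverse, the image is a preimage and hence
    Borel.\<close>
  have phiS: "phi a ` S = phi a -` S \<inter> ball 0 1"
    using S1 phi_phi phi_in_ball by (force intro: image_eqI[of _ _ "phi a _"])
  then have mS: "phi a ` S \<in> sets borel"
    using measurable_sets[OF borel_measurable_continuous_on_restrict[OF continuous_on_phi] S(1)]
    by (simp add: space_restrict_space sets_restrict_space_iff)
  have gR: "g ` R = vec_of_real -` (phi a ` S)"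
    unfolding g_def R_def vimage_vec_of_real by (simp add: image_comp comp_def)
  have der: "(g has_derivative real_of_vec \<circ> dphi (vec_of_real x) \<circ> vec_of_real) (at x within R)" if "x \<in> R" for x
    unfolding g_def
    by (rule has_derivative_at_withinI, intro diff_chain_at bounded_linear_imp_has_derivative
      bounded_linear_vec_of_real bounded_linear_real_of_vec has_derivative_phi RS that)
  have inj: "inj_on g R"
    by (rule inj_on_inverseI[of _ g]) (simp add: g_def phi_phi RS)
  have "emeasure lborel (g ` R) = emeasure lborel (phi a ` S)"
    unfolding gR by (rule emeasure_lborel_vec_of_real[OF mS])
  also have "\<dots> \<le> emeasure lborel (ball 0 1 :: (complex^'n) set)"
    using S1 phi_in_ball by (intro emeasure_mono) auto
  finally have fin: "emeasure lborel (g ` R) < \<infinity>"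
    using emeasure_lborel_ball_finite[of "0 :: complex^'n" 1] by order
  have gRb: "g ` R \<in> sets borel"
    unfolding gR using measurable_sets[OF measurable_vec_of_real mS] by simp
  then have lm: "g ` R \<in> lmeasurable"
    using fin by (simp add: fmeasurable_def)
  define m where "m = measure lebesgue (g ` R)"
  have hi: "((\<lambda>x. \<bar>det (matrix (real_of_vec \<circ> dphi (vec_of_real x) \<circ> vec_of_real))\<bar>) has_integral m) R"
    using has_measure_differentiable_image[OF _ der inj, of m] R lm by (simp add: m_def)
  have "((\<lambda>x. jac (vec_of_real x)) has_integral m) R"
    by (rule has_integral_eq[OF _ hi]) (simp add: abs_det_dphi RS)
  then have hi': "((\<lambda>x. jac (vec_of_real x) * indicator R x) has_integral m) UNIV"
    unfolding has_integral_restrict_UNIV[symmetric, where s=R]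
    by (rule has_integral_eq[rotated]) (auto simp: indicator_def)
  have jp: "jac z \<ge> 0" for z
    unfolding jac_def using norm_a_sq by (intro zero_le_power divide_nonneg_nonneg) auto
  have bm: "(\<lambda>z. jac z * indicator S z) \<in> borel_measurable borel"
  proof -
    have "(\<lambda>z. indicator (ball 0 1) z *\<^sub>R jac z) \<in> borel_measurable borel"
      by (rule borel_measurable_continuous_on_indicator[OF _ continuous_on_jac]) simp
    then have "(\<lambda>z. (indicator (ball 0 1) z *\<^sub>R jac z) * indicator S z) \<in> borel_measurable borel"
      using S(1) by (intro borel_measurable_times) auto
    also have "(\<lambda>z. (indicator (ball 0 1) z *\<^sub>R jac z) * indicator S z) = (\<lambda>z. jac z * indicator S z)"
      using S(2) by (auto simp: fun_eq_iff indicator_def)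
    finally show ?thesis .
  qed
  have ind: "indicator R x = (indicator S (vec_of_real x) :: real)" for x
    by (simp add: R_def indicator_def)
  have "(\<integral>\<^sup>+x. ennreal (jac x * indicator S x) \<partial>lborel) =
     (\<integral>\<^sup>+x. ennreal (jac (vec_of_real x) * indicator R x) \<partial>distr lborel borel real_of_vec)"
    by (subst nn_integral_distr) (use bm in \<open>auto simp: ind intro: measurable_compose[OF measurable_vec_of_real]\<close>)
  also have "\<dots> = ennreal m"
    unfolding lborel_distr_real_of_vec
    by (rule nn_integral_has_integral_lborel[OF _ _ hi'])
      (use bm in \<open>auto simp: ind jp intro: measurable_compose[OF measurable_vec_of_real]\<close>)
  also have "ennreal m = emeasure lborel (g ` R)"
    unfolding m_def using fin gRb by (simp add: emeasure_eq_ennreal_measure less_top measure_completion)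
  also have "\<dots> = emeasure lborel (phi a ` S)"
    unfolding gR by (rule emeasure_lborel_vec_of_real[OF mS])
  finally show ?thesis
    by (simp add: ennreal_mult' jp ennreal_indicator)
qed

lemma nn_integral_phi:
  assumes h: "h \<in> borel_measurable borel"
  shows "(\<integral>\<^sup>+z\<in>ball 0 1. h (phi a z) \<partial>lborel) = (\<integral>\<^sup>+z\<in>ball 0 1. (h z * jac z) \<partial>lborel)"
proof -
  let ?B = "ball 0 1 :: (complex^'n) set"
  define M where "M = restrict_space lborel ?B"
  have jM [measurable]: "jac \<in> borel_measurable M"
    unfolding M_def using borel_measurable_continuous_on_restrict[OF continuous_on_jac]
    by (simp cong: measurable_cong_sets add: sets_restrict_space)
  have pM: "phi a \<in> measurable M borel"
    unfolding M_def using borel_measurable_continuous_on_restrict[OF continuous_on_phi]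
    by (simp cong: measurable_cong_sets add: sets_restrict_space)
  have sM: "space M = ?B" by (simp add: M_def space_restrict_space)
  \<comment> \<open>It suffices to compare the push-forwards on Borel sets. A preimage under the
    involution is an image, so the density is \<open>jac\<close> itself, with no inverse map in its
    argument.\<close>
  have eq: "distr M borel (phi a) = distr (density M jac) borel (\<lambda>z. z)"
  proof (rule measure_eqI)
    fix S assume "S \<in> sets (distr M borel (phi a))"
    then have S: "S \<in> sets borel" by simp
    have iM: "(\<lambda>z. z) \<in> measurable M borel"
      unfolding M_def by (intro measurable_restrict_space1) simp
    have "emeasure (distr M borel (phi a)) S = emeasure M (phi a -` S \<inter> ?B)"
      using S pM by (simp add: emeasure_distr sM)
    also have "\<dots> = emeasure lborel (phi a -` S \<inter> ?B)"
      unfolding M_def by (subst emeasure_restrict_space) auto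
    also have "phi a -` S \<inter> ?B = phi a ` (S \<inter> ?B)"
      using phi_phi phi_in_ball by (force intro: image_eqI[of _ _ "phi a _"])
    also have "emeasure lborel \<dots> = (\<integral>\<^sup>+z\<in>S \<inter> ?B. jac z \<partial>lborel)"
      using S by (intro emeasure_phi_image) auto
    also have "\<dots> = (\<integral>\<^sup>+z\<in>S. jac z \<partial>M)"
      unfolding M_def by (subst nn_integral_restrict_space) (auto intro!: nn_integral_cong simp: indicator_def)
    also have "\<dots> = emeasure (density M jac) (S \<inter> ?B)"
      using measurable_sets[OF iM S]
      by (subst emeasure_density) (auto simp: sM intro!: nn_integral_cong simp: indicator_def)
    also have "\<dots> = emeasure (distr (density M jac) borel (\<lambda>z. z)) S"
      using S iM by (subst emeasure_distr) (auto simp: sM)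
    finally show "emeasure (distr M borel (phi a)) S = emeasure (distr (density M jac) borel (\<lambda>z. z)) S" .
  qed simp
  have iM: "(\<lambda>z. z) \<in> measurable M borel"
    unfolding M_def by (intro measurable_restrict_space1) simp
  have "(\<integral>\<^sup>+z. h (phi a z) \<partial>M) = (\<integral>\<^sup>+z. h z \<partial>distr M borel (phi a))"
    using h pM by (subst nn_integral_distr) auto
  also have "\<dots> = (\<integral>\<^sup>+z. h z \<partial>density M jac)"
    unfolding eq using h iM by (subst nn_integral_distr) auto
  also have "\<dots> = (\<integral>\<^sup>+z. jac z * h z \<partial>M)"
    using h iM by (subst nn_integral_density) auto
  finally have "(\<integral>\<^sup>+z. h (phi a z) \<partial>M) = (\<integral>\<^sup>+z. jac z * h z \<partial>M)" .
  then show ?thesis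
    unfolding M_def by (simp add: nn_integral_restrict_space mult.commute)
qed

end

section \<open>Square-summable sequences\<close>

lemma ell2_nth_simps [simp]:
  "ell2_nth (x + y) i = ell2_nth x i + ell2_nth y i"
  "ell2_nth (x - y) i = ell2_nth x i - ell2_nth y i"
  "ell2_nth (- x) i = - ell2_nth x i"
  "ell2_nth 0 i = 0"
  "ell2_nth (c *\<^sub>C x) i = c * ell2_nth x i"
  "ell2_nth (r *\<^sub>R x) i = of_real r * ell2_nth x i"
  by (simp_all add: plus_ell2.rep_eq ell2_nth_minus uminus_ell2.rep_eq zero_ell2.rep_eq
      ell2_scaleC.rep_eq scaleR_ell2_def)

lemma norm_scaleC [simp]: "norm (c *\<^sub>C x) = cmod c * norm (x :: ell2)"
proof -
  have "(norm (c *\<^sub>C x))\<^sup>2 = (cmod c * norm x)\<^sup>2"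
    unfolding norm_ell2_sq power_mult_distrib
    using suminf_mult[OF summable_ell2[of x], of "(cmod c)\<^sup>2"]
    by (simp add: norm_mult power_mult_distrib)
  then show ?thesis by simp
qed

lemma scaleC_simps:
  "c *\<^sub>C (x + y) = c *\<^sub>C x + c *\<^sub>C (y :: ell2)" "(c + d) *\<^sub>C x = c *\<^sub>C x + d *\<^sub>C x"
  "c *\<^sub>C (x - y) = c *\<^sub>C x - c *\<^sub>C y" "(c - d) *\<^sub>C x = c *\<^sub>C x - d *\<^sub>C x"
  "c *\<^sub>C d *\<^sub>C x = (c * d) *\<^sub>C x" "1 *\<^sub>C x = x" "0 *\<^sub>C x = 0" "c *\<^sub>C (0 :: ell2) = 0"
  by (rule ell2_eqI; simp add: algebra_simps)+

lemma bounded_bilinear_scaleC: "bounded_bilinear ((*\<^sub>C) :: complex \<Rightarrow> ell2 \<Rightarrow> ell2)"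
proof (rule bounded_bilinear.intro)
  show "\<exists>K. \<forall>a (b :: ell2). norm (a *\<^sub>C b) \<le> norm a * norm b * K"
    by (rule exI[of _ 1]) simp
qed (auto intro!: ell2_eqI simp: algebra_simps complex_scaleR)

lemmas continuous_on_scaleC [continuous_intros] =
  bounded_bilinear.continuous_on[OF bounded_bilinear_scaleC]

lemma borel_measurable_scaleC [measurable (raw)]:
  assumes "f \<in> borel_measurable M" "g \<in> borel_measurable M"
  shows "(\<lambda>x. f x *\<^sub>C (g x :: ell2)) \<in> borel_measurable M"
  using borel_measurable_continuous_Pair[OF assms, of "\<lambda>c x. c *\<^sub>C x"]
  by (simp add: continuous_on_scaleC continuous_on_fst continuous_on_snd)

lemma inner_scaleC: "inner (c *\<^sub>C x) y = inner x (cnj c *\<^sub>C (y :: ell2))"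
  unfolding inner_ell2_alt by (simp add: mult_ac)

lemma bounded_linear_nth: "bounded_linear (\<lambda>x. ell2_nth x i)"
  by (rule bounded_linear_intro[where K=1]) (auto simp: complex_scaleR cmod_ell2_nth_le)

lemma measurable_ell2_nth [measurable]: "(\<lambda>x. ell2_nth x i) \<in> borel_measurable borel"
  by (intro borel_measurable_continuous_onI linear_continuous_on bounded_linear_nth)

lemma cinner_add_left: "ell2_cinner (x + y) z = ell2_cinner x z + ell2_cinner y z"
  unfolding ell2_cinner_def
  by (subst suminf_add[OF summable_ell2_cinner summable_ell2_cinner]) (simp add: algebra_simps)

lemma cinner_scaleC_left: "ell2_cinner (c *\<^sub>C x) z = c * ell2_cinner x z"
  unfolding ell2_cinner_def
  by (subst suminf_mult[OF summable_ell2_cinner, symmetric]) (simp add: algebra_simps)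

lemma cinner_cnj: "cnj (ell2_cinner x y) = ell2_cinner y x"
  unfolding ell2_cinner_def
  by (subst bounded_linear.suminf[OF bounded_linear_cnj summable_ell2_cinner]) (simp add: mult.commute)

lemma Re_cinner: "Re (ell2_cinner x y) = inner x y"
  by (simp add: inner_ell2_def)

lemma norm_cinner_le: "cmod (ell2_cinner x y) \<le> norm x * norm y"
proof (cases "ell2_cinner x y = 0")
  case False
  define c where "c = cnj (ell2_cinner x y) / cmod (ell2_cinner x y)"
  have c: "cmod c = 1" using False by (simp add: c_def norm_divide)
  have "cmod (ell2_cinner x y) = Re (ell2_cinner (c *\<^sub>C x) y)"
    using False by (simp add: c_def cinner_scaleC_left complex_norm_square[symmetric] mult.commute
        power2_eq_square)
  also have "\<dots> \<le> norm (c *\<^sub>C x) * norm y"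
    unfolding Re_cinner by (rule norm_cauchy_schwarz)
  finally show ?thesis by (simp add: c)
qed simp

lemma bounded_linear_cinner: "bounded_linear (\<lambda>x. ell2_cinner x y)"
proof (rule bounded_linear_intro[where K="norm y"])
  show "ell2_cinner (r *\<^sub>R x) y = r *\<^sub>R ell2_cinner x y" for r x
    by (simp add: scaleR_ell2_def cinner_scaleC_left complex_scaleR)
qed (auto simp: cinner_add_left norm_cinner_le)

lemma measurable_cinner [measurable]: "(\<lambda>x. ell2_cinner x y) \<in> borel_measurable borel"
  by (intro borel_measurable_continuous_onI linear_continuous_on bounded_linear_cinner)

section \<open>The weighted measure\<close>

definition weight :: "'n::finite itself \<Rightarrow> real \<Rightarrow> complex^'n \<Rightarrow> real" where
  "weight _ \<alpha> z = normalizing_constant TYPE('n) \<alpha> * (1 - (norm z)\<^sup>2) powr \<alpha>"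

lemma nu_altdef: "nu \<alpha> = density (lebesgue_on unit_ball) (\<lambda>z :: complex^'n::finite. ennreal (weight TYPE('n) \<alpha> z))"
  by (simp add: nu_def weight_def)

text \<open>Bernoulli's inequality. The linear decay in \<delta> is what makes the weight integrable
  for every \<alpha> > -1.\<close>

lemma emeasure_annulus_le:
  fixes \<delta> :: real
  assumes "0 \<le> \<delta>" "\<delta> \<le> 1"
  shows "emeasure lborel {z \<in> (unit_ball :: (complex^'n::finite) set). 1 - norm z \<le> \<delta>} \<le>
    ennreal (measure lborel (unit_ball :: (complex^'n) set) * real DIM(complex^'n) * \<delta>)"
proof -
  define V where "V = measure lborel (unit_ball :: (complex^'n) set)"
  define D where "D = DIM(complex^'n)"
  have V: "V = unit_ball_vol D" by (simp add: V_def D_def content_ball)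
  have eb: "emeasure lborel (ball (0 :: complex^'n) r) = ennreal (V * r ^ D)" if "r \<ge> 0" for r
    unfolding V D_def using emeasure_ball[OF that, of "0 :: complex^'n"] that
    by (simp add: )
  have sub: "ball (0 :: complex^'n) (1 - \<delta>) \<subseteq> ball 0 1" using assms by auto
  have "{z \<in> (unit_ball :: (complex^'n) set). 1 - norm z \<le> \<delta>} = ball 0 1 - ball 0 (1 - \<delta>)" by auto
  then have "emeasure lborel {z \<in> (unit_ball :: (complex^'n) set). 1 - norm z \<le> \<delta>} =
      ennreal (V * 1 ^ D) - ennreal (V * (1 - \<delta>) ^ D)"
    using assms sub eb[of 1] eb[of "1 - \<delta>"] emeasure_lborel_ball_finite[of "0 :: complex^'n" "1 - \<delta>"]
    by (simp only:) (subst emeasure_Diff, auto)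
  also have "\<dots> = ennreal (V * 1 ^ D - V * (1 - \<delta>) ^ D)"
    using assms by (intro ennreal_minus) (simp add: V_def)
  also have "\<dots> \<le> ennreal (V * D * \<delta>)"
  proof (intro ennreal_leI)
    have "1 + real D * (-\<delta>) \<le> (1 + (-\<delta>)) ^ D" using assms by (intro Bernoulli_inequality) auto
    then have "V * (1 - (1 - \<delta>) ^ D) \<le> V * (D * \<delta>)" by (intro mult_left_mono) (auto simp: V_def)
    then show "V * 1 ^ D - V * (1 - \<delta>) ^ D \<le> V * D * \<delta>" by (simp add: algebra_simps)
  qed
  finally show ?thesis by (simp add: V_def D_def)
qed

lemma nn_integral_lebesgue_ball:
  assumes "h \<in> borel_measurable borel"
  shows "(\<integral>\<^sup>+z. h z \<partial>lebesgue_on unit_ball) = (\<integral>\<^sup>+z\<in>unit_ball. h z \<partial>(lborel :: (complex^'n::finite) measure))"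
proof -
  have "(\<integral>\<^sup>+z. h z \<partial>lebesgue_on unit_ball) = (\<integral>\<^sup>+z. h z * indicator unit_ball z \<partial>lebesgue)"
    by (subst nn_integral_restrict_space) simp_all
  also have "\<dots> = (\<integral>\<^sup>+z. h z * indicator unit_ball z \<partial>lborel)"
    using assms by (intro nn_integral_completion)
  finally show ?thesis .
qed

lemma nn_integral_weight_finite:
  assumes "\<alpha> > -1"
  shows "(\<integral>\<^sup>+z. ennreal ((1 - (norm z)\<^sup>2) powr \<alpha>) \<partial>lebesgue_on (unit_ball :: (complex^'n::finite) set)) < \<infinity>"
proof (cases "\<alpha> \<ge> 0")
  case True
  have "(\<integral>\<^sup>+z. ennreal ((1 - (norm z)\<^sup>2) powr \<alpha>) \<partial>lebesgue_on (unit_ball :: (complex^'n::finite) set))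
     \<le> (\<integral>\<^sup>+z. 1 \<partial>lebesgue_on (unit_ball :: (complex^'n::finite) set))"
  proof (intro nn_integral_mono)
    fix z :: "complex^'n" assume "z \<in> space (lebesgue_on unit_ball)"
    then have "norm z < 1" by simp
    then have "(1 - (norm z)\<^sup>2) powr \<alpha> \<le> 1 powr \<alpha>"
      using True by (intro powr_mono2) (auto simp: abs_square_less_1 less_imp_le power_le_one_iff)
    then show "ennreal ((1 - (norm z)\<^sup>2) powr \<alpha>) \<le> 1" by (simp add: ennreal_le_1)
  qed
  also have "\<dots> < \<infinity>" using emeasure_lborel_ball_finite[of "0 :: complex^'n" 1]
    by (simp add: emeasure_restrict_space)
  finally show ?thesis .
next
  case False
  define C where "C = measure lborel (unit_ball :: (complex^'n) set) * real DIM(complex^'n)"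
  have C: "C \<ge> 0" by (simp add: C_def)
  \<comment> \<open>For negative exponents the ball is covered by dyadic annuli: a mass of order
    2^(-k) times a weight of order 2^(-k \<alpha>) gives a geometric series of ratio 2^(-(1 +
    \<alpha>)).\<close>
  define A where "A k = {z \<in> (unit_ball :: (complex^'n) set). 1 - norm z \<le> (1/2) ^ k}" for k
  have A[measurable]: "A k \<in> sets borel" for k unfolding A_def by measurable
  define q where "q k = ((1/2) ^ Suc k) powr \<alpha>" for k
  have "ennreal ((1 - (norm z)\<^sup>2) powr \<alpha>) * indicator unit_ball z \<le> (\<Sum>k. ennreal (q k) * indicator (A k) z)"
    for z :: "complex^'n"
  proof (cases "z \<in> unit_ball")
    case True
    define \<delta> where "\<delta> = 1 - norm z"
    have \<delta>: "\<delta> > 0" "\<delta> \<le> 1" using True by (auto simp: \<delta>_def)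
    obtain K where K: "(1/2) ^ K < \<delta>" using \<delta> real_arch_pow_inv[of \<delta> "1/2"] by auto
    \<comment> \<open>Minimality of \<open>k\<close>, written below as \<open>Suc j\<close>, places
      1 - |z| between (1/2)^(j+1) and (1/2)^j. The upper bound gives membership in
      \<open>A j\<close>, the lower one the bound \<open>q j\<close> because \<alpha> < 0.\<close>
    define k where "k = (LEAST k. (1/2::real) ^ k < \<delta>)"
    have k: "(1/2) ^ k < \<delta>" unfolding k_def using K by (rule LeastI)
    then have "k \<noteq> 0" using \<delta> by (intro notI) auto
    then obtain j where j: "k = Suc j" by (cases k) auto
    have "\<not> (1/2::real) ^ j < \<delta>" unfolding k_def using not_less_Least[of j "\<lambda>k. (1/2::real) ^ k < \<delta>"] j k_def by auto
    then have zA: "z \<in> A j" using True by (simp add: A_def \<delta>_def)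
    have "(norm z)\<^sup>2 \<le> norm z" using \<delta> by (simp add: \<delta>_def power2_eq_square mult_left_le)
    then have "\<delta> \<le> 1 - (norm z)\<^sup>2" by (simp add: \<delta>_def)
    then have "(1 - (norm z)\<^sup>2) powr \<alpha> \<le> q j"
      using k \<delta> False unfolding q_def j by (intro powr_mono2') auto
    then have "ennreal ((1 - (norm z)\<^sup>2) powr \<alpha>) * indicator unit_ball z \<le> ennreal (q j) * indicator (A j) z"
      using zA True by (simp add: ennreal_leI)
    also have "\<dots> \<le> (\<Sum>k. ennreal (q k) * indicator (A k) z)"
    proof -
      define f where "f k = ennreal (q k) * indicator (A k) z" for k
      show ?thesis using sum_le_suminf[OF summableI, of "{j}" f] unfolding f_def[symmetric] by simp
    qed
    finally show ?thesis .
  qed simp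
  then have "(\<integral>\<^sup>+z\<in>unit_ball. ennreal ((1 - (norm z)\<^sup>2) powr \<alpha>) \<partial>(lborel :: (complex^'n) measure)) \<le>
      (\<integral>\<^sup>+z. (\<Sum>k. ennreal (q k) * indicator (A k) z) \<partial>lborel)"
    by (intro nn_integral_mono)
  also have "\<dots> = (\<Sum>k. ennreal (q k) * emeasure lborel (A k))"
    by (subst nn_integral_suminf) (auto simp: nn_integral_cmult)
  also have "\<dots> \<le> (\<Sum>k. ennreal (q k) * ennreal (C * (1/2) ^ k))"
    unfolding A_def C_def by (intro suminf_le mult_left_mono emeasure_annulus_le summableI) (auto simp: power_le_one)
  also have "\<dots> = (\<Sum>k. ennreal ((1/2) powr \<alpha> * C * ((1/2) powr (1 + \<alpha>)) ^ k))"
  proof (intro suminf_cong)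
    fix k
    have "q k = (1/2) powr (\<alpha> * Suc k)" unfolding q_def by (simp add: powr_powr powr_realpow[symmetric] mult.commute del: power_Suc)
    then have "q k * (1/2) ^ k = (1/2) powr \<alpha> * ((1/2) powr (1 + \<alpha>)) ^ k"
      by (simp add: powr_realpow[symmetric] powr_powr powr_add[symmetric] algebra_simps)
    then have "q k * (C * (1/2) ^ k) = (1/2) powr \<alpha> * C * ((1/2) powr (1 + \<alpha>)) ^ k"
      by (simp add: mult_ac)
    moreover have "q k \<ge> 0" by (simp add: q_def)
    ultimately show "ennreal (q k) * ennreal (C * (1/2) ^ k) = ennreal ((1/2) powr \<alpha> * C * ((1/2) powr (1 + \<alpha>)) ^ k)"
      using C by (simp add: ennreal_mult[symmetric])
  qed
  also have "\<dots> < \<infinity>"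
  proof -
    have "(1/2::real) powr (1 + \<alpha>) < 1" using assms powr_less_mono2[of "1 + \<alpha>" "1/2" 1] by simp
    then have "summable (\<lambda>k. (1/2) powr \<alpha> * C * ((1/2::real) powr (1 + \<alpha>)) ^ k)"
      by (intro summable_mult summable_geometric) auto
    then show ?thesis using C by (subst suminf_ennreal2) auto
  qed
  finally show ?thesis by (subst nn_integral_lebesgue_ball) auto
qed

text \<open>The parameter \<open>TN\<close> only serves to fix the index type.\<close>

locale bergman =
  fixes \<alpha> :: real and TN :: "'n::finite itself"
  assumes alpha: "\<alpha> > -1"
begin

abbreviation M :: "(complex^'n) measure" where "M \<equiv> nu \<alpha>"
abbreviation B :: "(complex^'n) set" where "B \<equiv> unit_ball"
abbreviation wt :: "complex^'n \<Rightarrow> real" where "wt \<equiv> weight TYPE('n) \<alpha>"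

definition N :: real where "N = real CARD('n) + 1 + \<alpha>"

lemma N_pos: "N > 0" using alpha by (simp add: N_def)

lemma space_nu [simp]: "space M = B"
  by (simp add: nu_altdef)

lemma sets_nu [measurable_cong]: "sets M = sets (lebesgue_on B)"
  by (simp add: nu_altdef)

lemma weight_measurable [measurable]: "wt \<in> borel_measurable borel"
  unfolding weight_def by measurable

lemma measurable_nu_borel: "h \<in> borel_measurable borel \<Longrightarrow> h \<in> borel_measurable M"
  unfolding measurable_cong_sets[OF sets_nu refl]
  by (rule measurable_restrict_space1, rule measurable_completion) simp

lemma measurable_nu_continuous: "continuous_on B h \<Longrightarrow> h \<in> borel_measurable M"
  unfolding measurable_cong_sets[OF sets_nu refl]
  by (rule continuous_imp_measurable_on_sets_lebesgue) auto

lemma measurable_ident_nu [measurable]: "(\<lambda>z. z) \<in> borel_measurable M"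
  by (rule measurable_nu_borel) simp

lemma integral_weight_pos: "(LINT z|lebesgue_on B. (1 - (norm z)\<^sup>2) powr \<alpha>) > 0"
proof -
  let ?f = "\<lambda>z :: complex^'n. (1 - (norm z)\<^sup>2) powr \<alpha>"
  have m: "?f \<in> borel_measurable (lebesgue_on B)"
    by (rule measurable_restrict_space1, rule measurable_completion) simp
  have int: "integrable (lebesgue_on B) ?f"
    using nn_integral_weight_finite[OF alpha] m by (intro integrableI_bounded) simp_all
  have "(LINT z|lebesgue_on B. ?f z) \<noteq> 0"
  proof
    assume "(LINT z|lebesgue_on B. ?f z) = 0"
    then have "AE z in lebesgue_on B. ?f z = 0"
      using integral_nonneg_eq_0_iff_AE[OF int] by simp
    moreover have "AE z in lebesgue_on B. ?f z \<noteq> 0"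
      by (rule AE_I2) (auto simp: abs_square_eq_1)
    ultimately have "AE z in lebesgue_on B. False" by eventually_elim simp
    then have "emeasure (lebesgue_on B) B = 0"
      using AE_E2[where M="lebesgue_on B" and P="\<lambda>_. False"] by (auto simp: ball_def)
    then show False
      using content_ball_pos[of 1 "0 :: complex^'n"]
      by (simp add: emeasure_restrict_space measure_def)
  qed
  then show ?thesis by (simp add: less_le integral_nonneg_AE)
qed

lemma weight_pos:
  assumes "z \<in> B" shows "wt z > 0"
proof -
  have "1 - (norm z)\<^sup>2 > 0" using assms by (simp add: abs_square_less_1)
  then have "(1 - (norm z)\<^sup>2) powr \<alpha> > 0" by simp
  then show ?thesis
    using integral_weight_pos unfolding weight_def normalizing_constant_def by (intro mult_pos_pos) simp_all
qed

lemma nn_integral_nu: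
  assumes "h \<in> borel_measurable borel"
  shows "(\<integral>\<^sup>+z. h z \<partial>M) = (\<integral>\<^sup>+z\<in>B. (ennreal (wt z) * h z) \<partial>lborel)"
proof -
  have "(\<integral>\<^sup>+z. h z \<partial>M) = (\<integral>\<^sup>+z. ennreal (wt z) * h z \<partial>lebesgue_on B)"
    unfolding nu_altdef
    by (rule nn_integral_density; rule measurable_restrict_space1, rule measurable_completion) (use assms in simp_all)
  then show ?thesis using assms by (simp add: nn_integral_lebesgue_ball)
qed

lemma emeasure_nu_ball: "emeasure M B = 1"
proof -
  let ?f = "\<lambda>z :: complex^'n. (1 - (norm z)\<^sup>2) powr \<alpha>"
  define Z where "Z = (LINT z|lebesgue_on B. ?f z)"
  have Z: "Z > 0" unfolding Z_def by (rule integral_weight_pos)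
  have m: "?f \<in> borel_measurable (lebesgue_on B)"
    by (rule measurable_restrict_space1, rule measurable_completion) simp
  have int: "integrable (lebesgue_on B) ?f"
    using nn_integral_weight_finite[OF alpha] m by (intro integrableI_bounded) simp_all
  have "emeasure M B = (\<integral>\<^sup>+z. ennreal (1 / Z * ?f z) \<partial>lebesgue_on B)"
    using m by (simp add: nu_def emeasure_density normalizing_constant_def Z_def)
      (intro nn_integral_cong, auto simp: indicator_def)
  also have "\<dots> = ennreal (1 / Z * Z)"
    unfolding Z_def using int Z by (subst nn_integral_eq_integral) (auto simp: Z_def)
  finally show ?thesis using Z by simp
qed

sublocale finite_measure M
  by (rule finite_measureI) (simp add: emeasure_nu_ball)

lemma measure_nu_ball [simp]: "measure M B = 1"
  by (simp add: measure_def emeasure_nu_ball)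

text \<open>The weight is strictly positive on the ball, so no set is lost or gained.\<close>

lemma null_sets_nu_iff: "S \<in> null_sets M \<longleftrightarrow> S \<in> null_sets (lebesgue_on B)"
proof -
  have m: "(\<lambda>z. ennreal (wt z)) \<in> borel_measurable (lebesgue_on B)"
    by (rule measurable_restrict_space1, rule measurable_completion) simp
  have "S \<in> null_sets M \<longleftrightarrow> S \<in> sets (lebesgue_on B) \<and> (AE z in lebesgue_on B. z \<in> S \<longrightarrow> ennreal (wt z) = 0)"
    unfolding nu_altdef null_sets_density_iff[OF m] ..
  also have "\<dots> \<longleftrightarrow> S \<in> sets (lebesgue_on B) \<and> (AE z in lebesgue_on B. z \<notin> S)"
  proof (intro conj_cong refl AE_cong)
    fix z assume "z \<in> space (lebesgue_on B)"
    then have "ennreal (wt z) \<noteq> 0" using weight_pos[of z] by (simp add: ennreal_eq_0_iff not_le)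
    then show "(z \<in> S \<longrightarrow> ennreal (wt z) = 0) \<longleftrightarrow> z \<notin> S" by simp
  qed
  also have "\<dots> \<longleftrightarrow> S \<in> null_sets (lebesgue_on B)"
    using AE_iff_null_sets by (auto simp: null_sets_def)
  finally show ?thesis .
qed

lemma nu_complete:
  assumes "S \<subseteq> T" "T \<in> null_sets M"
  shows "S \<in> null_sets M"
proof -
  have "T \<in> null_sets lebesgue" "T \<subseteq> B"
    using assms(2) unfolding null_sets_nu_iff
    by (auto simp: null_sets_restrict_space)
  then show ?thesis
    using assms(1) unfolding null_sets_nu_iff
    by (auto simp: null_sets_restrict_space intro: null_sets_completion_subset)
qed

text \<open>The map \<open>phi a\<close> is first controlled on Borel sets only. This decomposition
  extends the results to the completed sigma-algebra of \<open>nu\<close>, the remainder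
  \<open>V\<close> being absorbed by the null set.\<close>

lemma nu_sets_split:
  assumes "S \<in> sets M"
  obtains U V V' where "S = U \<union> V" "V \<subseteq> V'" "U \<in> sets borel" "V' \<in> sets borel" "U \<subseteq> B"
    "V' \<inter> B \<in> null_sets M"
proof -
  have "S \<in> sets lebesgue" "S \<subseteq> B"
    using assms by (auto simp: sets_nu sets_restrict_space_iff)
  then obtain U V V' where *: "S = U \<union> V" "V \<subseteq> V'" "V' \<in> null_sets lborel" "U \<in> sets lborel"
    by (auto simp: sets_completion)
  have "V' \<inter> B \<in> null_sets lebesgue"
    using *(3) by (intro null_sets_completionI null_set_Int2) auto
  then have "V' \<inter> B \<in> null_sets M"
    by (simp add: null_sets_nu_iff null_sets_restrict_space)
  then show ?thesis using * \<open>S \<subseteq> B\<close> by (intro that[of U V V']) auto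
qed

section \<open>Transport of the weighted measure under the involutions\<close>

definition ker2 :: "complex^'n \<Rightarrow> complex^'n \<Rightarrow> real" where
  "ker2 a z = ((1 - (norm a)\<^sup>2) / (cmod (1 - cdot z a))\<^sup>2) powr N"

lemma ker2_nonneg [simp]: "ker2 a z \<ge> 0"
  by (simp add: ker2_def)

lemma norm_kernel_powr:
  assumes "z \<in> B" "w \<in> B"
  shows "cmod ((1 - cdot w z) powr of_real r) = cmod (1 - cdot w z) powr r"
proof -
  show ?thesis using norm_powr_real_powr'[of "of_real r" "1 - cdot w z"] by simp
qed

text \<open>The weighted real Jacobian of \<open>phi a\<close> is the square of the normalized kernel, called \<open>ker2 a\<close>.\<close>

lemma weight_phi:
  assumes "a \<in> B" "z \<in> B"
  shows "wt (phi a z) * ball_point.jac a z = wt z * ker2 a z"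
proof -
  interpret ball_point a by unfold_locales (use assms in simp)
  have z: "norm z < 1" using assms by simp
  define q where "q = (1 - (norm a)\<^sup>2) / (cmod (1 - cdot z a))\<^sup>2"
  have 1: "1 - (norm a)\<^sup>2 > 0" "1 - (norm z)\<^sup>2 > 0" using assms by (simp_all add: abs_square_less_1)
  have 2: "cmod (1 - cdot z a) > 0" using one_minus_cdot_nonpos assms by auto
  have q: "q > 0" using 1 2 by (simp add: q_def)
  have "1 - (norm (phi a z))\<^sup>2 = q * (1 - (norm z)\<^sup>2)"
    unfolding norm_phi[OF z] q_def by simp
  then have "(1 - (norm (phi a z))\<^sup>2) powr \<alpha> = q powr \<alpha> * (1 - (norm z)\<^sup>2) powr \<alpha>"
    using q 1 by (simp add: powr_mult)
  moreover have "jac z = q powr (real (CARD('n) + 1))"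
    unfolding jac_def q_def[symmetric] using q powr_realpow[of q "CARD('n) + 1"] by simp
  moreover have "ker2 a z = q powr \<alpha> * q powr (real (CARD('n) + 1))"
    unfolding ker2_def q_def[symmetric] N_def powr_add[symmetric] by (simp add: algebra_simps)
  ultimately show ?thesis by (simp add: weight_def)
qed

lemma continuous_on_ker2: "a \<in> B \<Longrightarrow> continuous_on B (ker2 a)"
  unfolding ker2_def using one_minus_cdot_nonpos[of _ a]
  by (intro continuous_intros) (auto simp: abs_square_eq_1)

lemma nn_integral_nu_phi_borel:
  assumes aB: "a \<in> B" and h: "h \<in> borel_measurable borel"
  shows "(\<integral>\<^sup>+z. h (phi a z) \<partial>M) = (\<integral>\<^sup>+z. ennreal (ker2 a z) * h z \<partial>M)"
proof -
  interpret ball_point a by unfold_locales (use aB in simp)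
  have mphi: "(\<lambda>z. indicator B z *\<^sub>R phi a z) \<in> borel_measurable borel"
    by (rule borel_measurable_continuous_on_indicator[OF _ continuous_on_phi]) simp
  have mk: "(\<lambda>z. indicator B z *\<^sub>R ker2 a z) \<in> borel_measurable borel"
    by (rule borel_measurable_continuous_on_indicator[OF _ continuous_on_ker2[OF aB]]) simp
  \<comment> \<open>Since \<open>phi a\<close> is an involution, \<open>h2 (phi a z)\<close> is the
    weight at \<open>z\<close> times \<open>h (phi a z)\<close> on the ball. The indicator extends
    \<open>phi a\<close> to a Borel map on the whole space.\<close>
  define h2 where "h2 z = ennreal (wt (indicator B z *\<^sub>R phi a z)) * h z" for z
  have h2: "h2 \<in> borel_measurable borel"
    unfolding h2_def using h measurable_compose[OF mphi weight_measurable] by measurable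
  have "(\<integral>\<^sup>+z. h (phi a z) \<partial>M) = (\<integral>\<^sup>+z. h (indicator B z *\<^sub>R phi a z) \<partial>M)"
    by (rule nn_integral_cong) simp
  also have "\<dots> = (\<integral>\<^sup>+z\<in>B. (ennreal (wt z) * h (indicator B z *\<^sub>R phi a z)) \<partial>lborel)"
    by (rule nn_integral_nu) (use measurable_compose[OF mphi h] in simp)
  also have "\<dots> = (\<integral>\<^sup>+z\<in>B. h2 (phi a z) \<partial>lborel)"
    by (rule nn_integral_cong) (auto simp: h2_def indicator_def phi_phi phi_in_ball)
  also have "\<dots> = (\<integral>\<^sup>+z\<in>B. (h2 z * ennreal (jac z)) \<partial>lborel)"
    by (rule nn_integral_phi[OF h2])
  also have "\<dots> = (\<integral>\<^sup>+z\<in>B. (ennreal (wt z) * (ennreal (indicator B z *\<^sub>R ker2 a z) * h z)) \<partial>lborel)"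
  proof (rule nn_integral_cong)
    fix z :: "complex^'n"
    show "h2 z * ennreal (jac z) * indicator B z = ennreal (wt z) * (ennreal (indicator B z *\<^sub>R ker2 a z) * h z) * indicator B z"
    proof (cases "z \<in> B")
      case True
      have "wt (phi a z) \<ge> 0" "wt z \<ge> 0"
        using weight_pos True phi_in_ball[of z] by (auto intro: less_imp_le)
      then have "ennreal (wt (phi a z)) * ennreal (jac z) = ennreal (wt z) * ennreal (ker2 a z)"
        using weight_phi[OF aB True] by (simp add: ennreal_mult'[symmetric])
      then show ?thesis using True by (simp add: h2_def) (metis mult.assoc mult.commute)
    qed simp
  qed
  also have "\<dots> = (\<integral>\<^sup>+z. ennreal (indicator B z *\<^sub>R ker2 a z) * h z \<partial>M)"
    by (rule nn_integral_nu[symmetric]) (use mk h in measurable)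
  also have "\<dots> = (\<integral>\<^sup>+z. ennreal (ker2 a z) * h z \<partial>M)"
    by (rule nn_integral_cong) simp
  finally show ?thesis .
qed

lemma emeasure_vimage_phi:
  assumes aB: "a \<in> B" and S: "S \<in> sets borel"
  shows "emeasure M (phi a -` S \<inter> B) = (\<integral>\<^sup>+z\<in>S. ennreal (ker2 a z) \<partial>M)"
proof -
  interpret ball_point a by unfold_locales (use aB in simp)
  have "phi a -` S \<inter> space M \<in> sets M"
    using measurable_sets[OF measurable_nu_continuous[OF continuous_on_phi] S] .
  then have "emeasure M (phi a -` S \<inter> B) = (\<integral>\<^sup>+z. indicator (phi a -` S \<inter> B) z \<partial>M)" by simp
  also have "\<dots> = (\<integral>\<^sup>+z. indicator S (phi a z) \<partial>M)"
    by (rule nn_integral_cong) (simp add: indicator_def)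
  finally show ?thesis
    using S by (simp add: nn_integral_nu_phi_borel[OF aB])
qed

text \<open>Subsets of null sets are the only difficulty. Their preimages are null because the
  measure of a preimage is an integral of \<open>ker2 a\<close> over the set itself.\<close>

lemma measurable_phi_nu:
  assumes aB: "a \<in> B"
  shows "phi a \<in> measurable M M"
proof (rule measurableI)
  interpret ball_point a by unfold_locales (use aB in simp)
  show "phi a z \<in> space M" if "z \<in> space M" for z
    using that phi_in_ball by auto
  fix S assume "S \<in> sets M"
  then obtain U V V' where *: "S = U \<union> V" "V \<subseteq> V'" "U \<in> sets borel" "V' \<in> sets borel" "U \<subseteq> B"
    "V' \<inter> B \<in> null_sets M" by (rule nu_sets_split)
  have "(\<integral>\<^sup>+z\<in>V'. ennreal (ker2 a z) \<partial>M) = 0"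
  proof -
    have "AE z in M. z \<notin> V' \<inter> B" using *(6) by (rule AE_not_in)
    with AE_space have "AE z in M. ennreal (ker2 a z) * indicator V' z = 0"
      by eventually_elim (auto simp: indicator_def)
    then have "(\<integral>\<^sup>+z\<in>V'. ennreal (ker2 a z) \<partial>M) = (\<integral>\<^sup>+z. 0 \<partial>M)" by (rule nn_integral_cong_AE)
    then show ?thesis by simp
  qed
  then have "phi a -` V' \<inter> B \<in> null_sets M"
    using emeasure_vimage_phi[OF aB *(4)] measurable_sets[OF measurable_nu_continuous[OF continuous_on_phi] *(4)]
    by (simp add: null_sets_def)
  with *(2) have "phi a -` V \<inter> B \<in> null_sets M"
    by (intro nu_complete[of "phi a -` V \<inter> B" "phi a -` V' \<inter> B"]) auto
  then have "phi a -` V \<inter> B \<in> sets M" by (rule null_setsD2)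
  moreover have "phi a -` U \<inter> B \<in> sets M"
    using measurable_sets[OF measurable_nu_continuous[OF continuous_on_phi] *(3)] by simp
  moreover have "phi a -` S \<inter> space M = (phi a -` V \<inter> B) \<union> (phi a -` U \<inter> B)"
    using * by auto
  ultimately show "phi a -` S \<inter> space M \<in> sets M" by auto
qed

lemma measurable_ker2 [measurable]: "a \<in> B \<Longrightarrow> ker2 a \<in> borel_measurable M"
  by (rule measurable_nu_continuous[OF continuous_on_ker2])

lemma distr_phi:
  assumes aB: "a \<in> B"
  shows "distr M M (phi a) = density M (\<lambda>z. ennreal (ker2 a z))"
proof (rule measure_eqI)
  interpret ball_point a by unfold_locales (use aB in simp)
  fix S assume "S \<in> sets (distr M M (phi a))"
  then have S: "S \<in> sets M" by simp
  then obtain U V V' where *: "S = U \<union> V" "V \<subseteq> V'" "U \<in> sets borel" "V' \<in> sets borel" "U \<subseteq> B"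
    "V' \<inter> B \<in> null_sets M" by (rule nu_sets_split)
  have ae: "AE z in M. z \<notin> V' \<inter> B" using *(6) by (rule AE_not_in)
  have z: "(\<integral>\<^sup>+z\<in>V'. ennreal (ker2 a z) \<partial>M) = 0"
  proof -
    have "AE z in M. ennreal (ker2 a z) * indicator V' z = 0"
      using ae AE_space by eventually_elim (auto simp: indicator_def)
    then have "(\<integral>\<^sup>+z\<in>V'. ennreal (ker2 a z) \<partial>M) = (\<integral>\<^sup>+z. 0 \<partial>M)" by (rule nn_integral_cong_AE)
    then show ?thesis by simp
  qed
  then have n: "phi a -` V' \<inter> B \<in> null_sets M"
    using emeasure_vimage_phi[OF aB *(4)] measurable_sets[OF measurable_nu_continuous[OF continuous_on_phi] *(4)]
    by (simp add: null_sets_def)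
  have "emeasure (distr M M (phi a)) S = emeasure M (phi a -` S \<inter> B)"
    using S measurable_phi_nu[OF aB] by (simp add: emeasure_distr)
  also have "\<dots> = emeasure M (phi a -` U \<inter> B)"
  proof (rule emeasure_eq_AE)
    have "AE z in M. z \<notin> phi a -` V' \<inter> B" using n by (rule AE_not_in)
    then show "AE z in M. (z \<in> phi a -` S \<inter> B) = (z \<in> phi a -` U \<inter> B)"
      by eventually_elim (use * in auto)
    show "phi a -` S \<inter> B \<in> sets M" using measurable_sets[OF measurable_phi_nu[OF aB] S] by simp
    show "phi a -` U \<inter> B \<in> sets M"
      using measurable_sets[OF measurable_nu_continuous[OF continuous_on_phi] *(3)] by simp
  qed
  also have "\<dots> = (\<integral>\<^sup>+z\<in>U. ennreal (ker2 a z) \<partial>M)" by (rule emeasure_vimage_phi[OF aB *(3)])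
  also have "\<dots> = (\<integral>\<^sup>+z\<in>S. ennreal (ker2 a z) \<partial>M)"
  proof (rule nn_integral_cong_AE)
    show "AE z in M. ennreal (ker2 a z) * indicator U z = ennreal (ker2 a z) * indicator S z"
      using ae AE_space by eventually_elim (use * in \<open>auto simp: indicator_def\<close>)
  qed
  also have "\<dots> = emeasure (density M (\<lambda>z. ennreal (ker2 a z))) S"
    using S measurable_ker2[OF aB] by (simp add: emeasure_density)
  finally show "emeasure (distr M M (phi a)) S = emeasure (density M (\<lambda>z. ennreal (ker2 a z))) S" .
qed simp

lemma nn_integral_phi_nu:
  assumes "a \<in> B" "h \<in> borel_measurable M"
  shows "(\<integral>\<^sup>+z. h (phi a z) \<partial>M) = (\<integral>\<^sup>+z. ennreal (ker2 a z) * h z \<partial>M)"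
  using assms nn_integral_distr[OF measurable_phi_nu[of a], of h]
    nn_integral_density[of "\<lambda>z. ennreal (ker2 a z)" M h]
  by (simp add: distr_phi)

lemma integral_phi_nu:
  fixes h :: "complex^'n \<Rightarrow> 'e::{banach, second_countable_topology}"
  assumes "a \<in> B" "h \<in> borel_measurable M"
  shows "(\<integral>z. h (phi a z) \<partial>M) = (\<integral>z. ker2 a z *\<^sub>R h z \<partial>M)"
    and "integrable M (\<lambda>z. h (phi a z)) \<longleftrightarrow> integrable M (\<lambda>z. ker2 a z *\<^sub>R h z)"
  using assms integral_distr[OF measurable_phi_nu[of a], of h] integrable_distr_eq[OF measurable_phi_nu[of a], of h]
    integral_density[of h M "ker2 a"] integrable_density[of h M "ker2 a"]
  by (simp_all add: distr_phi)

end

section \<open>The mean value property\<close>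

definition hol :: "(complex^'n::finite \<Rightarrow> complex) \<Rightarrow> bool" where
  "hol g \<longleftrightarrow> (\<forall>z\<in>unit_ball. \<exists>D. (g has_derivative D) (at z) \<and> (\<forall>c v. D (c *s v) = c * D v))"

lemma holI:
  "(\<And>z. z \<in> unit_ball \<Longrightarrow> \<exists>D. (g has_derivative D) (at z) \<and> (\<forall>c v. D (c *s v) = c * D v)) \<Longrightarrow> hol g"
  by (simp add: hol_def)

lemma hol_continuous: "hol g \<Longrightarrow> continuous_on unit_ball g"
  unfolding hol_def by (meson continuous_at_imp_continuous_on has_derivative_continuous)

lemma holomorphic_on_ball_continuous: "holomorphic_on_ball f \<Longrightarrow> continuous_on unit_ball f"
  unfolding holomorphic_on_ball_def
  by (meson continuous_at_imp_continuous_on has_derivative_continuous)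

lemma hol_const [simp]: "hol (\<lambda>_. c)"
  by (auto simp: hol_def intro!: exI[of _ "\<lambda>_. 0"] has_derivative_const)

lemma hol_cdot: "hol (\<lambda>w. cdot w z)"
  unfolding hol_def
  using bounded_linear_imp_has_derivative[OF bounded_linear_cdot_left] cdot_scale_left by blast

lemma hol_mult:
  fixes f g :: "complex^'n::finite \<Rightarrow> complex"
  assumes "hol f" "hol g" shows "hol (\<lambda>z. f z * g z)"
proof (rule holI)
  fix z :: "complex^'n" assume z: "z \<in> unit_ball"
  obtain D E where "(f has_derivative D) (at z)" "\<And>c v. D (c *s v) = c * D v"
    "(g has_derivative E) (at z)" "\<And>c v. E (c *s v) = c * E v"
    using assms z unfolding hol_def by meson
  then show "\<exists>D. ((\<lambda>z. f z * g z) has_derivative D) (at z) \<and> (\<forall>c v. D (c *s v) = c * D v)"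
    by (intro exI[of _ "\<lambda>h. f z * E h + D h * g z"] conjI has_derivative_mult)
      (auto simp: algebra_simps)
qed

lemma hol_compose_field:
  fixes g :: "complex^'n::finite \<Rightarrow> complex"
  assumes g: "hol g" and h: "\<And>z. z \<in> unit_ball \<Longrightarrow> h field_differentiable at (g z)"
  shows "hol (\<lambda>z. h (g z))"
proof (rule holI)
  fix z :: "complex^'n" assume z: "z \<in> unit_ball"
  obtain D where D: "(g has_derivative D) (at z)" "\<And>c v. D (c *s v) = c * D v"
    using assms z unfolding hol_def by meson
  obtain h' where "(h has_field_derivative h') (at (g z))" using h[OF z] by (auto simp: field_differentiable_def)
  then have "(h has_derivative (*) h') (at (g z))" by (simp add: has_field_derivative_def)
  from has_derivative_compose[OF D(1) this]
  show "\<exists>D. ((\<lambda>z. h (g z)) has_derivative D) (at z) \<and> (\<forall>c v. D (c *s v) = c * D v)"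
    using D(2) by (intro exI[of _ "\<lambda>v. h' * D v"]) (auto simp: algebra_simps)
qed

lemma hol_phi:
  fixes g :: "complex^'n::finite \<Rightarrow> complex"
  assumes g: "hol g" and a: "a \<in> unit_ball"
  shows "hol (\<lambda>z. g (phi a z))"
proof (rule holI)
  interpret ball_point a by unfold_locales (use a in simp)
  fix z :: "complex^'n" assume z: "z \<in> unit_ball"
  then have "phi a z \<in> unit_ball" using phi_in_ball by simp
  then obtain D where D: "(g has_derivative D) (at (phi a z))" "\<And>c v. D (c *s v) = c * D v"
    using g z unfolding hol_def by meson
  have "(phi a has_derivative dphi z) (at z)" using z by (intro has_derivative_phi) simp
  from has_derivative_compose[OF this D(1)]
  show "\<exists>D. ((\<lambda>z. g (phi a z)) has_derivative D) (at z) \<and> (\<forall>c v. D (c *s v) = c * D v)"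
    using D(2) dphi_scale by (intro exI[of _ "\<lambda>v. D (dphi z v)"]) auto
qed

lemma hol_linear_compose:
  fixes f :: "complex^'n::finite \<Rightarrow> ell2"
  assumes f: "holomorphic_on_ball f" and L: "bounded_linear L" "\<And>c x. L (c *\<^sub>C x) = c * L x"
  shows "hol (\<lambda>z. L (f z))"
proof (rule holI)
  fix z :: "complex^'n" assume z: "z \<in> unit_ball"
  obtain D where D: "(f has_derivative D) (at z)" "\<And>c v. D (c *s v) = c *\<^sub>C D v"
    using f z unfolding holomorphic_on_ball_def by meson
  from bounded_linear.has_derivative[OF L(1) D(1)]
  show "\<exists>D. ((\<lambda>z. L (f z)) has_derivative D) (at z) \<and> (\<forall>c v. D (c *s v) = c * D v)"
    using D(2) L(2) by (intro exI[of _ "\<lambda>v. L (D v)"]) auto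
qed

lemma hol_nth: "holomorphic_on_ball f \<Longrightarrow> hol (\<lambda>z. ell2_nth (f z) i)"
  by (rule hol_linear_compose[OF _ bounded_linear_nth]) simp_all

lemma hol_cinner: "holomorphic_on_ball f \<Longrightarrow> hol (\<lambda>z. ell2_cinner (f z) x)"
  by (rule hol_linear_compose[OF _ bounded_linear_cinner]) (simp_all add: cinner_scaleC_left)

lemma hol_slice:
  assumes g: "hol g"
  shows "(\<lambda>c. g (c *s v)) holomorphic_on {c. cmod c * norm v < 1}"
proof -
  have "(\<lambda>c. g (c *s v)) field_differentiable at c" if "cmod c * norm v < 1" for c
  proof -
    have "c *s v \<in> unit_ball" using that by (simp add: norm_scale_vec)
    then obtain D where D: "(g has_derivative D) (at (c *s v))" "\<And>c v. D (c *s v) = c * D v"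
      using g unfolding hol_def by meson
    have "((\<lambda>c. c *s v) has_derivative (\<lambda>c. c *s v)) (at c)"
      by (intro bounded_linear_imp_has_derivative bounded_bilinear.bounded_linear_left[OF bounded_bilinear_scale_vec])
    from has_derivative_compose[OF this D(1)]
    have "((\<lambda>c. g (c *s v)) has_derivative (\<lambda>c. D v * c)) (at c)"
      by (simp add: D(2) mult.commute)
    then show ?thesis
      unfolding field_differentiable_def has_field_derivative_def by (intro exI[of _ "D v"])
  qed
  then show ?thesis
    unfolding holomorphic_on_def using field_differentiable_at_within by blast
qed

text \<open>Cauchy's formula on the complex line through \<open>z\<close>: as |z| < 1, the closed
  unit disc of parameters is mapped into the ball.\<close>

lemma hol_circle_mean:
  assumes g: "hol g" and z: "z \<in> unit_ball"
  shows "((\<lambda>t. g (exp (2 * of_real pi * \<i> * of_real t) *s z)) has_integral g 0) {0..1}"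
proof -
  define f where "f c = g (c *s z)" for c
  have "f holomorphic_on cball 0 1"
    unfolding f_def
  proof (rule holomorphic_on_subset[OF hol_slice[OF g]], rule subsetI)
    fix c :: complex assume "c \<in> cball 0 1"
    then have "cmod c * norm z \<le> 1 * norm z" by (intro mult_right_mono) auto
    then show "c \<in> {c. cmod c * norm z < 1}" using z by auto
  qed
  then have "((\<lambda>u. f u / (u - 0)) has_contour_integral (2 * of_real pi * \<i> * f 0)) (circlepath 0 1)"
    by (intro Cauchy_integral_circlepath_simple) auto
  then have "((\<lambda>t. f (exp (2 * of_real pi * \<i> * of_real t)) / exp (2 * of_real pi * \<i> * of_real t)
       * (2 * of_real pi * \<i> * exp (2 * of_real pi * \<i> * of_real t))) has_integral (2 * of_real pi * \<i> * f 0)) {0..1}"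
    unfolding has_contour_integral_def
  proof (rule has_integral_eq[rotated])
    fix x :: real assume "x \<in> {0..1}"
    then have "vector_derivative (circlepath 0 1) (at x within {0..1}) = 2 * of_real pi * \<i> * exp (2 * of_real pi * \<i> * of_real x)"
      by (simp add: vector_derivative_circlepath01)
    moreover have "circlepath 0 1 x = exp (2 * of_real pi * \<i> * of_real x)" by (simp add: circlepath)
    ultimately show "f (circlepath 0 1 x) / (circlepath 0 1 x - 0) * vector_derivative (circlepath 0 1) (at x within {0..1}) =
      f (exp (2 * of_real pi * \<i> * of_real x)) / exp (2 * of_real pi * \<i> * of_real x)
       * (2 * of_real pi * \<i> * exp (2 * of_real pi * \<i> * of_real x))" by simp
  qed
  then have "((\<lambda>t. (2 * of_real pi * \<i>) * f (exp (2 * of_real pi * \<i> * of_real t))) has_integral (2 * of_real pi * \<i>) * f 0) {0..1}"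
    by (simp add: field_simps)
  from has_integral_mult_right[OF this, of "1 / (2 * of_real pi * \<i>)"]
  show ?thesis by (simp add: f_def)
qed

section \<open>Rotation invariance and the mean value formula\<close>

lemma rotation_lborel:
  assumes u: "cmod u = 1"
  shows "distr lborel borel (\<lambda>z :: complex^'n::finite. u *s z) = lborel"
proof (rule lborel_eqI[symmetric])
  fix l b :: "complex^'n"
  assume le: "\<And>x. x \<in> Basis \<Longrightarrow> inner l x \<le> inner b x"
  have u': "u * cnj u = 1" "cnj u * u = 1" using u by (simp_all add: complex_norm_square[symmetric] mult.commute)
  define U :: "real^('n bit0) \<Rightarrow> _" where "U = real_of_vec \<circ> (\<lambda>v. cnj u *s v) \<circ> vec_of_real"
  have lin: "linear (\<lambda>v :: complex^'n. cnj u *s v)"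
    by (rule linearI) (auto simp: vec_eq_iff algebra_simps)
  have "inner (cnj u *s x) (cnj u *s y) = inner x y" for x y :: "complex^'n"
  proof -
    have "cdot (cnj u *s x) (cnj u *s y) = (cnj u * u) * cdot x y"
      by (simp add: cdot_scale_left cdot_scale_right)
    then show ?thesis by (simp add: u' flip: Re_cdot)
  qed
  then have oU: "orthogonal_transformation U"
    unfolding orthogonal_transformation_def
    by (auto simp: U_def inner_real_of_vec_cong inner_vec_of_real_cong
        intro!: linear_compose linear_vec_of_real linear_real_of_vec lin)
  let ?V = "vec_of_real -` box l b"
  have m: "(\<lambda>z :: complex^'n. u *s z) \<in> borel_measurable borel"
    by (intro borel_measurable_continuous_onI continuous_intros)
  have Vb: "?V \<in> sets borel" using measurable_sets[OF measurable_vec_of_real, of "box l b"] by simp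
  have eV: "emeasure lborel ?V = emeasure lborel (box l b)"
    by (rule emeasure_lborel_vec_of_real) simp
  then have fin: "emeasure lborel ?V < \<infinity>" using emeasure_lborel_box_finite[of l b] by simp
  then have lm: "?V \<in> lmeasurable" using Vb by (simp add: fmeasurable_def)
  have pre: "(\<lambda>z. u *s z) -` box l b \<in> sets borel" using measurable_sets[OF m, of "box l b"] by simp
  have "vec_of_real -` ((\<lambda>z. u *s z) -` box l b) = U ` ?V"
  proof
    show "vec_of_real -` ((\<lambda>z. u *s z) -` box l b) \<subseteq> U ` ?V"
    proof
      fix x :: "real^('n bit0)" assume "x \<in> vec_of_real -` ((\<lambda>z. u *s z) -` box l b)"
      then show "x \<in> U ` ?V"
        by (intro image_eqI[of _ _ "real_of_vec (u *s vec_of_real x)"]) (auto simp: U_def u')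
    qed
  qed (auto simp: U_def u')
  then have UV: "emeasure lborel (U ` ?V) = emeasure lborel ((\<lambda>z. u *s z) -` box l b)" "U ` ?V \<in> sets borel"
    using emeasure_lborel_vec_of_real[OF pre] measurable_sets[OF measurable_vec_of_real pre] by simp_all
  have Ul: "U ` ?V \<in> lmeasurable" "measure lebesgue (U ` ?V) = measure lebesgue ?V"
    using lm oU by (simp_all add: measurable_orthogonal_image measure_orthogonal_image)
  then have "emeasure lborel (U ` ?V) = emeasure lborel ?V"
    using UV(2) Vb lm by (simp add: fmeasurable_def emeasure_eq_ennreal_measure[symmetric] measure_completion)
       (metis emeasure_eq_ennreal_measure infinity_ennreal_def less_top)
  then show "emeasure (distr lborel borel (\<lambda>z. u *s z)) (box l b) = (\<Prod>x\<in>Basis. inner (b - l) x)"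
    using m le by (simp add: emeasure_distr UV(1)[symmetric] eV emeasure_lborel_box)
qed simp

context bergman
begin

lemma rotation_nu:
  assumes u: "cmod u = 1"
  shows "distr M borel (\<lambda>z. u *s z) = distr M borel (\<lambda>z. z)"
proof (rule measure_eqI)
  have m: "(\<lambda>z :: complex^'n. u *s z) \<in> borel_measurable borel"
    by (intro borel_measurable_continuous_onI continuous_intros)
  fix S assume "S \<in> sets (distr M borel (\<lambda>z. u *s z))"
  then have S [measurable]: "S \<in> sets borel" by simp
  have [measurable]: "B \<in> sets borel" by simp
  have "emeasure (distr M borel (\<lambda>z. u *s z)) S = (\<integral>\<^sup>+z. indicator S z \<partial>distr M borel (\<lambda>z. u *s z))"
    by simp
  also have "\<dots> = (\<integral>\<^sup>+z. indicator S (u *s z) \<partial>M)"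
    by (subst nn_integral_distr) (auto intro: measurable_nu_borel m)
  also have "\<dots> = (\<integral>\<^sup>+z\<in>B. (ennreal (wt z) * indicator S (u *s z)) \<partial>lborel)"
    by (rule nn_integral_nu) (use measurable_compose[OF m borel_measurable_indicator[OF S]] in simp)
  also have "\<dots> = (\<integral>\<^sup>+z. ennreal (wt (u *s z)) * indicator S (u *s z) * indicator B (u *s z) \<partial>lborel)"
    by (rule nn_integral_cong) (simp add: weight_def norm_scale_vec u indicator_def)
  also have "\<dots> = (\<integral>\<^sup>+z\<in>B. (ennreal (wt z) * indicator S z) \<partial>distr lborel borel (\<lambda>z. u *s z))"
  proof (subst nn_integral_distr)
    show "(\<lambda>z. ennreal (wt z) * indicator S z * indicator B z) \<in> borel_measurable (distr lborel borel (\<lambda>z. u *s z))"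
      unfolding measurable_distr_eq1 measurable_lborel1
      by measurable
  qed (use m in simp_all)
  also have "\<dots> = (\<integral>\<^sup>+z. indicator S z \<partial>M)"
    unfolding rotation_lborel[OF u] by (rule nn_integral_nu[symmetric]) simp
  also have "\<dots> = (\<integral>\<^sup>+z. indicator S z \<partial>distr M borel (\<lambda>z. z))"
    by (subst nn_integral_distr) (auto intro: measurable_nu_borel)
  finally show "emeasure (distr M borel (\<lambda>z. u *s z)) S = emeasure (distr M borel (\<lambda>z. z)) S" by simp
qed simp

lemma integral_rotation:
  fixes h :: "complex^'n \<Rightarrow> 'e::{banach, second_countable_topology}"
  assumes "cmod u = 1" "h \<in> borel_measurable borel"
  shows "(\<integral>z. h (u *s z) \<partial>M) = (\<integral>z. h z \<partial>M)"
    and "integrable M (\<lambda>z. h (u *s z)) \<longleftrightarrow> integrable M h"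
proof -
  have m: "(\<lambda>z :: complex^'n. u *s z) \<in> borel_measurable M"
    by (intro measurable_nu_borel borel_measurable_continuous_onI continuous_intros)
  show "(\<integral>z. h (u *s z) \<partial>M) = (\<integral>z. h z \<partial>M)"
    using integral_distr[OF m assms(2)] integral_distr[OF measurable_ident_nu assms(2)]
    by (simp add: rotation_nu[OF assms(1)])
  show "integrable M (\<lambda>z. h (u *s z)) \<longleftrightarrow> integrable M h"
    using integrable_distr_eq[OF m assms(2)] integrable_distr_eq[OF measurable_ident_nu assms(2)]
    by (simp add: rotation_nu[OF assms(1)])
qed

lemma ball_in_sets_nu: "r \<le> 1 \<Longrightarrow> ball 0 r \<in> sets M"
  by (auto simp: sets_nu sets_restrict_space_iff)

text \<open>The rotated function is integrated over circle and ball in both orders. Integrating over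
  the ball first gives the left side for every rotation; integrating over the circle first gives
  \<open>g 0\<close> at every point of the smaller ball, by Cauchy's formula.\<close>

lemma mean_value:
  assumes g: "hol g" and r: "r \<le> 1" and int: "integrable M (\<lambda>z. indicator (ball 0 r) z *\<^sub>R g z)"
  shows "(\<integral>z. indicator (ball 0 r) z *\<^sub>R g z \<partial>M) = measure M (ball 0 r) *\<^sub>R g 0"
proof -
  define G where "G z = indicator (ball 0 r) z *\<^sub>R g z" for z
  have Gb: "G \<in> borel_measurable borel"
    unfolding G_def using r
    by (intro borel_measurable_continuous_on_indicator continuous_on_subset[OF hol_continuous[OF g]]) auto
  define I where "I = restrict_space lborel {0..1::real}"
  have emI: "emeasure I (space I) = 1" by (simp add: I_def emeasure_restrict_space space_restrict_space)
  interpret I: finite_measure I by (rule finite_measureI) (simp add: emI)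
  interpret P: pair_sigma_finite I M by unfold_locales
  have mI: "measure I (space I) = 1" by (simp add: measure_def emI)
  define e where "e t = exp (2 * of_real pi * \<i> * of_real t)" for t :: real
  have e: "cmod (e t) = 1" for t by (simp add: e_def)
  have em: "e \<in> borel_measurable I"
    unfolding I_def e_def
    by (intro measurable_restrict_space1) (simp add: borel_measurable_continuous_onI continuous_intros)
  have "(\<lambda>(t, z). e t *s z) \<in> borel_measurable (I \<Otimes>\<^sub>M M)"
    unfolding case_prod_beta
    by (rule borel_measurable_continuous_Pair[OF measurable_compose[OF measurable_fst em]
       measurable_compose[OF measurable_snd measurable_ident_nu]]) (intro continuous_intros)
  from measurable_compose[OF this Gb]
  have Fm: "(\<lambda>(t, z). G (e t *s z)) \<in> borel_measurable (I \<Otimes>\<^sub>M M)" by (simp add: case_prod_beta)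
  have intG: "integrable M G" using int by (simp add: G_def[abs_def])
  have "integrable (I \<Otimes>\<^sub>M M) (\<lambda>(t, z). G (e t *s z))"
  proof (rule P.Fubini_integrable[OF Fm])
    show "AE t in I. integrable M (\<lambda>z. case (t, z) of (t, z) \<Rightarrow> G (e t *s z))"
      using intG by (simp add: integral_rotation[OF e Gb])
    have "(\<integral>z. norm (G (e t *s z)) \<partial>M) = (\<integral>z. norm (G z) \<partial>M)" for t
      by (rule integral_rotation[OF e]) (use Gb in simp)
    then show "integrable I (\<lambda>t. \<integral>z. norm (case (t, z) of (t, z) \<Rightarrow> G (e t *s z)) \<partial>M)"
      by simp
  qed
  then have "(\<integral>z. (\<integral>t. G (e t *s z) \<partial>I) \<partial>M) = (\<integral>t. (\<integral>z. G (e t *s z) \<partial>M) \<partial>I)"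
    by (rule P.Fubini_integral)
  also have "\<dots> = (\<integral>z. G z \<partial>M)"
    by (simp add: integral_rotation[OF e Gb] mI)
  also have "(\<integral>z. (\<integral>t. G (e t *s z) \<partial>I) \<partial>M) = (\<integral>z. indicator (ball 0 r) z *\<^sub>R g 0 \<partial>M)"
  proof (rule Bochner_Integration.integral_cong[OF refl])
    fix z assume "z \<in> space M"
    then have z: "z \<in> B" by simp
    show "(\<integral>t. G (e t *s z) \<partial>I) = indicator (ball 0 r) z *\<^sub>R g 0"
    proof (cases "z \<in> ball 0 r")
      case True
      have "continuous_on {0..1} (\<lambda>t. g (e t *s z))"
        using z unfolding e_def
        by (intro continuous_on_compose2[OF hol_continuous[OF g]] continuous_intros) (auto simp: norm_scale_vec)
      then have si: "set_integrable lborel {0..1} (\<lambda>t. g (e t *s z))"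
        by (rule borel_integrable_atLeastAtMost')
      have "(\<integral>t. G (e t *s z) \<partial>I) = (LINT t:{0..1}|lborel. g (e t *s z))"
        unfolding I_def set_lebesgue_integral_def
        by (subst integral_restrict_space) (use True in \<open>auto simp: G_def norm_scale_vec e indicator_def intro!: Bochner_Integration.integral_cong\<close>)
      also have "\<dots> = integral {0..1} (\<lambda>t. g (e t *s z))"
        by (rule set_borel_integral_eq_integral[OF si])
      also have "\<dots> = g 0"
        unfolding e_def using hol_circle_mean[OF g z] by (rule integral_unique)
      finally show ?thesis using True by simp
    next
      case False
      then show ?thesis by (simp add: G_def norm_scale_vec e)
    qed
  qed
  also have "\<dots> = measure M (ball 0 r) *\<^sub>R g 0"
  proof -
    have "ball 0 r \<inter> space M = ball 0 r" using r by auto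
    then show ?thesis using ball_in_sets_nu[OF r] by (simp add: emeasure_eq_measure)
  qed
  finally show ?thesis by (simp add: G_def)
qed

sublocale complete_measure M
  by unfold_locales (use nu_complete in blast)

section \<open>The Bergman projection\<close>

text \<open>This rests on completeness: arbitrary subsets of the exceptional null set are
  measurable.\<close>

lemma measurable_AE_eq:
  fixes f :: "complex^'n \<Rightarrow> 'b::topological_space"
  assumes g: "g \<in> borel_measurable M" and ae: "AE z in M. f z = g z"
  shows "f \<in> borel_measurable M"
proof (rule measurableI)
  fix S :: "'b set" assume "S \<in> sets borel"
  then have g: "g -` S \<inter> space M \<in> sets M" by (rule measurable_sets[OF g])
  show "f -` S \<inter> space M \<in> sets M"
    by (rule in_sets_AE[OF _ g]) (use ae AE_space in eventually_elim, auto)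
qed simp

text \<open>The indicator makes \<open>kf\<close> Borel measurable on the whole plane.\<close>

definition kf :: "complex \<Rightarrow> complex" where
  "kf x = indicator {x. Re x > 0} x *\<^sub>R x powr (- of_real N)"

lemma kf_measurable [measurable]: "kf \<in> borel_measurable borel"
  unfolding kf_def
proof (rule borel_measurable_continuous_on_indicator)
  show "continuous_on {x. Re x > 0} (\<lambda>x. x powr (- of_real N))"
    by (intro continuous_intros) (auto simp: complex_nonpos_Reals_iff)
qed simp

lemma cnj_kf: "cnj (kf x) = kf (cnj x)"
  by (cases "Re x > 0") (simp_all add: kf_def cnj_powr)

text \<open>For \<open>z\<close>, \<open>w\<close> in the ball this is the complex conjugate of
  \<open>bergman_kernel \<alpha> z w\<close>, holomorphic in \<open>z\<close>.\<close>

definition K :: "complex^'n \<Rightarrow> complex^'n \<Rightarrow> complex" where "K z w = kf (1 - cdot z w)"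

lemma cnj_K: "cnj (K z w) = K w z"
  by (simp add: K_def cnj_kf cdot_cnj)

lemma K_eq:
  assumes "z \<in> B" "w \<in> B"
  shows "K z w = (1 - cdot z w) powr (- of_real N)"
  using Re_one_minus_cdot_pos[of z w] assms by (simp add: K_def kf_def)

lemma norm_K:
  assumes "z \<in> B" "w \<in> B"
  shows "cmod (K z w) = cmod (1 - cdot z w) powr (- N)"
  using norm_kernel_powr[OF assms(2,1), of "-N"] by (simp add: K_eq[OF assms])

lemma cnj_bergman_kernel:
  assumes "z \<in> B" "w \<in> B"
  shows "cnj (bergman_kernel \<alpha> z w) = K z w"
proof -
  have "bergman_kernel \<alpha> z w = K w z"
    unfolding K_eq[OF assms(2,1)] by (simp add: bergman_kernel_def N_def)
  then show ?thesis by (simp add: cnj_K)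
qed

lemma norm_K_le:
  assumes "z \<in> B" "w \<in> B" "norm z \<le> r" "r < 1"
  shows "cmod (K z w) \<le> (1 - r) powr (- N)"
proof -
  have "norm z * norm w \<le> r * 1" using assms by (intro mult_mono) (auto intro: order_trans[OF norm_ge_zero])
  then have "1 - r \<le> cmod (1 - cdot z w)" using one_minus_cdot_ge[of z w] by simp
  then show ?thesis unfolding norm_K[OF assms(1,2)] using assms N_pos by (intro powr_mono2') auto
qed

lemma measurable_cdot_pair [measurable]: "(\<lambda>(z, w). cdot z w) \<in> borel_measurable (M \<Otimes>\<^sub>M M)"
  unfolding case_prod_beta
  by (rule borel_measurable_continuous_Pair[OF measurable_compose[OF measurable_fst measurable_ident_nu]
       measurable_compose[OF measurable_snd measurable_ident_nu]]) (intro continuous_intros)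

lemma measurable_cdot [measurable]: "(\<lambda>w. cdot z w) \<in> borel_measurable M" "(\<lambda>w. cdot w z) \<in> borel_measurable M"
  by (intro measurable_nu_continuous continuous_intros)+

lemma measurable_K_pair [measurable]: "(\<lambda>(z, w). K z w) \<in> borel_measurable (M \<Otimes>\<^sub>M M)"
  unfolding K_def by measurable

lemma measurable_K [measurable]: "(\<lambda>w. K z w) \<in> borel_measurable M" "(\<lambda>w. K w z) \<in> borel_measurable M"
  unfolding K_def by measurable

lemma ker2_K:
  assumes "a \<in> B" "z \<in> B"
  shows "ker2 a z = (1 - (norm a)\<^sup>2) powr N * (cmod (K a z))\<^sup>2"
proof -
  have 1: "1 - (norm a)\<^sup>2 > 0" using assms by (simp add: abs_square_less_1)
  have "cmod (1 - cdot z a) > 0" using one_minus_cdot_nonpos(3)[of z a] assms by auto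
  moreover have "cmod (1 - cdot z a) = cmod (1 - cdot a z)"
    by (metis cdot_cnj complex_cnj_diff complex_cnj_one complex_mod_cnj)
  ultimately have 2: "cmod (1 - cdot a z) > 0" "cmod (1 - cdot z a) = cmod (1 - cdot a z)" by simp_all
  have "(cmod (K a z))\<^sup>2 = ((cmod (1 - cdot a z))\<^sup>2) powr (- N)"
    unfolding norm_K[OF assms] using 2 by (simp add: power2_eq_square powr_mult)
  then show ?thesis
    using 1 2 by (simp add: ker2_def powr_divide powr_minus divide_simps)
qed

text \<open>The Bergman projection. It makes sense for every integrable function, since the kernel
  is bounded for fixed \<open>z\<close>; the value zero off the ball matches the normalisation of
  \<open>A2\<close>.\<close>

definition proj :: "(complex^'n \<Rightarrow> ell2) \<Rightarrow> complex^'n \<Rightarrow> ell2" where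
  "proj \<psi> z = (if z \<in> B then \<integral>w. K z w *\<^sub>C \<psi> w \<partial>M else 0)"

lemma toeplitz_integral_proj: "toeplitz_integral \<alpha> b f = proj (\<lambda>w. blinfun_apply (b w) (f w))"
  unfolding toeplitz_integral_def proj_def
  by (intro ext if_cong refl Bochner_Integration.integral_cong) (simp add: cnj_bergman_kernel)

lemma integrable_K_scaleC:
  assumes \<psi>: "integrable M \<psi>" and z: "z \<in> B"
  shows "integrable M (\<lambda>w. K z w *\<^sub>C \<psi> w)"
proof (rule Bochner_Integration.integrable_bound)
  show "integrable M (\<lambda>w. (1 - norm z) powr (- N) *\<^sub>R \<psi> w)" using \<psi> by simp
  show "(\<lambda>w. K z w *\<^sub>C \<psi> w) \<in> borel_measurable M" using \<psi> by measurable
  show "AE w in M. norm (K z w *\<^sub>C \<psi> w) \<le> norm ((1 - norm z) powr (- N) *\<^sub>R \<psi> w)"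
    using z by (intro AE_I2) (simp add: mult_right_mono norm_K_le)
qed

text \<open>The remainder is quadratic uniformly on the disc of radius \<rho> < 1, and this
  uniformity permits differentiating \<open>proj\<close> under the integral. The constant bounds the
  second derivative of \<open>(1 - t) powr (- N)\<close> on that disc.\<close>

lemma kernel_taylor:
  assumes \<rho>: "0 \<le> \<rho>" "\<rho> < 1" and t: "cmod t \<le> \<rho>" "cmod t' \<le> \<rho>"
  shows "cmod ((1 - t') powr (- of_real N) - (1 - t) powr (- of_real N)
      - of_real N * (1 - t) powr (- of_real N - 1) * (t' - t))
    \<le> N * (N + 1) * (1 - \<rho>) powr (- N - 2) * (cmod (t' - t))\<^sup>2"
proof -
  define f :: "nat \<Rightarrow> complex \<Rightarrow> complex" where
    "f i t = (if i = 0 then (1 - t) powr (- of_real N) else if i = 1 then of_real N * (1 - t) powr (- of_real N - 1)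
      else of_real N * (of_real N + 1) * (1 - t) powr (- of_real N - 2))" for i t
  have nn: "1 - x \<notin> \<real>\<^sub>\<le>\<^sub>0" if "cmod x \<le> \<rho>" for x
  proof -
    have "Re x < 1" using that \<rho> complex_Re_le_cmod[of x] by linarith
    then show ?thesis by (simp add: complex_nonpos_Reals_iff)
  qed
  have "cmod (f 0 t' - (\<Sum>i\<le>1. f i t * (t' - t) ^ i / fact i)) \<le>
     N * (N + 1) * (1 - \<rho>) powr (- N - 2) * cmod (t' - t) ^ Suc 1 / fact 1"
  proof (rule complex_Taylor[where S = "cball 0 \<rho>"])
    fix i :: nat and x :: complex
    assume x: "x \<in> cball 0 \<rho>" and i: "i \<le> 1"
    have d: "((\<lambda>x. (1 - x) powr s) has_field_derivative (- s * (1 - x) powr (s - 1))) (at x within cball 0 \<rho>)" for s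
      using nn[of x] x by (auto intro!: derivative_eq_intros)
    show "(f i has_field_derivative f (Suc i) x) (at x within cball 0 \<rho>)"
    proof (cases "i = 0")
      case True
      then show ?thesis using d[of "- of_real N"] by (simp add: f_def[abs_def])
    next
      case False
      then have "i = 1" using i by simp
      then show ?thesis using DERIV_cmult[OF d[of "- of_real N - 1"], of "of_real N"]
        by (simp add: f_def[abs_def] algebra_simps)
    qed
  next
    fix x :: complex assume x: "x \<in> cball 0 \<rho>"
    have "1 - \<rho> \<le> cmod (1 - x)" using x norm_triangle_ineq2[of 1 x] by simp
    moreover have "cmod ((1 - x) powr (- of_real N - 2)) = cmod (1 - x) powr (- N - 2)"
      using norm_powr_real_powr'[of "- of_real N - 2" "1 - x"] by simp
    ultimately have "cmod ((1 - x) powr (- of_real N - 2)) \<le> (1 - \<rho>) powr (- N - 2)"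
      using \<rho> N_pos by (simp add: powr_mono2')
    moreover have "cmod (of_real N * (of_real N + 1)) = N * (N + 1)"
    proof -
      have "complex_of_real N * (of_real N + 1) = of_real (N * (N + 1))" by simp
      then show ?thesis using N_pos by (simp only: norm_of_real) simp
    qed
    ultimately show "cmod (f (Suc 1) x) \<le> N * (N + 1) * (1 - \<rho>) powr (- N - 2)"
      using N_pos by (simp add: f_def norm_mult mult_left_mono)
  qed (use t in auto)
  then show ?thesis by (simp add: f_def power2_eq_square algebra_simps)
qed

lemma proj_holomorphic:
  assumes \<psi>: "integrable M \<psi>"
  shows "holomorphic_on_ball (proj \<psi>)"
  unfolding holomorphic_on_ball_def
proof (intro ballI)
  fix z :: "complex^'n" assume z: "z \<in> B"
  \<comment> \<open>Halfway between |z| and 1: every y with |y - z| < e satisfies |y| <= \<rho>, so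
    the Taylor estimate applies to <y,w> and <z,w> for all \<open>w\<close> in the ball.\<close>
  define \<rho> where "\<rho> = (1 + norm z) / 2"
  have \<rho>: "0 \<le> \<rho>" "\<rho> < 1" "norm z \<le> \<rho>" using z by (auto simp: \<rho>_def)
  define e where "e = (1 - norm z) / 2"
  have e: "e > 0" using z by (simp add: e_def)
  define K' where "K' w = of_real N * (if w \<in> B then (1 - cdot z w) powr (- of_real N - 1) else 0)" for w
  have "continuous_on B K'"
  proof -
    have "continuous_on B (\<lambda>w. of_real N * (1 - cdot z w) powr (- of_real N - 1))"
    proof -
      have "Re (cdot z w) \<le> 1" "cdot z w \<noteq> 1" if "norm w < 1" for w
        using Re_one_minus_cdot_pos[of z w] that z by auto
      then show ?thesis by (intro continuous_intros) (auto simp: complex_nonpos_Reals_iff complex_eq_iff)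
    qed
    then show ?thesis by (rule continuous_on_eq) (simp add: K'_def)
  qed
  then have K'm [measurable]: "K' \<in> borel_measurable M" by (rule measurable_nu_continuous)
  define C where "C = N * (1 - norm z) powr (- N - 1)"
  have K'b: "cmod (K' w) \<le> C" if w: "w \<in> B" for w
  proof -
    have "norm z * norm w \<le> norm z * 1" using w by (intro mult_left_mono) auto
    then have "1 - norm z \<le> cmod (1 - cdot z w)" using one_minus_cdot_ge[of z w] by simp
    moreover have "cmod ((1 - cdot z w) powr (- of_real N - 1)) = cmod (1 - cdot z w) powr (- N - 1)"
      using norm_powr_real_powr'[of "- of_real N - 1" "1 - cdot z w"] by simp
    ultimately have "cmod ((1 - cdot z w) powr (- of_real N - 1)) \<le> (1 - norm z) powr (- N - 1)"
      using z N_pos by (simp add: powr_mono2')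
    then show ?thesis using w N_pos by (simp add: K'_def C_def norm_mult)
  qed
  define D where "D h = (\<integral>w. (K' w * cdot h w) *\<^sub>C \<psi> w \<partial>M)" for h
  have iD: "integrable M (\<lambda>w. (K' w * cdot h w) *\<^sub>C \<psi> w)" for h
  proof (rule Bochner_Integration.integrable_bound)
    show "integrable M (\<lambda>w. (C * norm h) *\<^sub>R \<psi> w)" using \<psi> by simp
    show "(\<lambda>w. (K' w * cdot h w) *\<^sub>C \<psi> w) \<in> borel_measurable M" using \<psi> by measurable
    have "cmod (cdot h w) \<le> norm h" if "w \<in> B" for w
      using norm_cdot_le[of h w] that mult_left_le[of "norm w" "norm h"] by simp
    then show "AE w in M. norm ((K' w * cdot h w) *\<^sub>C \<psi> w) \<le> norm ((C * norm h) *\<^sub>R \<psi> w)"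
      using K'b order_trans[OF norm_ge_zero K'b[OF z]]
      by (intro AE_I2) (auto simp: norm_mult intro!: mult_right_mono mult_mono)
  qed
  have iK: "integrable M (\<lambda>w. K z w *\<^sub>C \<psi> w)" if "z \<in> B" for z by (rule integrable_K_scaleC[OF \<psi> that])
  define I where "I = (\<integral>w. norm (\<psi> w) \<partial>M)"
  have I: "I \<ge> 0" by (simp add: I_def)
  have Dadd: "D (x + y) = D x + D y" for x y
    unfolding D_def by (subst Bochner_Integration.integral_add[symmetric, OF iD iD]) (simp add: cdot_add_left algebra_simps scaleC_simps)
  have Dscale: "D (c *s x) = c *\<^sub>C D x" for c x
  proof -
    have "D (c *s x) = (\<integral>w. c *\<^sub>C ((K' w * cdot x w) *\<^sub>C \<psi> w) \<partial>M)"
      unfolding D_def by (simp add: cdot_scale_left scaleC_simps mult_ac)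
    then show ?thesis unfolding D_def
      by (simp add: integral_bounded_linear[OF bounded_bilinear.bounded_linear_right[OF bounded_bilinear_scaleC] iD])
  qed
  have Db: "norm (D h) \<le> norm h * (C * I)" for h
  proof -
    have "norm (D h) \<le> (\<integral>w. norm ((K' w * cdot h w) *\<^sub>C \<psi> w) \<partial>M)" unfolding D_def by (rule integral_norm_bound)
    also have "\<dots> \<le> (\<integral>w. C * norm h * norm (\<psi> w) \<partial>M)"
    proof (rule integral_mono)
      fix w assume "w \<in> space M"
      then have w: "w \<in> B" by simp
      have "cmod (cdot h w) \<le> norm h"
        using norm_cdot_le[of h w] w mult_left_le[of "norm w" "norm h"] by simp
      then show "norm ((K' w * cdot h w) *\<^sub>C \<psi> w) \<le> C * norm h * norm (\<psi> w)"
        using K'b[OF w] order_trans[OF norm_ge_zero K'b[OF z]] by (auto simp: norm_mult intro!: mult_right_mono mult_mono)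
    qed (use \<psi> integrable_norm[OF iD] in simp_all)
    also have "\<dots> = norm h * (C * I)" by (simp add: I_def)
    finally show ?thesis .
  qed
  have bl: "bounded_linear D"
    by (rule bounded_linear_intro[OF _ _ Db]) (simp_all add: Dadd scaleR_vec_complex Dscale scaleR_ell2_def)
  define C2 where "C2 = N * (N + 1) * (1 - \<rho>) powr (- N - 2)"
  have C2: "C2 \<ge> 0" using N_pos by (simp add: C2_def)
  have "(proj \<psi> has_derivative D) (at z within UNIV)"
  proof (rule has_derivativeI_sandwich[OF e bl])
    fix y assume y: "y \<noteq> z" "dist y z < e"
    have "norm y \<le> norm z + dist y z" by (metis dist_norm norm_triangle_sub)
    then have y\<rho>: "norm y \<le> \<rho>" using y by (simp add: e_def \<rho>_def field_simps)
    then have yB: "y \<in> B" using \<rho> by simp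
    have "proj \<psi> y - proj \<psi> z - D (y - z) = (\<integral>w. (K y w - K z w - K' w * cdot (y - z) w) *\<^sub>C \<psi> w \<partial>M)"
      using yB z unfolding proj_def D_def
      by (simp add: scaleC_simps iK iD)
    also have "norm \<dots> \<le> (\<integral>w. norm ((K y w - K z w - K' w * cdot (y - z) w) *\<^sub>C \<psi> w) \<partial>M)"
      by (rule integral_norm_bound)
    also have "\<dots> \<le> (\<integral>w. C2 * (norm (y - z))\<^sup>2 * norm (\<psi> w) \<partial>M)"
    proof (rule integral_mono)
      show "integrable M (\<lambda>w. norm ((K y w - K z w - K' w * cdot (y - z) w) *\<^sub>C \<psi> w))"
        using yB z by (intro integrable_norm) (simp add: scaleC_simps iK iD)
      show "integrable M (\<lambda>w. C2 * (norm (y - z))\<^sup>2 * norm (\<psi> w))" using \<psi> by simp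
      fix w assume "w \<in> space M"
      then have w: "w \<in> B" by simp
      have le: "cmod (cdot x w) \<le> norm x" for x
        using norm_cdot_le[of x w] w mult_left_le[of "norm w" "norm x"] by simp
      have "cmod (K y w - K z w - K' w * cdot (y - z) w) \<le> C2 * (cmod (cdot y w - cdot z w))\<^sup>2"
        using kernel_taylor[OF \<rho>(1,2), of "cdot z w" "cdot y w"] le[of y] le[of z] \<rho> y\<rho> w
        by (simp add: K_eq[OF yB w] K_eq[OF z w] K'_def w C2_def cdot_diff_left)
      also have "\<dots> \<le> C2 * (norm (y - z))\<^sup>2"
        using C2 le[of "y - z"] by (intro mult_left_mono power_mono) (auto simp: cdot_diff_left)
      finally show "norm ((K y w - K z w - K' w * cdot (y - z) w) *\<^sub>C \<psi> w) \<le> C2 * (norm (y - z))\<^sup>2 * norm (\<psi> w)"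
        by (simp add: mult_right_mono)
    qed
    also have "\<dots> = C2 * I * norm (y - z) * norm (y - z)" by (simp add: I_def power2_eq_square)
    finally show "norm (proj \<psi> y - proj \<psi> z - D (y - z)) / norm (y - z) \<le> C2 * I * norm (y - z)"
      using y by (simp add: divide_le_eq)
  next
    show "((\<lambda>y. C2 * I * norm (y - z)) \<longlongrightarrow> 0) (at z within UNIV)"
      by (auto intro!: tendsto_eq_intros)
  qed
  then show "\<exists>D. (proj \<psi> has_derivative D) (at z) \<and> (\<forall>c v. D (c *s v) = c *\<^sub>C D v)"
    using Dscale by auto
qed

text \<open>The mean value formula at 0 is moved to \<open>z\<close> by \<open>phi z\<close>, which
  turns the measure into \<open>ker2 z\<close> times itself. The power of 1 - <w,z> in
  \<open>G\<close> cancels one of the two conjugate kernel factors in \<open>ker2 z w\<close>,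
  leaving \<open>K z w\<close>.\<close>

lemma reproducing_scalar:
  assumes g: "hol g" and int: "integrable M g" and z: "z \<in> B"
  shows "(\<integral>w. K z w * g w \<partial>M) = g z"
proof -
  interpret ball_point z by unfold_locales (use z in simp)
  define G where "G w = g w * (1 - cdot w z) powr of_real N" for w
  have G: "hol G"
    unfolding G_def
  proof (rule hol_mult[OF g], rule hol_compose_field[OF hol_cdot])
    fix w :: "complex^'n" assume "w \<in> B"
    then have "1 - cdot w z \<notin> \<real>\<^sub>\<le>\<^sub>0" using one_minus_cdot_nonpos(1)[of w z] z by simp
    then show "(\<lambda>t. (1 - t) powr of_real N) field_differentiable at (cdot w z)"
      unfolding field_differentiable_def by (auto intro!: exI derivative_eq_intros)
  qed
  have Gm: "G \<in> borel_measurable M" by (rule measurable_nu_continuous[OF hol_continuous[OF G]])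
  define c where "c = (1 - (norm z)\<^sup>2) powr N"
  have c: "c > 0" using norm_a_sq by (simp add: c_def)
  have eq: "ker2 z w *\<^sub>R G w = c *\<^sub>R (K z w * g w)" if w: "w \<in> B" for w
  proof -
    have "K w z * (1 - cdot w z) powr of_real N = 1"
      unfolding K_eq[OF w z] using one_minus_cdot_nonpos(2)[of w z] w z
      by (simp add: powr_minus)
    then have "(K z w * cnj (K z w)) * (1 - cdot w z) powr of_real N = K z w"
      by (simp add: cnj_K)
    moreover have "complex_of_real (ker2 z w) = of_real c * (K z w * cnj (K z w))"
      unfolding ker2_K[OF z w] c_def[symmetric] by (simp add: complex_norm_square[symmetric])
    ultimately have "of_real (ker2 z w) * G w = of_real c * g w * K z w"
      by (simp add: G_def mult_ac)
    then show ?thesis by (simp add: complex_scaleR mult_ac)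
  qed
  have iK: "integrable M (\<lambda>w. K z w * g w)"
  proof (rule Bochner_Integration.integrable_bound)
    show "integrable M (\<lambda>w. (1 - norm z) powr (- N) *\<^sub>R g w)" using int by simp
    show "(\<lambda>w. K z w * g w) \<in> borel_measurable M" using int by measurable
    show "AE w in M. norm (K z w * g w) \<le> norm ((1 - norm z) powr (- N) *\<^sub>R g w)"
      using z by (intro AE_I2) (simp add: mult_right_mono norm_K_le norm_mult)
  qed
  have "integrable M (\<lambda>w. ker2 z w *\<^sub>R G w) \<longleftrightarrow> integrable M (\<lambda>w. c *\<^sub>R (K z w * g w))"
    by (rule Bochner_Integration.integrable_cong) (simp_all add: eq)
  then have i2: "integrable M (\<lambda>w. G (phi z w))"
    using iK integral_phi_nu(2)[OF z Gm] by simp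
  have ind: "integrable M (\<lambda>w. indicator (ball 0 1) w *\<^sub>R G (phi z w)) \<longleftrightarrow> integrable M (\<lambda>w. G (phi z w))"
    by (rule Bochner_Integration.integrable_cong) simp_all
  have "(\<integral>w. c *\<^sub>R (K z w * g w) \<partial>M) = (\<integral>w. ker2 z w *\<^sub>R G w \<partial>M)"
    by (rule Bochner_Integration.integral_cong) (simp_all add: eq)
  also have "\<dots> = (\<integral>w. G (phi z w) \<partial>M)"
    by (rule integral_phi_nu(1)[OF z Gm, symmetric])
  also have "\<dots> = (\<integral>w. indicator (ball 0 1) w *\<^sub>R G (phi z w) \<partial>M)"
    by (rule Bochner_Integration.integral_cong) simp_all
  also have "\<dots> = measure M (ball 0 1) *\<^sub>R G (phi z 0)"
    by (rule mean_value[OF hol_phi[OF G z]]) (use i2 ind in simp_all)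
  also have "\<dots> = G z" by simp
  \<comment> \<open>At w = z the additional factor of \<open>G\<close> is (1 - |z|^2)^N, which is
    \<open>c\<close>.\<close>
  also have "\<dots> = c *\<^sub>R g z"
  proof -
    have "1 - cdot z z = of_real (1 - (norm z)\<^sup>2)" by (simp add: cdot_self)
    then have "(1 - cdot z z) powr of_real N = of_real c"
      using norm_a_sq by (simp add: c_def powr_of_real del: of_real_diff)
    then show ?thesis by (simp add: G_def complex_scaleR)
  qed
  finally show ?thesis using c by simp
qed

lemma reproducing:
  assumes f: "holomorphic_on_ball f" and int: "integrable M f" and z: "z \<in> B"
  shows "proj f z = f z"
proof (rule ell2_eqI)
  fix i
  have "ell2_nth (proj f z) i = (\<integral>w. ell2_nth (K z w *\<^sub>C f w) i \<partial>M)"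
    unfolding proj_def using z
    by (simp add: integral_bounded_linear[OF bounded_linear_nth integrable_K_scaleC[OF int z]] del: ell2_nth_simps)
  also have "\<dots> = (\<integral>w. K z w * ell2_nth (f w) i \<partial>M)" by simp
  also have "\<dots> = ell2_nth (f z) i"
    by (rule reproducing_scalar[OF hol_nth[OF f] integrable_bounded_linear[OF bounded_linear_nth int] z])
  finally show "ell2_nth (proj f z) i = ell2_nth (f z) i" .
qed

end

lemma strongly_measurable_borel:
  fixes f :: "'a \<Rightarrow> 'e::{banach, second_countable_topology}"
  assumes "f \<in> borel_measurable M"
  shows "strongly_measurable M f"
proof -
  obtain s where "\<And>i. simple_function M (s i)" "\<And>x. x \<in> space M \<Longrightarrow> (\<lambda>i. s i x) \<longlonglongrightarrow> f x"
    using borel_measurable_implies_sequence_metric[OF assms, of 0] by metis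
  then show ?thesis unfolding strongly_measurable_def by (intro exI[of _ s]) auto
qed

section \<open>Square-integrable functions and contractivity of the projection\<close>

context bergman
begin

text \<open>Values in \<open>ennreal\<close> allow norm inequalities to be stated and chained before
  finiteness is known.\<close>

definition nsq :: "(complex^'n \<Rightarrow> 'b::real_normed_vector) \<Rightarrow> ennreal" where
  "nsq f = (\<integral>\<^sup>+z. ennreal ((norm (f z))\<^sup>2) \<partial>M)"

lemma nsq_cong: "(\<And>z. z \<in> B \<Longrightarrow> norm (f z) = norm (g z)) \<Longrightarrow> nsq f = nsq g"
  unfolding nsq_def by (rule nn_integral_cong) simp

lemma nsq_mono: "(\<And>z. z \<in> B \<Longrightarrow> norm (f z) \<le> norm (g z)) \<Longrightarrow> nsq f \<le> nsq g"
  unfolding nsq_def by (rule nn_integral_mono) (simp add: ennreal_leI power_mono)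

lemma integrable_sq:
  assumes "f \<in> borel_measurable M" "nsq f < \<infinity>"
  shows "integrable M (\<lambda>z. (norm (f z))\<^sup>2)" "nsq f = ennreal (\<integral>z. (norm (f z))\<^sup>2 \<partial>M)"
proof -
  show 1: "integrable M (\<lambda>z. (norm (f z))\<^sup>2)"
    using assms by (intro integrableI_bounded) (simp_all add: nsq_def)
  show "nsq f = ennreal (\<integral>z. (norm (f z))\<^sup>2 \<partial>M)"
    unfolding nsq_def by (rule nn_integral_eq_integral[OF 1]) simp
qed

lemma nsq_integrable:
  fixes f :: "complex^'n \<Rightarrow> 'b::{banach, second_countable_topology}"
  assumes "f \<in> borel_measurable M" "nsq f < \<infinity>"
  shows "integrable M f"
proof (rule Bochner_Integration.integrable_bound)
  show "integrable M (\<lambda>z. 1 + (norm (f z))\<^sup>2)"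
    using integrable_sq[OF assms] by simp
  have "x \<le> 1 + x\<^sup>2" for x :: real
  proof (cases "x \<le> 1")
    case True
    then show ?thesis using zero_le_power2[of x] by linarith
  next
    case False
    then have "x * 1 \<le> x * x" by (intro mult_left_mono) auto
    then show ?thesis by (simp add: power2_eq_square)
  qed
  then show "AE z in M. norm (f z) \<le> norm (1 + (norm (f z))\<^sup>2)" by simp
qed fact

lemma nsq_add_le:
  fixes f g :: "complex^'n \<Rightarrow> 'b::{real_normed_vector, second_countable_topology}"
  assumes "f \<in> borel_measurable M" "g \<in> borel_measurable M"
  shows "nsq (\<lambda>z. f z + g z) \<le> 2 * nsq f + 2 * nsq g"
proof -
  have "nsq (\<lambda>z. f z + g z) \<le> (\<integral>\<^sup>+z. 2 * ennreal ((norm (f z))\<^sup>2) + 2 * ennreal ((norm (g z))\<^sup>2) \<partial>M)"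
    unfolding nsq_def
  proof (rule nn_integral_mono)
    fix z
    have "(norm (f z + g z))\<^sup>2 \<le> (norm (f z) + norm (g z))\<^sup>2"
      by (intro power_mono norm_triangle_ineq norm_ge_zero)
    also have "\<dots> \<le> 2 * (norm (f z))\<^sup>2 + 2 * (norm (g z))\<^sup>2"
      using sum_squares_bound[of "norm (f z)" "norm (g z)"] by (simp add: power2_sum)
    finally show "ennreal ((norm (f z + g z))\<^sup>2) \<le> 2 * ennreal ((norm (f z))\<^sup>2) + 2 * ennreal ((norm (g z))\<^sup>2)"
      by (simp add: ennreal_leI flip: ennreal_plus ennreal_numeral ennreal_mult')
  qed
  also have "\<dots> = 2 * nsq f + 2 * nsq g"
    using assms unfolding nsq_def by (simp add: nn_integral_add nn_integral_cmult)
  finally show ?thesis .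
qed

lemma nsq_scaleC:
  assumes "f \<in> borel_measurable M"
  shows "nsq (\<lambda>z. c *\<^sub>C (f z)) = ennreal ((cmod c)\<^sup>2) * nsq f"
  unfolding nsq_def using assms
  by (simp add: power_mult_distrib ennreal_mult nn_integral_cmult)

text \<open>The test functions for duality. On their support the kernel is bounded uniformly in the
  other variable, so their projections are bounded and Fubini applies even when the other factor is
  merely integrable.\<close>

definition compactly_bounded :: "(complex^'n \<Rightarrow> ell2) \<Rightarrow> bool" where
  "compactly_bounded g \<longleftrightarrow> g \<in> borel_measurable M \<and>
    (\<exists>r C. 0 \<le> r \<and> r < 1 \<and> (\<forall>z\<in>B. norm (g z) \<le> C) \<and> (\<forall>z\<in>B. r < norm z \<longrightarrow> g z = 0))"

lemma bounded_integrable: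
  fixes g :: "complex^'n \<Rightarrow> 'b::{banach, second_countable_topology}"
  assumes "g \<in> borel_measurable M" "\<And>z. z \<in> B \<Longrightarrow> norm (g z) \<le> C"
  shows "integrable M g" "nsq g < \<infinity>"
proof -
  show "integrable M g"
    by (rule integrable_const_bound[of _ C]) (use assms in auto)
  have "nsq g \<le> (\<integral>\<^sup>+z. ennreal (C\<^sup>2) \<partial>M)"
    unfolding nsq_def using assms(2)
    by (intro nn_integral_mono ennreal_leI power_mono) auto
  also have "\<dots> < \<infinity>" by (simp add: emeasure_nu_ball)
  finally show "nsq g < \<infinity>" .
qed

lemma compactly_bounded_integrable:
  assumes "compactly_bounded g"
  shows "integrable M g" "nsq g < \<infinity>"
  using assms bounded_integrable unfolding compactly_bounded_def by metis+

lemma proj_bounded: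
  assumes g: "compactly_bounded g"
  obtains C where "\<And>z. norm (proj g z) \<le> C"
proof -
  obtain r C where r: "0 \<le> r" "r < 1" "\<And>z. z \<in> B \<Longrightarrow> norm (g z) \<le> C" "\<And>z. z \<in> B \<Longrightarrow> r < norm z \<Longrightarrow> g z = 0"
    using g unfolding compactly_bounded_def by metis
  have C: "0 \<le> C" using order_trans[OF norm_ge_zero r(3)[of 0]] by simp
  have "norm (proj g z) \<le> (1 - r) powr (- N) * C" for z
  proof (cases "z \<in> B")
    case True
    have le: "norm (K z w *\<^sub>C g w) \<le> (1 - r) powr (- N) * C" if w: "w \<in> B" for w
    proof (cases "norm w \<le> r")
      case le: True
      have "cmod (K z w) = cmod (K w z)" by (metis cnj_K complex_mod_cnj)
      also have "\<dots> \<le> (1 - r) powr (- N)" using norm_K_le[OF w True le] r by simp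
      finally show ?thesis using r(3)[OF w] by (simp add: mult_mono)
    qed (use r(4)[OF w] C in \<open>simp add: scaleC_simps\<close>)
    have "norm (proj g z) \<le> (\<integral>w. norm (K z w *\<^sub>C g w) \<partial>M)"
      unfolding proj_def using True by (simp add: integral_norm_bound del: norm_scaleC)
    also have "\<dots> \<le> (\<integral>w. (1 - r) powr (- N) * C \<partial>M)"
    proof (rule integral_mono)
      show "integrable M (\<lambda>w. norm (K z w *\<^sub>C g w))"
        by (intro integrable_norm integrable_K_scaleC[OF compactly_bounded_integrable(1)[OF g] True])
    qed (use le in simp_all)
    finally show ?thesis by simp
  qed (use C in \<open>simp add: proj_def\<close>)
  then show ?thesis by (rule that)
qed

lemma proj_Hinfty:
  assumes g: "compactly_bounded g"
  shows "proj g \<in> Hinfty"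
proof -
  obtain C where "\<And>z. norm (proj g z) \<le> C" using proj_bounded[OF g] by blast
  then have "bounded (proj g ` B)" by (auto simp: bounded_iff)
  then show ?thesis
    using proj_holomorphic[OF compactly_bounded_integrable(1)[OF g]]
    by (simp add: Hinfty_def proj_def)
qed

lemma measurable_proj:
  assumes "integrable M g"
  shows "proj g \<in> borel_measurable M"
  by (rule measurable_nu_continuous[OF holomorphic_on_ball_continuous[OF proj_holomorphic[OF assms]]])

text \<open>The kernel is Hermitian, so this is Fubini. As \<open>g\<close> is bounded and vanishes
  near the sphere, the double integrand is dominated by a multiple of
  \<open>norm (\<psi> w)\<close>.\<close>

lemma proj_adjoint:
  assumes \<psi>: "integrable M \<psi>" and g: "compactly_bounded g"
  shows "(\<integral>z. inner (proj \<psi> z) (g z) \<partial>M) = (\<integral>w. inner (\<psi> w) (proj g w) \<partial>M)"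
proof -
  interpret P: pair_sigma_finite M M by unfold_locales
  obtain r C where r: "0 \<le> r" "r < 1" "\<And>z. z \<in> B \<Longrightarrow> norm (g z) \<le> C" "\<And>z. z \<in> B \<Longrightarrow> r < norm z \<Longrightarrow> g z = 0"
    using g unfolding compactly_bounded_def by metis
  have C: "0 \<le> C" using order_trans[OF norm_ge_zero r(3)[of 0]] by simp
  have gi: "integrable M g" by (rule compactly_bounded_integrable(1)[OF g])
  have [measurable]: "\<psi> \<in> borel_measurable M" "g \<in> borel_measurable M" using \<psi> gi by auto
  define D where "D = (1 - r) powr (- N) * C"
  have D: "D \<ge> 0" using C by (simp add: D_def)
  have le: "\<bar>inner (K z w *\<^sub>C \<psi> w) (g z)\<bar> \<le> D * norm (\<psi> w)" if zw: "z \<in> B" "w \<in> B" for z w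
  proof (cases "norm z \<le> r")
    case True
    have "\<bar>inner (K z w *\<^sub>C \<psi> w) (g z)\<bar> \<le> norm (K z w *\<^sub>C \<psi> w) * norm (g z)" by (rule Cauchy_Schwarz_ineq2)
    also have "\<dots> \<le> ((1 - r) powr (- N) * norm (\<psi> w)) * C"
      using norm_K_le[OF zw True r(2)] r(3)[OF zw(1)] by (auto intro!: mult_mono)
    finally show ?thesis by (simp add: D_def mult_ac)
  qed (use r(4)[OF zw(1)] D in simp)
  have iG: "integrable (M \<Otimes>\<^sub>M M) (\<lambda>(z, w). D * norm (\<psi> w))"
    by (rule P.Fubini_integrable) (use \<psi> in \<open>simp_all add: case_prod_beta\<close>)
  have iF: "integrable (M \<Otimes>\<^sub>M M) (\<lambda>(z, w). inner (K z w *\<^sub>C \<psi> w) (g z))"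
  proof (rule Bochner_Integration.integrable_bound[OF iG])
    show "AE x in M \<Otimes>\<^sub>M M. norm (case x of (z, w) \<Rightarrow> inner (K z w *\<^sub>C \<psi> w) (g z)) \<le> norm (case x of (z, w) \<Rightarrow> D * norm (\<psi> w))"
      using le D by (intro AE_I2) (auto simp: space_pair_measure abs_mult)
  qed measurable
  have "(\<integral>z. inner (proj \<psi> z) (g z) \<partial>M) = (\<integral>z. (\<integral>w. inner (K z w *\<^sub>C \<psi> w) (g z) \<partial>M) \<partial>M)"
  proof (rule Bochner_Integration.integral_cong[OF refl])
    fix z assume "z \<in> space M"
    then have z: "z \<in> B" by simp
    show "inner (proj \<psi> z) (g z) = (\<integral>w. inner (K z w *\<^sub>C \<psi> w) (g z) \<partial>M)"
      using z integral_inner_left[of "g z" M "\<lambda>w. K z w *\<^sub>C \<psi> w"] integrable_K_scaleC[OF \<psi> z] by (simp add: proj_def)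
  qed
  also have "\<dots> = (\<integral>w. (\<integral>z. inner (K z w *\<^sub>C \<psi> w) (g z) \<partial>M) \<partial>M)"
    by (rule P.Fubini_integral[OF iF, symmetric])
  also have "\<dots> = (\<integral>w. inner (\<psi> w) (proj g w) \<partial>M)"
  proof (rule Bochner_Integration.integral_cong[OF refl])
    fix w assume "w \<in> space M"
    then have w: "w \<in> B" by simp
    have "(\<integral>z. inner (K z w *\<^sub>C \<psi> w) (g z) \<partial>M) = (\<integral>z. inner (\<psi> w) (K w z *\<^sub>C g z) \<partial>M)"
      by (simp add: inner_scaleC cnj_K)
    then show "(\<integral>z. inner (K z w *\<^sub>C \<psi> w) (g z) \<partial>M) = inner (\<psi> w) (proj g w)"
      using w integral_inner_right[of "\<psi> w" M "\<lambda>z. K w z *\<^sub>C g z"] integrable_K_scaleC[OF gi w] by (simp add: proj_def)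
  qed
  finally show ?thesis .
qed

lemma abs_inner_le_half: "\<bar>inner x y\<bar> \<le> ((norm x)\<^sup>2 + (norm y)\<^sup>2) / 2" for x y :: "'a::real_inner"
  using Cauchy_Schwarz_ineq2[of x y] sum_squares_bound[of "norm x" "norm y"] by (simp add: mult.assoc)

lemma integrable_inner_sq:
  fixes f g :: "complex^'n \<Rightarrow> ell2"
  assumes "f \<in> borel_measurable M" "nsq f < \<infinity>" "g \<in> borel_measurable M" "nsq g < \<infinity>"
  shows "integrable M (\<lambda>z. inner (f z) (g z))"
proof (rule Bochner_Integration.integrable_bound)
  show "integrable M (\<lambda>z. ((norm (f z))\<^sup>2 + (norm (g z))\<^sup>2) / 2)"
    using integrable_sq assms by (intro integrable_divide Bochner_Integration.integrable_add) auto
  show "AE z in M. norm (inner (f z) (g z)) \<le> norm (((norm (f z))\<^sup>2 + (norm (g z))\<^sup>2) / 2)"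
    by (intro AE_I2) (use abs_inner_le_half in \<open>auto intro: order_trans\<close>)
qed (use assms in measurable)

text \<open>Self-adjointness and P P g = P g give |P g|^2 = <P g, g> <= (|P g|^2 + |g|^2) / 2. The
  term |P g|^2 can be absorbed because P g is bounded, hence of finite norm.\<close>

lemma proj_contraction_compact:
  assumes g: "compactly_bounded g"
  shows "nsq (proj g) \<le> nsq g"
proof -
  note gi = compactly_bounded_integrable[OF g]
  obtain C where C: "\<And>z. norm (proj g z) \<le> C" using proj_bounded[OF g] by blast
  have m: "proj g \<in> borel_measurable M" by (rule measurable_proj[OF gi(1)])
  have pi: "integrable M (proj g)" "nsq (proj g) < \<infinity>" using bounded_integrable[OF m] C by auto
  have gm: "g \<in> borel_measurable M" using gi(1) by auto
  have "(\<integral>z. (norm (proj g z))\<^sup>2 \<partial>M) = (\<integral>z. inner (proj g z) (proj g z) \<partial>M)"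
    by (simp add: power2_norm_eq_inner)
  also have "\<dots> = (\<integral>z. inner (proj (proj g) z) (g z) \<partial>M)"
    by (rule proj_adjoint[OF pi(1) g, symmetric])
  also have "\<dots> = (\<integral>z. inner (proj g z) (g z) \<partial>M)"
    by (rule Bochner_Integration.integral_cong)
      (simp_all add: reproducing[OF proj_holomorphic[OF gi(1)] pi(1)])
  also have "\<dots> \<le> (\<integral>z. ((norm (proj g z))\<^sup>2 + (norm (g z))\<^sup>2) / 2 \<partial>M)"
  proof (rule integral_mono)
    show "inner (proj g z) (g z) \<le> ((norm (proj g z))\<^sup>2 + (norm (g z))\<^sup>2) / 2" for z
      by (rule abs_le_D1[OF abs_inner_le_half])
  qed (use integrable_sq(1)[OF m pi(2)] integrable_sq(1)[OF gm gi(2)] integrable_inner_sq[OF m pi(2) gm gi(2)] in simp_all)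
  also have "\<dots> = ((\<integral>z. (norm (proj g z))\<^sup>2 \<partial>M) + (\<integral>z. (norm (g z))\<^sup>2 \<partial>M)) / 2"
    using integrable_sq[OF m pi(2)] integrable_sq[OF gm gi(2)] by simp
  finally have "(\<integral>z. (norm (proj g z))\<^sup>2 \<partial>M) \<le> (\<integral>z. (norm (g z))\<^sup>2 \<partial>M)" by simp
  then show ?thesis
    by (simp add: integrable_sq(2)[OF m pi(2)] integrable_sq(2)[OF gm gi(2)] ennreal_leI)
qed

text \<open>Fatou's lemma for squared norms.\<close>

lemma nsq_liminf:
  fixes f :: "nat \<Rightarrow> complex^'n \<Rightarrow> 'b::{real_normed_vector, second_countable_topology}"
  assumes "\<And>k. f k \<in> borel_measurable M" "\<And>z. z \<in> B \<Longrightarrow> (\<lambda>k. f k z) \<longlonglongrightarrow> h z" "\<And>k. nsq (f k) \<le> A"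
  shows "nsq h \<le> A"
proof -
  note [measurable] = assms(1)
  have "nsq h = (\<integral>\<^sup>+z. liminf (\<lambda>k. ennreal ((norm (f k z))\<^sup>2)) \<partial>M)"
    unfolding nsq_def
  proof (rule nn_integral_cong)
    fix z assume "z \<in> space M"
    then have "(\<lambda>k. ennreal ((norm (f k z))\<^sup>2)) \<longlonglongrightarrow> ennreal ((norm (h z))\<^sup>2)"
      using assms(2)[of z] by (intro tendsto_ennrealI tendsto_intros) simp
    then show "ennreal ((norm (h z))\<^sup>2) = liminf (\<lambda>k. ennreal ((norm (f k z))\<^sup>2))"
      by (rule lim_imp_Liminf[OF trivial_limit_sequentially, symmetric])
  qed
  also have "\<dots> \<le> liminf (\<lambda>k. nsq (f k))"
    unfolding nsq_def by (intro nn_integral_liminf) measurable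
  also have "\<dots> \<le> limsup (\<lambda>k. nsq (f k))" by (rule Liminf_le_Limsup) simp
  also have "\<dots> \<le> A" using assms(3) by (intro Limsup_bounded) simp
  finally show ?thesis .
qed

lemma radius_tendsto: "(\<lambda>k. 1 - 1 / real (Suc k)) \<longlonglongrightarrow> 1"
  using tendsto_diff[OF tendsto_const[of 1] LIMSEQ_inverse_real_of_nat] by (simp add: inverse_eq_divide)

definition trunc :: "nat \<Rightarrow> (complex^'n \<Rightarrow> ell2) \<Rightarrow> complex^'n \<Rightarrow> ell2" where
  "trunc k \<psi> z = (if norm z \<le> 1 - 1 / real (Suc k) \<and> norm (\<psi> z) \<le> real k then \<psi> z else 0)"

lemma trunc_measurable [measurable]:
  assumes [measurable]: "\<psi> \<in> borel_measurable M"
  shows "trunc k \<psi> \<in> borel_measurable M"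
  unfolding trunc_def[abs_def] by measurable

lemma trunc_compactly_bounded:
  assumes "\<psi> \<in> borel_measurable M"
  shows "compactly_bounded (trunc k \<psi>)"
  unfolding compactly_bounded_def using assms
  by (intro conjI exI[of _ "1 - 1 / real (Suc k)"] exI[of _ "real k"]) (auto simp: trunc_def)

lemma trunc_tendsto:
  assumes "z \<in> B"
  shows "(\<lambda>k. trunc k \<psi> z) \<longlonglongrightarrow> \<psi> z"
proof (rule tendsto_eventually)
  have "norm z < 1" using assms by simp
  from order_tendstoD(1)[OF radius_tendsto this]
  have "\<forall>\<^sub>F k in sequentially. norm z < 1 - 1 / real (Suc k)" .
  moreover have "\<forall>\<^sub>F k in sequentially. norm (\<psi> z) \<le> real k"
    using filterlim_real_sequentially by (simp add: filterlim_at_top)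
  ultimately show "\<forall>\<^sub>F k in sequentially. trunc k \<psi> z = \<psi> z"
    by eventually_elim (simp add: trunc_def)
qed

lemma norm_trunc_le: "norm (trunc k \<psi> z) \<le> norm (\<psi> z)"
  by (simp add: trunc_def)

lemma proj_tendsto_trunc:
  assumes \<psi>: "integrable M \<psi>"
  shows "(\<lambda>k. proj (trunc k \<psi>) z) \<longlonglongrightarrow> proj \<psi> z"
proof (cases "z \<in> B")
  case True
  have [measurable]: "\<psi> \<in> borel_measurable M" using \<psi> by auto
  have "(\<lambda>k. \<integral>w. K z w *\<^sub>C trunc k \<psi> w \<partial>M) \<longlonglongrightarrow> (\<integral>w. K z w *\<^sub>C \<psi> w \<partial>M)"
  proof (rule integral_dominated_convergence)
    show "integrable M (\<lambda>w. norm (K z w *\<^sub>C \<psi> w))"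
      by (intro integrable_norm integrable_K_scaleC[OF \<psi> True])
    show "AE w in M. (\<lambda>k. K z w *\<^sub>C trunc k \<psi> w) \<longlonglongrightarrow> K z w *\<^sub>C \<psi> w"
      by (intro AE_I2 bounded_bilinear.tendsto[OF bounded_bilinear_scaleC] tendsto_const trunc_tendsto) simp
    show "AE w in M. norm (K z w *\<^sub>C trunc k \<psi> w) \<le> norm (K z w *\<^sub>C \<psi> w)" for k
      by (intro AE_I2) (simp add: mult_left_mono norm_trunc_le)
  qed measurable
  then show ?thesis using True by (simp add: proj_def)
qed (simp add: proj_def)

lemma proj_contraction:
  assumes \<psi>: "\<psi> \<in> borel_measurable M" "nsq \<psi> < \<infinity>"
  shows "nsq (proj \<psi>) \<le> nsq \<psi>"
proof (rule nsq_liminf)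
  note cb = trunc_compactly_bounded[OF \<psi>(1)]
  show "proj (trunc k \<psi>) \<in> borel_measurable M" for k
    by (rule measurable_proj[OF compactly_bounded_integrable(1)[OF cb]])
  show "(\<lambda>k. proj (trunc k \<psi>) z) \<longlonglongrightarrow> proj \<psi> z" for z
    by (rule proj_tendsto_trunc[OF nsq_integrable[OF \<psi>]])
  have "nsq (proj (trunc k \<psi>)) \<le> nsq (trunc k \<psi>)" for k by (rule proj_contraction_compact[OF cb])
  also have "nsq (trunc k \<psi>) \<le> nsq \<psi>" for k by (rule nsq_mono[OF norm_trunc_le])
  finally show "nsq (proj (trunc k \<psi>)) \<le> nsq \<psi>" for k .
qed

section \<open>The Bergman space and the density of bounded functions\<close>

lemma A2_iff:
  fixes f :: "complex^'n \<Rightarrow> ell2"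
  shows  "f \<in> A2 \<alpha> \<longleftrightarrow> holomorphic_on_ball f \<and> (\<forall>z. z \<notin> B \<longrightarrow> f z = 0) \<and> nsq f < \<infinity>"
proof -
  have "(\<integral>\<^sup>+z. ennreal (norm (f z) powr 2) \<partial>M) = nsq f"
    unfolding nsq_def by (intro nn_integral_cong) (simp add: powr_numeral)
  moreover have "strongly_measurable M f" if "holomorphic_on_ball f"
    using that by (intro strongly_measurable_borel measurable_nu_continuous holomorphic_on_ball_continuous)
  ultimately show ?thesis unfolding A2_def Lp_def mem_Collect_eq by auto
qed

lemma A2D:
  fixes f :: "complex^'n \<Rightarrow> ell2"
  assumes "f \<in> A2 \<alpha>"
  shows "holomorphic_on_ball f" "\<And>z. z \<notin> B \<Longrightarrow> f z = 0" "nsq f < \<infinity>" "f \<in> borel_measurable M" "integrable M f"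
proof -
  show h: "holomorphic_on_ball f" "\<And>z. z \<notin> B \<Longrightarrow> f z = 0" "nsq f < \<infinity>"
    using assms unfolding A2_iff by auto
  show m: "f \<in> borel_measurable M"
    by (rule measurable_nu_continuous[OF holomorphic_on_ball_continuous[OF h(1)]])
  show "integrable M f" by (rule nsq_integrable[OF m h(3)])
qed

lemma Lp_norm_nonneg: "Lp_norm \<alpha> 2 (f :: complex^'n \<Rightarrow> ell2) \<ge> 0"
  by (simp add: Lp_norm_def)

lemma nsq_A2:
  fixes f :: "complex^'n \<Rightarrow> ell2"
  assumes "f \<in> A2 \<alpha>"
  shows "nsq f = ennreal ((Lp_norm \<alpha> 2 f)\<^sup>2)"
proof -
  have "Lp_norm \<alpha> 2 f = sqrt (\<integral>z. (norm (f z))\<^sup>2 \<partial>M)"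
    unfolding Lp_norm_def by (simp add: powr_numeral powr_half_sqrt)
  then show ?thesis
    using integrable_sq(2)[OF A2D(4,3)[OF assms]] by simp
qed

lemma A2_zero: "(\<lambda>_ :: complex^'n. 0) \<in> A2 \<alpha>"
  by (auto simp: A2_iff nsq_def holomorphic_on_ball_def scaleC_simps intro!: exI[of _ "\<lambda>_. 0"])

lemma A2_add:
  fixes f g :: "complex^'n \<Rightarrow> ell2"
  assumes f: "f \<in> A2 \<alpha>" and g: "g \<in> A2 \<alpha>"
  shows "(\<lambda>z. f z + g z) \<in> A2 \<alpha>"
  unfolding A2_iff
proof (intro conjI)
  show "holomorphic_on_ball (\<lambda>z. f z + g z)"
    unfolding holomorphic_on_ball_def
  proof
    fix z :: "complex^'n" assume z: "z \<in> B"
    obtain D E where *: "(f has_derivative D) (at z)" "\<And>c v. D (c *s v) = c *\<^sub>C D v"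
      "(g has_derivative E) (at z)" "\<And>c v. E (c *s v) = c *\<^sub>C E v"
      using A2D(1)[OF f] A2D(1)[OF g] z unfolding holomorphic_on_ball_def by meson
    show "\<exists>D. ((\<lambda>z. f z + g z) has_derivative D) (at z) \<and> (\<forall>c v. D (c *s v) = c *\<^sub>C D v)"
      by (intro exI[of _ "\<lambda>v. D v + E v"] conjI has_derivative_add *) (simp add: * scaleC_simps)
  qed
  have "nsq (\<lambda>z. f z + g z) \<le> 2 * nsq f + 2 * nsq g" by (rule nsq_add_le) (use A2D f g in auto)
  also have "\<dots> < \<infinity>" using A2D(3)[OF f] A2D(3)[OF g] by (simp add: ennreal_mult_less_top)
  finally show "nsq (\<lambda>z. f z + g z) < \<infinity>" .
  show "\<forall>z. z \<notin> B \<longrightarrow> f z + g z = 0" using A2D(2)[OF f] A2D(2)[OF g] by simp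
qed

lemma A2_linear:
  fixes f :: "complex^'n \<Rightarrow> ell2"
  assumes f: "f \<in> A2 \<alpha>" and L: "bounded_linear L" "\<And>c x. L (c *\<^sub>C x) = c *\<^sub>C L x"
  shows "(\<lambda>z. L (f z)) \<in> A2 \<alpha>"
  unfolding A2_iff
proof (intro conjI)
  interpret L: bounded_linear L by fact
  show "holomorphic_on_ball (\<lambda>z. L (f z))"
    unfolding holomorphic_on_ball_def
  proof
    fix z :: "complex^'n" assume z: "z \<in> B"
    obtain D where *: "(f has_derivative D) (at z)" "\<And>c v. D (c *s v) = c *\<^sub>C D v"
      using A2D(1)[OF f] z unfolding holomorphic_on_ball_def by meson
    show "\<exists>D. ((\<lambda>z. L (f z)) has_derivative D) (at z) \<and> (\<forall>c v. D (c *s v) = c *\<^sub>C D v)"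
      by (intro exI[of _ "\<lambda>v. L (D v)"] conjI L.has_derivative *) (simp add: * L)
  qed
  obtain C where C: "C > 0" "\<And>x. norm (L x) \<le> norm x * C" using L.pos_bounded by blast
  have "nsq (\<lambda>z. L (f z)) \<le> nsq (\<lambda>z. of_real C *\<^sub>C f z)"
    by (rule nsq_mono) (use C in \<open>simp add: mult.commute\<close>)
  also have "\<dots> < \<infinity>" unfolding nsq_scaleC[OF A2D(4)[OF f]]
    using A2D(3)[OF f] by (simp add: ennreal_mult_less_top)
  finally show "nsq (\<lambda>z. L (f z)) < \<infinity>" .
  show "\<forall>z. z \<notin> B \<longrightarrow> L (f z) = 0" using A2D(2)[OF f] L.zero by simp
qed

lemma A2_scaleC:
  fixes f :: "complex^'n \<Rightarrow> ell2"
  assumes f: "f \<in> A2 \<alpha>"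
  shows "(\<lambda>z. c *\<^sub>C f z) \<in> A2 \<alpha>"
  by (rule A2_linear[OF f bounded_bilinear.bounded_linear_right[OF bounded_bilinear_scaleC]])
    (simp add: scaleC_simps mult.commute)

lemma A2_diff:
  fixes f g :: "complex^'n \<Rightarrow> ell2"
  assumes f: "f \<in> A2 \<alpha>" and g: "g \<in> A2 \<alpha>"
  shows "(\<lambda>z. f z - g z) \<in> A2 \<alpha>"
proof -
  have "(\<lambda>z. f z - g z) = (\<lambda>z. f z + (- 1) *\<^sub>C g z)" by (intro ext ell2_eqI) simp
  then show ?thesis using A2_add[OF f A2_scaleC[OF g, of "-1"]] by simp
qed

lemma proj_id:
  fixes f :: "complex^'n \<Rightarrow> ell2"
  assumes f: "f \<in> A2 \<alpha>"
  shows "proj f = f"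
proof
  fix z show "proj f z = f z"
    using reproducing[OF A2D(1)[OF f] A2D(5)[OF f]] A2D(2)[OF f] by (cases "z \<in> B") (auto simp: proj_def)
qed

lemma proj_diff:
  fixes f g :: "complex^'n \<Rightarrow> ell2"
  assumes "integrable M f" "integrable M g"
  shows "proj (\<lambda>z. f z - g z) = (\<lambda>z. proj f z - proj g z)"
  by (auto simp: fun_eq_iff proj_def scaleC_simps integrable_K_scaleC[OF assms(1)] integrable_K_scaleC[OF assms(2)])

lemma Hinfty_A2:
  fixes f :: "complex^'n \<Rightarrow> ell2"
  assumes f: "f \<in> Hinfty"
  shows "f \<in> A2 \<alpha>"
proof -
  obtain C where "\<And>z. z \<in> B \<Longrightarrow> norm (f z) \<le> C" using f by (force simp: Hinfty_def bounded_iff)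
  moreover have "f \<in> borel_measurable M"
    using f by (auto simp: Hinfty_def intro: measurable_nu_continuous holomorphic_on_ball_continuous)
  ultimately have "nsq f < \<infinity>" by (intro bounded_integrable(2))
  then show "f \<in> A2 \<alpha>" using f by (auto simp: A2_iff Hinfty_def)
qed

text \<open>Since P f = f, the error f - P (trunc k f) is P (f - trunc k f), which contractivity
  controls; the truncation error tends to zero by dominated convergence.\<close>

lemma Hinfty_dense:
  fixes f :: "complex^'n \<Rightarrow> ell2"
  assumes f: "f \<in> A2 \<alpha>"
  obtains g where "\<And>k. g k \<in> Hinfty" "(\<lambda>k. nsq (\<lambda>z. f z - g k z)) \<longlonglongrightarrow> 0"
proof -
  note [measurable] = A2D(4)[OF f]
  define g where "g k = proj (trunc k f)" for k
  note cb = trunc_compactly_bounded[OF A2D(4)[OF f]]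
  have "g k \<in> Hinfty" for k unfolding g_def by (rule proj_Hinfty[OF cb])
  have nd: "nsq (\<lambda>z. f z - trunc k f z) < \<infinity>" for k
    by (rule order_le_less_trans[OF nsq_mono A2D(3)[OF f]]) (simp add: trunc_def)
  have le: "nsq (\<lambda>z. f z - g k z) \<le> nsq (\<lambda>z. f z - trunc k f z)" for k
  proof -
    have "nsq (\<lambda>z. f z - g k z) = nsq (proj (\<lambda>z. f z - trunc k f z))"
      unfolding g_def proj_diff[OF A2D(5)[OF f] compactly_bounded_integrable(1)[OF cb]] proj_id[OF f] ..
    also have "\<dots> \<le> nsq (\<lambda>z. f z - trunc k f z)"
      by (rule proj_contraction[OF _ nd]) measurable
    finally show ?thesis .
  qed
  have lim: "(\<lambda>k. nsq (\<lambda>z. f z - trunc k f z)) \<longlonglongrightarrow> (\<integral>\<^sup>+z. 0 \<partial>M)"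
    unfolding nsq_def
  proof (rule nn_integral_dominated_convergence)
    show "(\<integral>\<^sup>+z. ennreal ((norm (f z))\<^sup>2) \<partial>M) < \<infinity>" using A2D(3)[OF f] by (simp add: nsq_def)
    show "AE z in M. (\<lambda>k. ennreal ((norm (f z - trunc k f z))\<^sup>2)) \<longlonglongrightarrow> 0"
    proof (rule AE_I2)
      fix z assume "z \<in> space M"
      then have "(\<lambda>k. ennreal ((norm (f z - trunc k f z))\<^sup>2)) \<longlonglongrightarrow> ennreal ((norm (f z - f z))\<^sup>2)"
        by (intro tendsto_ennrealI tendsto_intros trunc_tendsto) simp
      then show "(\<lambda>k. ennreal ((norm (f z - trunc k f z))\<^sup>2)) \<longlonglongrightarrow> 0" by simp
    qed
    show "AE z in M. ennreal ((norm (f z - trunc k f z))\<^sup>2) \<le> ennreal ((norm (f z))\<^sup>2)" for k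
      by (intro AE_I2) (simp add: trunc_def)
  qed measurable
  have "(\<lambda>k. nsq (\<lambda>z. f z - g k z)) \<longlonglongrightarrow> 0"
  proof (rule tendsto_sandwich[of "\<lambda>_. 0"])
    show "(\<lambda>k. nsq (\<lambda>z. f z - trunc k f z)) \<longlonglongrightarrow> 0" using lim by simp
    show "(\<lambda>_. 0) \<longlonglongrightarrow> (0::ennreal)" by simp
  qed (use le in auto)
  with \<open>\<And>k. g k \<in> Hinfty\<close> show ?thesis by (rule that)
qed

text \<open>By the reproducing formula the value of an element of \<open>A2\<close> at a point
  depends only on its almost-everywhere class.\<close>

lemma nsq_zero:
  fixes f :: "complex^'n \<Rightarrow> ell2"
  assumes f: "f \<in> A2 \<alpha>" and "nsq f = 0"
  shows "f = (\<lambda>_. 0)"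
proof
  have "AE w in M. f w = 0"
    using assms(2) A2D(4)[OF f] unfolding nsq_def by (subst (asm) nn_integral_0_iff_AE) auto
  then have "proj f z = proj (\<lambda>_. 0) z" for z
    unfolding proj_def using A2D(4)[OF f]
    by (intro if_cong refl integral_cong_AE) (auto elim!: eventually_mono)
  then show "f z = 0" for z
    using proj_id[OF f] proj_id[OF A2_zero] by metis
qed

section \<open>Carleson densities\<close>

definition half_mass :: real where "half_mass = measure M (ball 0 (1/2))"

lemma measure_ball_pos:
  assumes "0 < r" "r \<le> 1"
  shows "measure M (ball 0 r) > 0"
proof (rule ccontr)
  assume "\<not> measure M (ball 0 r) > 0"
  then have "measure M (ball 0 r) = 0" by (simp add: not_less measure_le_0_iff)
  then have "ball 0 r \<in> null_sets M"
    using ball_in_sets_nu[OF assms(2)] by (simp add: null_sets_def emeasure_eq_measure)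
  then have "ball (0 :: complex^'n) r \<in> null_sets lebesgue"
    by (auto simp: null_sets_nu_iff null_sets_restrict_space)
  then have "emeasure lborel (ball (0 :: complex^'n) r) = 0" by (auto simp: null_sets_def)
  then show False using content_ball_pos[OF assms(1), of "0 :: complex^'n"] by (simp add: measure_def)
qed

lemma half_mass_pos: "half_mass > 0"
  by (simp add: half_mass_def measure_ball_pos)

lemma measurable_ker2_pair [measurable]: "(\<lambda>(z, w). ker2 z w) \<in> borel_measurable (M \<Otimes>\<^sub>M M)"
proof -
  have [measurable]: "(\<lambda>(z, w). cdot w z) \<in> borel_measurable (M \<Otimes>\<^sub>M M)"
    using measurable_compose[OF measurable_pair_swap' measurable_cdot_pair] by (simp add: case_prod_beta)
  show ?thesis unfolding ker2_def by measurable
qed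

lemma measurable_ker2' [measurable]: "(\<lambda>w. ker2 z w) \<in> borel_measurable M" "(\<lambda>w. ker2 w z) \<in> borel_measurable M"
  unfolding ker2_def by measurable

section \<open>Hyperbolic balls and local masses\<close>

lemma norm_one_minus_cdot_commute: "cmod (1 - cdot w z) = cmod (1 - cdot z w)"
  using complex_mod_cnj[of "1 - cdot w z"] by (simp add: cdot_cnj)

text \<open>For r >= 0 and points of the ball this says |phi_z(w)| < r, see \<open>near_iff\<close>.
  The closed expression makes symmetry and joint measurability immediate.\<close>

definition near :: "real \<Rightarrow> complex^'n \<Rightarrow> complex^'n \<Rightarrow> bool" where
  "near r z w \<longleftrightarrow> (1 - (norm z)\<^sup>2) * (1 - (norm w)\<^sup>2) / (cmod (1 - cdot w z))\<^sup>2 > 1 - r\<^sup>2"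

lemma near_commute: "near r z w \<longleftrightarrow> near r w z"
proof -
  have "cmod (1 - cdot w z) = cmod (1 - cdot z w)"
    by (rule norm_one_minus_cdot_commute)
  then show ?thesis by (simp add: near_def mult.commute)
qed

lemma near_iff:
  assumes "z \<in> B" "w \<in> B" "r \<ge> 0"
  shows "near r z w \<longleftrightarrow> norm (phi z w) < r"
proof -
  interpret ball_point z by unfold_locales (use assms in simp)
  have "(1 - (norm z)\<^sup>2) * (1 - (norm w)\<^sup>2) / (cmod (1 - cdot w z))\<^sup>2 = 1 - (norm (phi z w))\<^sup>2"
    using assms by (simp add: norm_phi)
  then have "near r z w \<longleftrightarrow> (norm (phi z w))\<^sup>2 < r\<^sup>2" by (simp add: near_def)
  also have "\<dots> \<longleftrightarrow> norm (phi z w) < r"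
    using power2_less_imp_less[OF _ assms(3)] power_strict_mono[of "norm (phi z w)" r 2] by auto
  finally show ?thesis .
qed

lemma near_measurable [measurable]: "(\<lambda>(z, w). indicator {w. near r z w} w :: ennreal) \<in> borel_measurable (M \<Otimes>\<^sub>M M)"
proof -
  have [measurable]: "(\<lambda>(z, w). cdot w z) \<in> borel_measurable (M \<Otimes>\<^sub>M M)"
    using measurable_compose[OF measurable_pair_swap' measurable_cdot_pair] by (simp add: case_prod_beta)
  have "(\<lambda>(z, w). indicator {w. near r z w} w :: ennreal) = (\<lambda>(z, w). if near r z w then 1 else 0)"
    by (auto simp: fun_eq_iff)
  also have "\<dots> \<in> borel_measurable (M \<Otimes>\<^sub>M M)" unfolding near_def by measurable
  finally show ?thesis .
qed

text \<open>In the coordinate v = phi_w(z), where |v| < 1/2, the identity \<open>norm_phi\<close>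
  shows that the ratio of the two factors is at most 1 / |1 - <v,w>|^2 <= 4.\<close>

lemma near_half_weight:
  assumes z: "z \<in> B" and w: "w \<in> B" and nr: "near (1/2) z w"
  shows "1 - (norm z)\<^sup>2 \<le> 4 * (1 - (norm w)\<^sup>2)"
proof -
  interpret ball_point w by unfold_locales (use w in simp)
  define v where "v = phi w z"
  have v: "norm v < 1/2" using nr z w near_iff[of w z "1/2"] by (simp add: near_commute v_def)
  have zv: "z = phi w v" using z by (simp add: v_def phi_phi)
  have "norm v * norm w \<le> 1/2 * 1" using v w by (intro mult_mono) auto
  then have q: "1/2 \<le> cmod (1 - cdot v w)" using one_minus_cdot_ge[of v w] by simp
  have w1: "1 - (norm w)\<^sup>2 > 0" using norm_a_sq by simp
  have "1 - (norm z)\<^sup>2 = (1 - (norm w)\<^sup>2) * (1 - (norm v)\<^sup>2) / (cmod (1 - cdot v w))\<^sup>2"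
    unfolding zv using v by (intro norm_phi) simp
  also have "\<dots> \<le> (1 - (norm w)\<^sup>2) * 1 / (1/2)\<^sup>2"
    using q w1 v by (intro frac_le mult_left_mono power_mono mult_pos_pos zero_le_power) (auto simp: abs_square_less_1 abs_square_le_1)
  finally show ?thesis by (simp add: power2_eq_square)
qed

text \<open>The two kernels share the denominator and differ only by the factors compared in
  \<open>near_half_weight\<close>.\<close>

lemma ker2_near:
  assumes z: "z \<in> B" and w: "w \<in> B" and nr: "near (1/2) z w"
  shows "ker2 z w \<le> 4 powr N * ker2 w z"
proof -
  have c: "cmod (1 - cdot w z) = cmod (1 - cdot z w)"
    by (rule norm_one_minus_cdot_commute)
  have 1: "1 - (norm z)\<^sup>2 > 0" "1 - (norm w)\<^sup>2 > 0" using z w by (auto simp: abs_square_less_1)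
  have "ker2 z w \<le> (4 * (1 - (norm w)\<^sup>2) / (cmod (1 - cdot w z))\<^sup>2) powr N"
    unfolding ker2_def using near_half_weight[OF assms] N_pos 1 by (intro powr_mono2 divide_right_mono) auto
  also have "\<dots> = 4 powr N * ker2 w z"
    unfolding ker2_def c using 1 by (simp add: powr_mult[symmetric])
  finally show ?thesis .
qed

text \<open>The mass of |g|^2 on the hyperbolic ball of radius 1/2 about \<open>z\<close>, taken in
  the coordinate centred at \<open>z\<close>. In the original coordinate the measure acquires the
  density \<open>ker2 z\<close>, see \<open>nn_integral_local\<close>.\<close>

definition local_mass :: "(complex^'n \<Rightarrow> 'b::real_normed_vector) \<Rightarrow> complex^'n \<Rightarrow> ennreal" where
  "local_mass g z = (\<integral>\<^sup>+v\<in>ball 0 (1/2). ennreal ((norm (g (phi z v)))\<^sup>2) \<partial>M)"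

lemma nn_integral_local:
  fixes h :: "complex^'n \<Rightarrow> ennreal"
  assumes z: "z \<in> B" and [measurable]: "h \<in> borel_measurable M" and r: "r \<ge> 0"
  shows "(\<integral>\<^sup>+v\<in>ball 0 r. h (phi z v) \<partial>M) = (\<integral>\<^sup>+w. ennreal (ker2 z w) * (h w * indicator {w. near r z w} w) \<partial>M)"
proof -
  interpret ball_point z by unfold_locales (use z in simp)
  have [measurable]: "(\<lambda>w. indicator {w. near r z w} w :: ennreal) \<in> borel_measurable M"
    using measurable_compose[OF measurable_Pair1'[of z M M] near_measurable] z by simp
  have "(\<integral>\<^sup>+v\<in>ball 0 r. h (phi z v) \<partial>M) = (\<integral>\<^sup>+v. h (phi z v) * indicator {w. near r z w} (phi z v) \<partial>M)"
  proof (rule nn_integral_cong)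
    fix v assume "v \<in> space M"
    then have v: "v \<in> B" by simp
    then have "near r z (phi z v) \<longleftrightarrow> norm v < r"
      using near_iff[OF z _ r, of "phi z v"] phi_in_ball[of v] phi_phi[of v] by simp
    then show "h (phi z v) * indicator (ball 0 r) v = h (phi z v) * indicator {w. near r z w} (phi z v)"
      by (simp add: indicator_def)
  qed
  also have "\<dots> = (\<integral>\<^sup>+w. ennreal (ker2 z w) * (h w * indicator {w. near r z w} w) \<partial>M)"
    by (rule nn_integral_phi_nu[OF z]) measurable
  finally show ?thesis .
qed

text \<open>After Fubini, \<open>ker2_near\<close> exchanges the arguments of the kernel at the cost
  4^N, and the inner integral becomes the Carleson condition with centre \<open>w\<close>. As
  \<open>w\<close> is integrated, the condition suffices almost everywhere.\<close>

lemma local_mass_integral: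
  fixes m :: "complex^'n \<Rightarrow> real"
  assumes [measurable]: "m \<in> borel_measurable M" "g \<in> borel_measurable M" and m: "\<And>z. m z \<ge> 0"
    and C: "AE w in M. (\<integral>\<^sup>+z. ennreal (m z * ker2 w z) \<partial>M) \<le> ennreal C"
  shows "(\<integral>\<^sup>+z. ennreal (m z) * local_mass g z \<partial>M) \<le> ennreal (4 powr N * C) * nsq g"
proof -
  interpret P: pair_sigma_finite M M by unfold_locales
  have [measurable]: "(\<lambda>w. indicator {w. near r z w} w :: ennreal) \<in> borel_measurable M" if "z \<in> B" for r z
    using measurable_compose[OF measurable_Pair1'[of z M M] near_measurable] that by simp
  have "(\<integral>\<^sup>+z. ennreal (m z) * local_mass g z \<partial>M) =
      (\<integral>\<^sup>+z. (\<integral>\<^sup>+w. ennreal (m z) * (ennreal (ker2 z w) * (ennreal ((norm (g w))\<^sup>2) * indicator {w. near (1/2) z w} w)) \<partial>M) \<partial>M)"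
  proof (rule nn_integral_cong)
    fix z assume "z \<in> space M"
    then have z: "z \<in> B" by simp
    show "ennreal (m z) * local_mass g z = (\<integral>\<^sup>+w. ennreal (m z) * (ennreal (ker2 z w) * (ennreal ((norm (g w))\<^sup>2) * indicator {w. near (1/2) z w} w)) \<partial>M)"
      unfolding local_mass_def using z by (subst nn_integral_local[OF z]) (auto intro!: nn_integral_cmult[symmetric])
  qed
  also have "\<dots> \<le> (\<integral>\<^sup>+z. (\<integral>\<^sup>+w. ennreal (4 powr N) * (ennreal ((norm (g w))\<^sup>2) * ennreal (m z * ker2 w z)) \<partial>M) \<partial>M)"
  proof (intro nn_integral_mono)
    fix z w assume "z \<in> space M" "w \<in> space M"
    then have zw: "z \<in> B" "w \<in> B" by auto
    show "ennreal (m z) * (ennreal (ker2 z w) * (ennreal ((norm (g w))\<^sup>2) * indicator {w. near (1/2) z w} w)) \<le>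
       ennreal (4 powr N) * (ennreal ((norm (g w))\<^sup>2) * ennreal (m z * ker2 w z))"
    proof (cases "near (1/2) z w")
      case True
      have "m z * (ker2 z w * (norm (g w))\<^sup>2) \<le> m z * ((4 powr N * ker2 w z) * (norm (g w))\<^sup>2)"
        using ker2_near[OF zw True] m by (intro mult_left_mono mult_right_mono) auto
      then show ?thesis using True m
        by (simp add: ennreal_mult'[symmetric] ennreal_leI mult_ac)
    qed simp
  qed
  also have "\<dots> = (\<integral>\<^sup>+w. (\<integral>\<^sup>+z. ennreal (4 powr N) * (ennreal ((norm (g w))\<^sup>2) * ennreal (m z * ker2 w z)) \<partial>M) \<partial>M)"
  proof (rule P.Fubini')
    show "(\<lambda>(w, z). ennreal (4 powr N) * (ennreal ((norm (g w))\<^sup>2) * ennreal (m z * ker2 w z))) \<in> borel_measurable (M \<Otimes>\<^sub>M M)"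
      by measurable
  qed
  also have "\<dots> = (\<integral>\<^sup>+w. ennreal (4 powr N) * (ennreal ((norm (g w))\<^sup>2) * (\<integral>\<^sup>+z. ennreal (m z * ker2 w z) \<partial>M)) \<partial>M)"
    by (intro nn_integral_cong) (simp add: nn_integral_cmult)
  also have "\<dots> \<le> (\<integral>\<^sup>+w. ennreal (4 powr N) * (ennreal ((norm (g w))\<^sup>2) * ennreal C) \<partial>M)"
    using C by (intro nn_integral_mono_AE) (auto elim!: eventually_mono intro!: mult_left_mono)
  also have "\<dots> = ennreal (4 powr N * C) * nsq g"
  proof -
    have "ennreal (4 powr N * C) = ennreal (4 powr N) * ennreal C" by (rule ennreal_mult') simp
    then show ?thesis unfolding nsq_def by (simp add: nn_integral_cmult nn_integral_multc mult_ac)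
  qed
  finally show ?thesis .
qed

section \<open>The sub-mean value property and the Carleson embedding\<close>

lemma hol_bounded_ball:
  assumes g: "hol g" and r: "r < 1"
  obtains C where "\<And>v. norm v \<le> r \<Longrightarrow> cmod (g v) \<le> C"
proof -
  have "compact (g ` cball 0 r)"
    using r by (intro compact_continuous_image continuous_on_subset[OF hol_continuous[OF g]]) auto
  then obtain C where "\<forall>x\<in>g ` cball 0 r. cmod x \<le> C" using compact_imp_bounded bounded_iff by metis
  then show ?thesis by (intro that[of C]) auto
qed

lemma hol_integrable_ball:
  assumes g: "hol g" and r: "r < 1"
  shows "integrable M (\<lambda>v. indicator (ball 0 r) v *\<^sub>R g v)"
proof -
  obtain C where C: "\<And>v. norm v \<le> r \<Longrightarrow> cmod (g v) \<le> C" using hol_bounded_ball[OF assms] by metis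
  have [measurable]: "g \<in> borel_measurable M" by (rule measurable_nu_continuous[OF hol_continuous[OF g]])
  have [measurable]: "ball 0 r \<in> sets M" using r by (intro ball_in_sets_nu) simp
  have "cmod (indicator (ball 0 r) v *\<^sub>R g v) \<le> max C 0" for v
    using C[of v] by (auto simp: indicator_def)
  then show ?thesis by (intro integrable_const_bound[of _ "max C 0"]) auto
qed

text \<open>The mean value formula is applied to the holomorphic square of \<open>g\<close>.\<close>

lemma submean:
  assumes g: "hol g" and r: "0 < r" "r < 1"
  shows "ennreal ((cmod (g 0))\<^sup>2 * measure M (ball 0 r)) \<le> (\<integral>\<^sup>+v\<in>ball 0 r. ennreal ((cmod (g v))\<^sup>2) \<partial>M)"
proof -
  have h: "hol (\<lambda>v. g v * g v)" by (rule hol_mult[OF g g])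
  note int = hol_integrable_ball[OF h r(2)]
  have "(cmod (g 0))\<^sup>2 * measure M (ball 0 r) = cmod (\<integral>v. indicator (ball 0 r) v *\<^sub>R (g v * g v) \<partial>M)"
    using r by (subst mean_value[OF h _ int]) (simp_all add: norm_mult power2_eq_square)
  also have "ennreal \<dots> \<le> (\<integral>\<^sup>+v. ennreal (cmod (indicator (ball 0 r) v *\<^sub>R (g v * g v))) \<partial>M)"
    by (rule integral_norm_bound_ennreal[OF int])
  also have "\<dots> = (\<integral>\<^sup>+v\<in>ball 0 r. ennreal ((cmod (g v))\<^sup>2) \<partial>M)"
    by (intro nn_integral_cong) (auto simp: indicator_def norm_mult power2_eq_square)
  finally show ?thesis by (simp add: ennreal_leI)
qed

lemma local_mass_ge:
  assumes g: "hol g" and z: "z \<in> B"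
  shows "ennreal ((cmod (g z))\<^sup>2 * half_mass) \<le> local_mass g z"
proof -
  interpret ball_point z by unfold_locales (use z in simp)
  show ?thesis using submean[OF hol_phi[OF g z], of "1/2"] by (simp add: local_mass_def half_mass_def)
qed

text \<open>The numerator is the cost of exchanging kernel arguments in
  \<open>local_mass_integral\<close>, the denominator the normalisation in
  \<open>local_mass_ge\<close>.\<close>

definition carleson_const :: real where "carleson_const = 4 powr N / half_mass"

lemma carleson_const_nonneg: "carleson_const \<ge> 0"
  using half_mass_pos by (simp add: carleson_const_def)

text \<open>Each |g(z)|^2 is dominated by the local mass of \<open>g\<close> at \<open>z\<close>,
  and the local masses are integrated against \<open>m\<close> by
  \<open>local_mass_integral\<close>.\<close>

lemma carleson_scalar:
  fixes m :: "complex^'n \<Rightarrow> real"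
  assumes m[measurable]: "m \<in> borel_measurable M" "\<And>z. m z \<ge> 0"
    and C: "AE w in M. (\<integral>\<^sup>+z. ennreal (m z * ker2 w z) \<partial>M) \<le> ennreal C" "C \<ge> 0"
    and g: "hol g"
  shows "(\<integral>\<^sup>+z. ennreal (m z * (cmod (g z))\<^sup>2) \<partial>M) \<le> ennreal (carleson_const * C) * nsq g"
proof -
  have gm[measurable]: "g \<in> borel_measurable M" by (rule measurable_nu_continuous[OF hol_continuous[OF g]])
  have "ennreal half_mass * (\<integral>\<^sup>+z. ennreal (m z * (cmod (g z))\<^sup>2) \<partial>M) = (\<integral>\<^sup>+z. ennreal half_mass * ennreal (m z * (cmod (g z))\<^sup>2) \<partial>M)"
    by (rule nn_integral_cmult[symmetric]) measurable
  also have "\<dots> \<le> (\<integral>\<^sup>+z. ennreal (m z) * local_mass g z \<partial>M)"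
  proof (rule nn_integral_mono)
    fix z assume "z \<in> space M"
    then have "ennreal ((cmod (g z))\<^sup>2 * half_mass) \<le> local_mass g z" using local_mass_ge[OF g] by simp
    then have "ennreal (m z) * ennreal ((cmod (g z))\<^sup>2 * half_mass) \<le> ennreal (m z) * local_mass g z"
      by (rule mult_left_mono) simp
    then show "ennreal half_mass * ennreal (m z * (cmod (g z))\<^sup>2) \<le> ennreal (m z) * local_mass g z"
      using m half_mass_pos by (simp add: ennreal_mult'[symmetric] mult_ac)
  qed
  also have "\<dots> \<le> ennreal (4 powr N * C) * nsq g"
    by (rule local_mass_integral[OF m(1) gm m(2) C(1)])
  finally have *: "ennreal half_mass * (\<integral>\<^sup>+z. ennreal (m z * (cmod (g z))\<^sup>2) \<partial>M) \<le> ennreal (4 powr N * C) * nsq g" .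
  have "(\<integral>\<^sup>+z. ennreal (m z * (cmod (g z))\<^sup>2) \<partial>M) = ennreal (1 / half_mass) * (ennreal half_mass * (\<integral>\<^sup>+z. ennreal (m z * (cmod (g z))\<^sup>2) \<partial>M))"
    using half_mass_pos by (simp add: mult.assoc[symmetric] ennreal_mult'[symmetric])
  also have "\<dots> \<le> ennreal (1 / half_mass) * (ennreal (4 powr N * C) * nsq g)"
    by (intro mult_left_mono * ) simp
  also have "\<dots> = ennreal (carleson_const * C) * nsq g"
    using half_mass_pos C(2) by (simp add: mult.assoc[symmetric] ennreal_mult'[symmetric] carleson_const_def)
  finally show ?thesis .
qed

lemma nsq_suminf:
  fixes f :: "complex^'n \<Rightarrow> ell2"
  assumes [measurable]: "f \<in> borel_measurable M"
  shows "nsq f = (\<Sum>i. nsq (\<lambda>z. ell2_nth (f z) i))"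
proof -
  have "ennreal ((norm (f z))\<^sup>2) = (\<Sum>i. ennreal ((cmod (ell2_nth (f z) i))\<^sup>2))" for z
    unfolding norm_ell2_sq by (rule suminf_ennreal2[symmetric]) (simp_all add: summable_ell2)
  then show ?thesis unfolding nsq_def by (simp add: nn_integral_suminf)
qed

text \<open>The scalar constant is the same for every coordinate, so the scalar estimates add
  up.\<close>

lemma carleson:
  fixes m :: "complex^'n \<Rightarrow> real"
  assumes m[measurable]: "m \<in> borel_measurable M" "\<And>z. m z \<ge> 0"
    and C: "AE w in M. (\<integral>\<^sup>+z. ennreal (m z * ker2 w z) \<partial>M) \<le> ennreal C" "C \<ge> 0"
    and f: "holomorphic_on_ball f"
  shows "(\<integral>\<^sup>+z. ennreal (m z * (norm (f z))\<^sup>2) \<partial>M) \<le> ennreal (carleson_const * C) * nsq f"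
proof -
  have [measurable]: "f \<in> borel_measurable M"
    by (rule measurable_nu_continuous[OF holomorphic_on_ball_continuous[OF f]])
  have "ennreal (m z * (norm (f z))\<^sup>2) = (\<Sum>i. ennreal (m z * (cmod (ell2_nth (f z) i))\<^sup>2))" for z
    unfolding norm_ell2_sq suminf_mult[OF summable_ell2, symmetric] using m
    by (intro suminf_ennreal2[symmetric]) (simp_all add: summable_ell2 summable_mult)
  then have "(\<integral>\<^sup>+z. ennreal (m z * (norm (f z))\<^sup>2) \<partial>M) = (\<Sum>i. \<integral>\<^sup>+z. ennreal (m z * (cmod (ell2_nth (f z) i))\<^sup>2) \<partial>M)"
    by (simp add: nn_integral_suminf)
  also have "\<dots> \<le> (\<Sum>i. ennreal (carleson_const * C) * nsq (\<lambda>z. ell2_nth (f z) i))"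
    by (intro suminf_le summableI carleson_scalar[OF m C hol_nth[OF f]])
  also have "\<dots> = ennreal (carleson_const * C) * nsq f"
    by (simp add: nsq_suminf ennreal_suminf_cmult)
  finally show ?thesis .
qed

text \<open>For a truncation g of P \<psi>, |g|^2 = <P \<psi>, g> = <\<psi>, P g> <= A + |P g|^2 / 2
  <= A + |g|^2 / 2, where pairings are real parts. Hence |g|^2 <= 2 A, and Fatou removes the
  truncation. In this way a bound on a form becomes a bound on an operator.\<close>

lemma dual_bound:
  assumes \<psi>: "integrable M \<psi>"
    and h: "\<And>h. h \<in> A2 \<alpha> \<Longrightarrow> (\<integral>w. inner (\<psi> w) (h w) \<partial>M) \<le> A + (\<integral>w. (norm (h w))\<^sup>2 \<partial>M) / 2"
  shows "nsq (proj \<psi>) \<le> ennreal (2 * A)"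
proof (rule nsq_liminf)
  \<comment> \<open>The hypothesis is tested on the projections of truncations of \<open>proj \<psi>\<close> itself.\<close>
  have m: "proj \<psi> \<in> borel_measurable M" by (rule measurable_proj[OF \<psi>])
  define g where "g k = trunc k (proj \<psi>)" for k
  show gm: "g k \<in> borel_measurable M" for k unfolding g_def using m by measurable
  show "(\<lambda>k. g k z) \<longlonglongrightarrow> proj \<psi> z" if "z \<in> B" for z
    unfolding g_def using that by (rule trunc_tendsto)
  show "nsq (g k) \<le> ennreal (2 * A)" for k
  proof -
    have cb: "compactly_bounded (g k)" unfolding g_def by (rule trunc_compactly_bounded[OF m])
    note gi = compactly_bounded_integrable[OF cb]
    have hA: "proj (g k) \<in> A2 \<alpha>" by (rule Hinfty_A2[OF proj_Hinfty[OF cb]])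
    have "ennreal (\<integral>w. (norm (proj (g k) w))\<^sup>2 \<partial>M) \<le> ennreal (\<integral>z. (norm (g k z))\<^sup>2 \<partial>M)"
      using proj_contraction_compact[OF cb] integrable_sq(2)[OF gm gi(2)] integrable_sq(2)[OF A2D(4,3)[OF hA]] by simp
    then have le: "(\<integral>w. (norm (proj (g k) w))\<^sup>2 \<partial>M) \<le> (\<integral>z. (norm (g k z))\<^sup>2 \<partial>M)"
      by (subst (asm) ennreal_le_iff) simp_all
    have "(\<integral>z. (norm (g k z))\<^sup>2 \<partial>M) = (\<integral>z. inner (proj \<psi> z) (g k z) \<partial>M)"
      by (intro Bochner_Integration.integral_cong) (simp_all add: g_def trunc_def power2_norm_eq_inner)
    also have "\<dots> = (\<integral>w. inner (\<psi> w) (proj (g k) w) \<partial>M)" by (rule proj_adjoint[OF \<psi> cb])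
    also have "\<dots> \<le> A + (\<integral>w. (norm (proj (g k) w))\<^sup>2 \<partial>M) / 2" by (rule h[OF hA])
    finally have "(\<integral>z. (norm (g k z))\<^sup>2 \<partial>M) \<le> 2 * A" using le by simp
    then show ?thesis by (simp add: integrable_sq(2)[OF gm gi(2)] ennreal_leI)
  qed
qed

section \<open>Bounded Toeplitz operators\<close>

text \<open>The Carleson condition tested on normalised kernels. It is imposed at almost every
  centre, matching a Berezin transform that is essentially bounded.\<close>

definition carleson_density :: "(complex^'n \<Rightarrow> real) \<Rightarrow> bool" where
  "carleson_density m \<longleftrightarrow> m \<in> borel_measurable M \<and> (\<forall>z. m z \<ge> 0) \<and>
    (\<exists>C\<ge>0. AE w in M. (\<integral>\<^sup>+z. ennreal (m z * ker2 w z) \<partial>M) \<le> ennreal C)"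

text \<open>
  The majorant \<open>m\<close> is needed because \<open>norm (b z)\<close> need not depend measurably on \<open>z\<close>.
\<close>

definition symbol :: "(complex^'n \<Rightarrow> ell2 \<Rightarrow>\<^sub>L ell2) \<Rightarrow> bool" where
  "symbol b \<longleftrightarrow> (\<exists>m. carleson_density m \<and> (\<forall>z\<in>B. norm (b z) \<le> m z)) \<and>
    (\<forall>f\<in>borel_measurable M. (\<lambda>z. blinfun_apply (b z) (f z)) \<in> borel_measurable M) \<and>
    (\<forall>z\<in>B. b z \<in> clinear_operators)"

lemma symbol_measurable_apply:
  "symbol b \<Longrightarrow> f \<in> borel_measurable M \<Longrightarrow> (\<lambda>z. blinfun_apply (b z) (f z)) \<in> borel_measurable M"
  by (simp add: symbol_def)

lemma carleson_density_bound:
  assumes m: "carleson_density m"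
  shows "integrable M (\<lambda>z. m z)"
    and "\<exists>D>0. \<forall>f\<in>A2 \<alpha>. integrable M (\<lambda>z. m z * (norm (f z))\<^sup>2) \<and>
      (\<integral>z. m z * (norm (f z))\<^sup>2 \<partial>M) \<le> D * (\<integral>z. (norm (f z))\<^sup>2 \<partial>M)"
proof -
  obtain C where C: "C \<ge> 0" "AE w in M. (\<integral>\<^sup>+z. ennreal (m z * ker2 w z) \<partial>M) \<le> ennreal C"
    using m unfolding carleson_density_def by blast
  have bm [measurable]: "m \<in> borel_measurable M" and m0: "\<And>z. m z \<ge> 0" using m unfolding carleson_density_def by blast+
  \<comment> \<open>Adding 1 makes \<open>D\<close> positive: \<open>symbol_form_bound\<close>
    divides by it.\<close>
  define D where "D = carleson_const * C + 1"
  have D: "D > 0" "carleson_const * C \<le> D" "carleson_const * C \<ge> 0"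
    using carleson_const_nonneg C by (simp_all add: D_def add_nonneg_pos)
  have car: "(\<integral>\<^sup>+z. ennreal (m z * (norm (f z))\<^sup>2) \<partial>M) \<le> ennreal (carleson_const * C) * nsq f"
    if f: "f \<in> A2 \<alpha>" for f
    by (rule carleson[OF bm m0 C(2,1) A2D(1)[OF f]])
  have fin: "(\<integral>\<^sup>+z. ennreal (m z * (norm (f z))\<^sup>2) \<partial>M) < \<infinity>" if f: "f \<in> A2 \<alpha>" for f
    by (rule order_le_less_trans[OF car[OF f]]) (use A2D(3)[OF f] in \<open>simp add: ennreal_mult_less_top\<close>)
  have int: "integrable M (\<lambda>z. m z * (norm (f z))\<^sup>2)" if f: "f \<in> A2 \<alpha>" for f
    using fin[OF f] A2D(4)[OF f] m0 by (intro integrableI_bounded) (auto simp: abs_mult)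
  have le: "(\<integral>z. m z * (norm (f z))\<^sup>2 \<partial>M) \<le> D * (\<integral>z. (norm (f z))\<^sup>2 \<partial>M)" if f: "f \<in> A2 \<alpha>" for f
  proof -
    have "ennreal (\<integral>z. m z * (norm (f z))\<^sup>2 \<partial>M) = (\<integral>\<^sup>+z. ennreal (m z * (norm (f z))\<^sup>2) \<partial>M)"
      by (rule nn_integral_eq_integral[OF int[OF f], symmetric]) (simp add: m0)
    also have "\<dots> \<le> ennreal (carleson_const * C * (\<integral>z. (norm (f z))\<^sup>2 \<partial>M))"
      using car[OF f] D(3) unfolding integrable_sq(2)[OF A2D(4,3)[OF f]] by (simp add: ennreal_mult')
    finally have "(\<integral>z. m z * (norm (f z))\<^sup>2 \<partial>M) \<le> carleson_const * C * (\<integral>z. (norm (f z))\<^sup>2 \<partial>M)"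
      by (subst (asm) ennreal_le_iff) (use D(3) in auto)
    also have "\<dots> \<le> D * (\<integral>z. (norm (f z))\<^sup>2 \<partial>M)" using D by (intro mult_right_mono) auto
    finally show ?thesis .
  qed
  have "(\<integral>\<^sup>+z. ennreal (m z * (cmod 1)\<^sup>2) \<partial>M) \<le> ennreal (carleson_const * C) * nsq (\<lambda>_. 1 :: complex)"
    by (rule carleson_scalar[OF bm m0 C(2,1)]) simp
  also have "\<dots> < \<infinity>" by (simp add: nsq_def emeasure_nu_ball)
  \<comment> \<open>The embedding has been applied to the constant function 1.\<close>
  finally show "integrable M (\<lambda>z. m z)" by (intro integrableI_bounded) (simp_all add: m0)
  show "\<exists>D>0. \<forall>f\<in>A2 \<alpha>. integrable M (\<lambda>z. m z * (norm (f z))\<^sup>2) \<and>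
      (\<integral>z. m z * (norm (f z))\<^sup>2 \<partial>M) \<le> D * (\<integral>z. (norm (f z))\<^sup>2 \<partial>M)"
    by (intro exI[of _ D] conjI ballI D(1) int le)
qed

lemma norm_apply_le: "norm (blinfun_apply A x) \<le> norm A * norm x"
  using norm_blinfun by blast

lemma symbol_apply_integrable:
  assumes b: "symbol b" and f: "f \<in> A2 \<alpha>"
  shows "integrable M (\<lambda>z. blinfun_apply (b z) (f z))"
proof -
  obtain m where m: "carleson_density m" "\<And>z. z \<in> B \<Longrightarrow> norm (b z) \<le> m z"
    using b unfolding symbol_def by blast
  have D: "integrable M (\<lambda>z. m z * (norm (f z))\<^sup>2)" "integrable M m"
    using carleson_density_bound[OF m(1)] f by blast+
  show ?thesis
  proof (rule Bochner_Integration.integrable_bound)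
    show "integrable M (\<lambda>z. m z + m z * (norm (f z))\<^sup>2)" using D by simp
    show "(\<lambda>z. blinfun_apply (b z) (f z)) \<in> borel_measurable M"
      by (rule symbol_measurable_apply[OF b A2D(4)[OF f]])
    have "norm (blinfun_apply (b z) (f z)) \<le> m z + m z * (norm (f z))\<^sup>2" if z: "z \<in> B" for z
    proof -
      have "norm (f z) \<le> 1 + (norm (f z))\<^sup>2"
        using sum_squares_bound[of 1 "norm (f z)"] norm_ge_zero[of "f z"] unfolding one_power2 mult_1_right by linarith
      then have "norm (b z) * norm (f z) \<le> m z * (1 + (norm (f z))\<^sup>2)"
        using m(2)[OF z] order_trans[OF norm_ge_zero m(2)[OF z]] by (intro mult_mono) auto
      then show ?thesis using norm_apply_le[of "b z" "f z"] by (simp add: algebra_simps)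
    qed
    then show "AE z in M. norm (blinfun_apply (b z) (f z)) \<le> norm (m z + m z * (norm (f z))\<^sup>2)"
      by (intro AE_I2) (simp add: order_trans[OF _ abs_ge_self])
  qed
qed

lemma symbol_form_bound:
  assumes b: "symbol b"
  shows "\<exists>D>0. \<forall>f\<in>A2 \<alpha>. \<forall>h\<in>A2 \<alpha>. integrable M (\<lambda>z. inner (blinfun_apply (b z) (f z)) (h z)) \<and>
      (\<integral>z. inner (blinfun_apply (b z) (f z)) (h z) \<partial>M) \<le> D * (\<integral>z. (norm (f z))\<^sup>2 \<partial>M) + (\<integral>z. (norm (h z))\<^sup>2 \<partial>M) / 2"
proof -
  obtain m where m: "carleson_density m" "\<And>z. z \<in> B \<Longrightarrow> norm (b z) \<le> m z"
    using b unfolding symbol_def by blast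
  obtain D where D: "D > 0"
    "\<And>f. f \<in> A2 \<alpha> \<Longrightarrow> integrable M (\<lambda>z. m z * (norm (f z))\<^sup>2)"
    "\<And>f. f \<in> A2 \<alpha> \<Longrightarrow> (\<integral>z. m z * (norm (f z))\<^sup>2 \<partial>M) \<le> D * (\<integral>z. (norm (f z))\<^sup>2 \<partial>M)"
    using carleson_density_bound(2)[OF m(1)] by blast
  \<comment> \<open>Young's inequality with weights D and 1/D. The Carleson estimate multiplies by
    \<open>D\<close>, so the term in \<open>h\<close> ends with coefficient exactly 1/2, as
    \<open>dual_bound\<close> requires.\<close>
  have le: "\<bar>inner (blinfun_apply (b z) x) y\<bar> \<le> D / 2 * (m z * (norm x)\<^sup>2) + 1 / (2 * D) * (m z * (norm y)\<^sup>2)" if z: "z \<in> B" for z x y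
  proof -
    have "0 \<le> (D * norm x - norm y)\<^sup>2" by simp
    then have "2 * D * (norm x * norm y) \<le> D\<^sup>2 * (norm x)\<^sup>2 + (norm y)\<^sup>2" by (simp add: power2_diff power_mult_distrib mult_ac)
    then have *: "norm x * norm y \<le> D / 2 * (norm x)\<^sup>2 + 1 / (2 * D) * (norm y)\<^sup>2"
      using D(1) by (simp add: field_simps power2_eq_square)
    have "\<bar>inner (blinfun_apply (b z) x) y\<bar> \<le> norm (blinfun_apply (b z) x) * norm y" by (rule Cauchy_Schwarz_ineq2)
    also have "\<dots> \<le> (m z * norm x) * norm y"
      using order_trans[OF norm_apply_le mult_right_mono[OF m(2)[OF z]]] by (intro mult_right_mono) auto
    also have "\<dots> \<le> m z * (D / 2 * (norm x)\<^sup>2 + 1 / (2 * D) * (norm y)\<^sup>2)"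
      using mult_left_mono[OF *, of "m z"] order_trans[OF norm_ge_zero m(2)[OF z]] by (simp add: mult.assoc)
    finally show ?thesis by (simp add: algebra_simps)
  qed
  have iR: "integrable M (\<lambda>z. D / 2 * (m z * (norm (f z))\<^sup>2) + 1 / (2 * D) * (m z * (norm (h z))\<^sup>2))"
    if "f \<in> A2 \<alpha>" "h \<in> A2 \<alpha>" for f h
    using D(2)[OF that(1)] D(2)[OF that(2)] by simp
  have int: "integrable M (\<lambda>z. inner (blinfun_apply (b z) (f z)) (h z))" if fh: "f \<in> A2 \<alpha>" "h \<in> A2 \<alpha>" for f h
  proof (rule Bochner_Integration.integrable_bound[OF iR[OF fh]])
    have [measurable]: "(\<lambda>z. blinfun_apply (b z) (f z)) \<in> borel_measurable M" "h \<in> borel_measurable M"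
      using symbol_measurable_apply[OF b] A2D(4) fh by auto
    show "(\<lambda>z. inner (blinfun_apply (b z) (f z)) (h z)) \<in> borel_measurable M" by measurable
    show "AE z in M. norm (inner (blinfun_apply (b z) (f z)) (h z)) \<le>
        norm (D / 2 * (m z * (norm (f z))\<^sup>2) + 1 / (2 * D) * (m z * (norm (h z))\<^sup>2))"
      by (intro AE_I2) (unfold real_norm_def, rule order_trans[OF le abs_ge_self], simp)
  qed
  have "(\<integral>z. inner (blinfun_apply (b z) (f z)) (h z) \<partial>M) \<le> D\<^sup>2 / 2 * (\<integral>z. (norm (f z))\<^sup>2 \<partial>M) + (\<integral>z. (norm (h z))\<^sup>2 \<partial>M) / 2"
    if fh: "f \<in> A2 \<alpha>" "h \<in> A2 \<alpha>" for f h
  proof -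
    have "(\<integral>z. inner (blinfun_apply (b z) (f z)) (h z) \<partial>M) \<le> (\<integral>z. D / 2 * (m z * (norm (f z))\<^sup>2) + 1 / (2 * D) * (m z * (norm (h z))\<^sup>2) \<partial>M)"
      by (intro integral_mono int iR fh abs_le_D1[OF le]) simp
    also have "\<dots> = D / 2 * (\<integral>z. m z * (norm (f z))\<^sup>2 \<partial>M) + 1 / (2 * D) * (\<integral>z. m z * (norm (h z))\<^sup>2 \<partial>M)"
      using D(2)[OF fh(1)] D(2)[OF fh(2)] by simp
    also have "\<dots> \<le> D / 2 * (D * (\<integral>z. (norm (f z))\<^sup>2 \<partial>M)) + 1 / (2 * D) * (D * (\<integral>z. (norm (h z))\<^sup>2 \<partial>M))"
      using D(1) by (intro add_mono mult_left_mono D(3) fh) auto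
    finally show ?thesis using D(1) by (simp add: power2_eq_square)
  qed
  moreover have "D\<^sup>2 / 2 > 0" using D(1) by simp
  ultimately show ?thesis using int by (intro exI[of _ "D\<^sup>2 / 2"] conjI ballI)
qed

lemma symbol_toeplitz_bound:
  assumes b: "symbol b"
  shows "\<exists>D\<ge>0. \<forall>f\<in>A2 \<alpha>. nsq (toeplitz_integral \<alpha> b f) \<le> ennreal D * nsq f"
proof -
  obtain D where D: "D > 0" "\<And>f h. f \<in> A2 \<alpha> \<Longrightarrow> h \<in> A2 \<alpha> \<Longrightarrow>
      (\<integral>z. inner (blinfun_apply (b z) (f z)) (h z) \<partial>M) \<le> D * (\<integral>z. (norm (f z))\<^sup>2 \<partial>M) + (\<integral>z. (norm (h z))\<^sup>2 \<partial>M) / 2"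
    using symbol_form_bound[OF b] by blast
  have "nsq (toeplitz_integral \<alpha> b f) \<le> ennreal (2 * D) * nsq f" if f: "f \<in> A2 \<alpha>" for f
  proof -
    have "nsq (toeplitz_integral \<alpha> b f) \<le> ennreal (2 * (D * (\<integral>z. (norm (f z))\<^sup>2 \<partial>M)))"
      unfolding toeplitz_integral_proj by (rule dual_bound[OF symbol_apply_integrable[OF b f] D(2)[OF f]])
    also have "\<dots> = ennreal (2 * D) * nsq f"
      using D(1) unfolding integrable_sq(2)[OF A2D(4,3)[OF f]] by (simp add: ennreal_mult'[symmetric])
    finally show ?thesis .
  qed
  moreover have "2 * D \<ge> 0" using D(1) by simp
  ultimately show ?thesis by blast
qed

lemma toeplitz_integral_A2:
  assumes b: "symbol b" and f: "f \<in> A2 \<alpha>"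
  shows "toeplitz_integral \<alpha> b f \<in> A2 \<alpha>"
  unfolding A2_iff
proof (intro conjI)
  show "holomorphic_on_ball (toeplitz_integral \<alpha> b f)"
    unfolding toeplitz_integral_proj by (rule proj_holomorphic[OF symbol_apply_integrable[OF b f]])
  show "\<forall>z. z \<notin> B \<longrightarrow> toeplitz_integral \<alpha> b f z = 0" by (simp add: toeplitz_integral_def)
  obtain D where "D \<ge> 0" "nsq (toeplitz_integral \<alpha> b f) \<le> ennreal D * nsq f"
    using symbol_toeplitz_bound[OF b] f by blast
  then show "nsq (toeplitz_integral \<alpha> b f) < \<infinity>"
    using A2D(3)[OF f] by (auto intro: order_le_less_trans simp: ennreal_mult_less_top)
qed

lemma Lp_norm_le_iff:
  assumes f: "f \<in> A2 \<alpha>" and g: "g \<in> A2 \<alpha>" and C: "C \<ge> 0"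
  shows "Lp_norm \<alpha> 2 f \<le> C * Lp_norm \<alpha> 2 g \<longleftrightarrow> nsq f \<le> ennreal (C\<^sup>2) * nsq g"
proof -
  have "nsq f \<le> ennreal (C\<^sup>2) * nsq g \<longleftrightarrow> ennreal ((Lp_norm \<alpha> 2 f)\<^sup>2) \<le> ennreal ((C * Lp_norm \<alpha> 2 g)\<^sup>2)"
    unfolding nsq_A2[OF f] nsq_A2[OF g] by (simp add: ennreal_mult'[symmetric] power_mult_distrib)
  also have "\<dots> \<longleftrightarrow> (Lp_norm \<alpha> 2 f)\<^sup>2 \<le> (C * Lp_norm \<alpha> 2 g)\<^sup>2" by (simp add: ennreal_le_iff)
  also have "\<dots> \<longleftrightarrow> Lp_norm \<alpha> 2 f \<le> C * Lp_norm \<alpha> 2 g"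
    using C Lp_norm_nonneg[of f] Lp_norm_nonneg[of g] by (simp add: abs_le_square_iff[symmetric] abs_mult)
  finally show ?thesis ..
qed

lemma clinear_scaleC: "A \<in> clinear_operators \<Longrightarrow> blinfun_apply A (c *\<^sub>C x) = c *\<^sub>C blinfun_apply A x"
  by (simp add: clinear_operators_def)

lemma toeplitz_integral_add:
  assumes b: "symbol b" and f: "f \<in> A2 \<alpha>" and g: "g \<in> A2 \<alpha>"
  shows "toeplitz_integral \<alpha> b (\<lambda>z. f z + g z) = (\<lambda>z. toeplitz_integral \<alpha> b f z + toeplitz_integral \<alpha> b g z)"
  unfolding toeplitz_integral_proj
  by (auto simp: fun_eq_iff proj_def blinfun.add_right scaleC_simps
     integrable_K_scaleC[OF symbol_apply_integrable[OF b f]] integrable_K_scaleC[OF symbol_apply_integrable[OF b g]])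

lemma toeplitz_integral_scaleC:
  assumes b: "symbol b" and f: "f \<in> A2 \<alpha>"
  shows "toeplitz_integral \<alpha> b (\<lambda>z. c *\<^sub>C f z) = (\<lambda>z. c *\<^sub>C toeplitz_integral \<alpha> b f z)"
proof
  fix z
  show "toeplitz_integral \<alpha> b (\<lambda>z. c *\<^sub>C f z) z = c *\<^sub>C toeplitz_integral \<alpha> b f z"
  proof (cases "z \<in> B")
    case True
    have "(\<integral>w. K z w *\<^sub>C blinfun_apply (b w) (c *\<^sub>C f w) \<partial>M) = (\<integral>w. c *\<^sub>C (K z w *\<^sub>C blinfun_apply (b w) (f w)) \<partial>M)"
      using b by (intro Bochner_Integration.integral_cong) (auto simp: symbol_def clinear_scaleC scaleC_simps mult.commute)
    also have "\<dots> = c *\<^sub>C (\<integral>w. K z w *\<^sub>C blinfun_apply (b w) (f w) \<partial>M)"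
      by (rule integral_bounded_linear[OF bounded_bilinear.bounded_linear_right[OF bounded_bilinear_scaleC]
          integrable_K_scaleC[OF symbol_apply_integrable[OF b f] True]])
    finally show ?thesis using True by (simp add: toeplitz_integral_proj proj_def)
  qed (simp add: toeplitz_integral_def scaleC_simps)
qed

section \<open>Bounded operators and uniqueness of the extension\<close>

lemma bounded_operators_nsq:
  fixes T :: "'n operator"
  assumes T: "T \<in> bounded_operators \<alpha>"
  shows "\<exists>C\<ge>0. \<forall>f\<in>A2 \<alpha>. nsq (T f) \<le> ennreal C * nsq f"
proof -
  obtain C where C: "\<And>f. f \<in> A2 \<alpha> \<Longrightarrow> Lp_norm \<alpha> 2 (T f) \<le> C * Lp_norm \<alpha> 2 f"
    using T unfolding bounded_operators_def by blast
  have "nsq (T f) \<le> ennreal ((max C 0)\<^sup>2) * nsq f" if f: "f \<in> A2 \<alpha>" for f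
  proof -
    have Tf: "T f \<in> A2 \<alpha>" using T f unfolding bounded_operators_def by blast
    have "Lp_norm \<alpha> 2 (T f) \<le> max C 0 * Lp_norm \<alpha> 2 f"
      using C[OF f] mult_right_mono[OF max.cobounded1 Lp_norm_nonneg[of f], of C 0] by simp
    then show ?thesis using Lp_norm_le_iff[OF Tf f, of "max C 0"] by simp
  qed
  moreover have "(max C 0)\<^sup>2 \<ge> 0" by simp
  ultimately show ?thesis by blast
qed

lemma bounded_operators_diff:
  fixes T :: "'n operator"
  assumes T: "T \<in> bounded_operators \<alpha>" and f: "f \<in> A2 \<alpha>" and g: "g \<in> A2 \<alpha>"
  shows "T (\<lambda>z. f z - g z) = (\<lambda>z. T f z - T g z)"
proof -
  have *: "(\<lambda>z. f z - g z) = (\<lambda>z. f z + (- 1) *\<^sub>C g z)" by (intro ext ell2_eqI) simp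
  have "T (\<lambda>z. f z - g z) = (\<lambda>z. T f z + (- 1) *\<^sub>C T g z)"
    using T f A2_scaleC[OF g, of "-1"] g unfolding * bounded_operators_def by simp
  then show ?thesis by (simp add: fun_eq_iff) (intro allI ell2_eqI, simp)
qed

text \<open>Density of \<open>Hinfty\<close> makes a bounded extension unique; this justifies the
  definite description in \<open>toeplitz\<close>.\<close>

lemma bounded_operators_eq:
  fixes S T :: "'n operator"
  assumes S: "S \<in> bounded_operators \<alpha>" and T: "T \<in> bounded_operators \<alpha>"
    and eq: "\<And>f. f \<in> Hinfty \<Longrightarrow> S f = T f" and f: "f \<in> A2 \<alpha>"
  shows "S f = T f"
proof -
  obtain C where C: "C \<ge> 0" "\<And>f. f \<in> A2 \<alpha> \<Longrightarrow> nsq (S f) \<le> ennreal C * nsq f"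
    using bounded_operators_nsq[OF S] by blast
  obtain C' where C': "C' \<ge> 0" "\<And>f. f \<in> A2 \<alpha> \<Longrightarrow> nsq (T f) \<le> ennreal C' * nsq f"
    using bounded_operators_nsq[OF T] by blast
  have ST: "S f \<in> A2 \<alpha>" "T f \<in> A2 \<alpha>" if "f \<in> A2 \<alpha>" for f
    using S T that unfolding bounded_operators_def by blast+
  obtain g where g: "\<And>k. g k \<in> Hinfty" "(\<lambda>k. nsq (\<lambda>z. f z - g k z)) \<longlonglongrightarrow> 0"
    using Hinfty_dense[OF f] by metis
  define A where "A = 2 * ennreal C + 2 * ennreal C'"
  have A: "A < \<infinity>" by (simp add: A_def ennreal_mult_less_top)
  have le: "nsq (\<lambda>z. S f z - T f z) \<le> A * nsq (\<lambda>z. f z - g k z)" for k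
  proof -
    have gk: "g k \<in> A2 \<alpha>" by (rule Hinfty_A2[OF g(1)])
    define d where "d = (\<lambda>z. f z - g k z)"
    have d: "d \<in> A2 \<alpha>" unfolding d_def by (rule A2_diff[OF f gk])
    have "(\<lambda>z. S f z - T f z) = (\<lambda>z. S d z + (- 1) *\<^sub>C T d z)"
      unfolding d_def bounded_operators_diff[OF S f gk] bounded_operators_diff[OF T f gk] eq[OF g(1)]
      by (intro ext ell2_eqI) simp
    then have "nsq (\<lambda>z. S f z - T f z) = nsq (\<lambda>z. S d z + (- 1) *\<^sub>C T d z)" by simp
    also have "\<dots> \<le> 2 * nsq (S d) + 2 * nsq (\<lambda>z. (- 1) *\<^sub>C T d z)"
      using A2D(4)[OF ST(1)[OF d]] A2D(4)[OF A2_scaleC[OF ST(2)[OF d]]] by (rule nsq_add_le)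
    also have "nsq (\<lambda>z. (- 1) *\<^sub>C T d z) = nsq (T d)" by (rule nsq_cong) simp
    also have "2 * nsq (S d) + 2 * nsq (T d) \<le> 2 * (ennreal C * nsq d) + 2 * (ennreal C' * nsq d)"
      by (intro add_mono mult_left_mono C C' d) simp_all
    also have "\<dots> = A * nsq d" by (simp add: A_def algebra_simps)
    finally show ?thesis by (simp add: d_def)
  qed
  have "(\<lambda>k. A * nsq (\<lambda>z. f z - g k z)) \<longlonglongrightarrow> A * 0"
    using A unfolding infinity_ennreal_def by (intro ennreal_tendsto_cmult g(2))
  then have "nsq (\<lambda>z. S f z - T f z) \<le> 0"
    using le by (intro LIMSEQ_le_const[of "\<lambda>k. A * nsq (\<lambda>z. f z - g k z)"]) auto
  then have "(\<lambda>z. S f z - T f z) = (\<lambda>_. 0)"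
    using ST f by (intro nsq_zero A2_diff) auto
  then show ?thesis by (simp add: fun_eq_iff)
qed

text \<open>For a symbol the defining integral already converges on all of \<open>A2\<close> and is
  bounded there. It is therefore itself the extension, and uniqueness identifies it with
  \<open>toeplitz\<close>.\<close>

lemma toeplitz_properties:
  assumes b: "symbol b"
  shows "toeplitz \<alpha> b \<in> bounded_operators \<alpha>"
    and "\<And>f. f \<in> A2 \<alpha> \<Longrightarrow> toeplitz \<alpha> b f = toeplitz_integral \<alpha> b f"
proof -
  define T where "T f = (if f \<in> A2 \<alpha> then toeplitz_integral \<alpha> b f else (\<lambda>_. 0))" for f
  obtain D where D: "D \<ge> 0" "\<And>f. f \<in> A2 \<alpha> \<Longrightarrow> nsq (toeplitz_integral \<alpha> b f) \<le> ennreal D * nsq f"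
    using symbol_toeplitz_bound[OF b] by blast
  have "Lp_norm \<alpha> 2 (T f) \<le> sqrt D * Lp_norm \<alpha> 2 f" if f: "f \<in> A2 \<alpha>" for f
    using D f Lp_norm_le_iff[OF toeplitz_integral_A2[OF b f] f, of "sqrt D"] by (simp add: T_def)
  then have Tb: "T \<in> bounded_operators \<alpha>"
    unfolding bounded_operators_def mem_Collect_eq
    by (intro conjI ballI allI exI[of _ "sqrt D"])
      (simp_all add: T_def toeplitz_integral_A2[OF b] A2_add A2_scaleC toeplitz_integral_add[OF b] toeplitz_integral_scaleC[OF b])
  have "toeplitz \<alpha> b = T"
    unfolding toeplitz_def
  proof (rule the_equality)
    show "T \<in> bounded_operators \<alpha> \<and> (\<forall>f\<in>Hinfty. T f = toeplitz_integral \<alpha> b f) \<and> (\<forall>f. f \<notin> A2 \<alpha> \<longrightarrow> T f = (\<lambda>_. 0))"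
      using Tb by (simp add: T_def Hinfty_A2)
    fix S assume S: "S \<in> bounded_operators \<alpha> \<and> (\<forall>f\<in>Hinfty. S f = toeplitz_integral \<alpha> b f) \<and> (\<forall>f. f \<notin> A2 \<alpha> \<longrightarrow> S f = (\<lambda>_. 0))"
    show "S = T"
    proof
      fix f
      show "S f = T f"
      proof (cases "f \<in> A2 \<alpha>")
        case True
        show ?thesis
          by (rule bounded_operators_eq[OF _ Tb _ True]) (use S in \<open>simp_all add: T_def Hinfty_A2\<close>)
      qed (use S in \<open>simp add: T_def\<close>)
    qed
  qed
  then show "toeplitz \<alpha> b \<in> bounded_operators \<alpha>" "\<And>f. f \<in> A2 \<alpha> \<Longrightarrow> toeplitz \<alpha> b f = toeplitz_integral \<alpha> b f"
    using Tb by (simp_all add: T_def)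
qed

section \<open>Strong measurability and symbols of bounded mean oscillation\<close>

lemma simple_function_compose_measurable:
  assumes s: "simple_function M s" and H: "\<And>a. (\<lambda>z. H a z) \<in> measurable M L"
  shows "(\<lambda>z. H (s z) z) \<in> measurable M L"
proof (rule measurable_compose_countable'[where I = "s ` space M"])
  show "s \<in> measurable M (count_space (s ` space M))"
    using s measurable_simple_function[OF s]
    by (auto simp: measurable_def intro!: simple_functionD)
  show "countable (s ` space M)" using s by (simp add: simple_function_def countable_finite)
qed (rule H)

text \<open>A quantity depending continuously on the value of \<open>b\<close> is an
  almost-everywhere limit of measurable functions, hence measurable because \<open>nu\<close> is
  complete.\<close>

lemma strongly_measurable_compose:
  fixes H :: "'e::banach \<Rightarrow> complex^'n \<Rightarrow> 'c::{banach, second_countable_topology}"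
  assumes b: "strongly_measurable M b" and H: "\<And>a. (\<lambda>z. H a z) \<in> borel_measurable M"
    and cont: "\<And>z a s. s \<longlonglongrightarrow> a \<Longrightarrow> (\<lambda>i. H (s i) z) \<longlonglongrightarrow> H a z"
  shows "(\<lambda>z. H (b z) z) \<in> borel_measurable M"
proof -
  obtain s where s: "\<And>i. simple_function M (s i)" "AE z in M. (\<lambda>i. s i z) \<longlonglongrightarrow> b z"
    using b unfolding strongly_measurable_def by blast
  have "(\<lambda>z. H (s i z) z) \<in> borel_measurable M" for i
    by (rule simple_function_compose_measurable[OF s(1) H])
  then have "(\<lambda>z. lim (\<lambda>i. H (s i z) z)) \<in> borel_measurable M" by (rule borel_measurable_lim_metric)
  moreover have "AE z in M. H (b z) z = lim (\<lambda>i. H (s i z) z)"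
    using s(2) by eventually_elim (simp add: limI[OF cont])
  ultimately show ?thesis by (rule measurable_AE_eq)
qed

lemma strongly_measurable_norm: "strongly_measurable M b \<Longrightarrow> (\<lambda>z. norm (b z)) \<in> borel_measurable M"
  by (rule strongly_measurable_compose[where H = "\<lambda>a z. norm a"]) (auto intro: tendsto_norm)

lemma strongly_measurable_apply:
  fixes b :: "complex^'n \<Rightarrow> ell2 \<Rightarrow>\<^sub>L ell2"
  assumes b: "strongly_measurable M b" and [measurable]: "f \<in> borel_measurable M"
  shows "(\<lambda>z. blinfun_apply (b z) (f z)) \<in> borel_measurable M"
proof (rule strongly_measurable_compose[where H = "\<lambda>a z. blinfun_apply a (f z)", OF b])
  show "(\<lambda>z. blinfun_apply a (f z)) \<in> borel_measurable M" for a
    by (rule borel_measurable_continuous_on[OF linear_continuous_on[OF blinfun.bounded_linear_right] assms(2)])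
qed (intro tendsto_intros)

text \<open>The triangle inequality bounds the integral of the norm of b o phi_z by the mean
  oscillation plus the norm of the Berezin transform at \<open>z\<close>. The change of variables
  rewrites that integral as one of \<open>norm (b w)\<close> against
  \<open>ker2 z w\<close>.\<close>

lemma symbol_BMO:
  fixes b :: "complex^'n \<Rightarrow> ell2 \<Rightarrow>\<^sub>L ell2"
  assumes cl: "\<forall>z\<in>B. b z \<in> clinear_operators" and bmo: "b \<in> BMO1 \<alpha>" and ber: "berezin \<alpha> b \<in> Linfty \<alpha>"
  shows "symbol b"
proof -
  have sm: "strongly_measurable M b" using bmo by (simp add: BMO1_def Lp_def)
  note nm = strongly_measurable_norm[OF sm]
  obtain C1 where C1: "AE z in M. norm (berezin \<alpha> b z) \<le> C1"
    using ber by (auto simp: Linfty_def)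
  obtain C2 where C2: "\<And>z. z \<in> B \<Longrightarrow> Lp_norm \<alpha> 1 (\<lambda>w. b (phi z w) - berezin \<alpha> b z) \<le> C2"
    using bmo unfolding BMO1_def bdd_above_def by blast
  have le: "(\<integral>\<^sup>+w. ennreal (norm (b w) * ker2 z w) \<partial>M) \<le> ennreal (C2 + norm (berezin \<alpha> b z))" if z: "z \<in> B" for z
  proof -
    define D where "D w = b (phi z w) - berezin \<alpha> b z" for w
    have DL: "D \<in> Lp \<alpha> 1" using bmo z unfolding BMO1_def D_def by blast
    have Dm: "(\<lambda>w. norm (D w)) \<in> borel_measurable M"
      using DL by (intro strongly_measurable_norm) (simp add: Lp_def)
    have "(\<integral>\<^sup>+w. ennreal (norm (D w)) \<partial>M) < \<infinity>"
      using DL by (simp add: Lp_def powr_one_gt_zero_iff cong: nn_integral_cong)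
    then have Di: "integrable M (\<lambda>w. norm (D w))" using Dm by (intro integrableI_bounded) simp_all
    have "(\<integral>w. norm (D w) \<partial>M) \<le> C2"
      using C2[OF z] by (simp add: Lp_norm_def D_def)
    then have D2: "(\<integral>\<^sup>+w. ennreal (norm (D w)) \<partial>M) \<le> ennreal C2"
      by (simp add: nn_integral_eq_integral[OF Di] ennreal_leI)
    have C20: "C2 \<ge> 0" by (rule order_trans[OF _ \<open>(\<integral>w. norm (D w) \<partial>M) \<le> C2\<close>]) simp
    have "(\<integral>\<^sup>+w. ennreal (norm (b w) * ker2 z w) \<partial>M) = (\<integral>\<^sup>+w. ennreal (ker2 z w) * ennreal (norm (b w)) \<partial>M)"
      by (intro nn_integral_cong) (simp add: ennreal_mult'[symmetric] mult.commute)
    also have "\<dots> = (\<integral>\<^sup>+w. ennreal (norm (b (phi z w))) \<partial>M)"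
      by (rule nn_integral_phi_nu[OF z, symmetric]) (use nm in measurable)
    also have "\<dots> \<le> (\<integral>\<^sup>+w. ennreal (norm (D w)) + ennreal (norm (berezin \<alpha> b z)) \<partial>M)"
    proof (rule nn_integral_mono)
      fix w
      have "norm (b (phi z w)) \<le> norm (D w) + norm (berezin \<alpha> b z)"
        using norm_triangle_ineq[of "D w" "berezin \<alpha> b z"] by (simp add: D_def)
      then show "ennreal (norm (b (phi z w))) \<le> ennreal (norm (D w)) + ennreal (norm (berezin \<alpha> b z))"
        by (simp add: ennreal_leI flip: ennreal_plus)
    qed
    also have "\<dots> = (\<integral>\<^sup>+w. ennreal (norm (D w)) \<partial>M) + ennreal (norm (berezin \<alpha> b z))"
      using Dm by (subst nn_integral_add) (auto simp: emeasure_nu_ball)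
    also have "\<dots> \<le> ennreal C2 + ennreal (norm (berezin \<alpha> b z))" by (intro add_right_mono D2)
    also have "\<dots> = ennreal (C2 + norm (berezin \<alpha> b z))" using C20 by simp
    finally show ?thesis .
  qed
  \<comment> \<open>The bound above is now restricted to the centres at which the Berezin transform
    obeys its essential bound \<open>C1\<close>.\<close>
  have "AE z in M. (\<integral>\<^sup>+w. ennreal (norm (b w) * ker2 z w) \<partial>M) \<le> ennreal (max 0 (C2 + C1))"
    using C1 AE_space
  proof eventually_elim
    case (elim z)
    have "(\<integral>\<^sup>+w. ennreal (norm (b w) * ker2 z w) \<partial>M) \<le> ennreal (C2 + norm (berezin \<alpha> b z))"
      using elim by (intro le) simp
    also have "\<dots> \<le> ennreal (max 0 (C2 + C1))" using elim by (intro ennreal_leI) simp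
    finally show ?case .
  qed
  then have "carleson_density (\<lambda>z. norm (b z))"
    unfolding carleson_density_def using nm by (intro conjI exI[of _ "max 0 (C2 + C1)"]) auto
  then show ?thesis
    unfolding symbol_def using cl strongly_measurable_apply[OF sm] by (intro conjI exI[of _ "\<lambda>z. norm (b z)"]) auto
qed

section \<open>Scalar symbols dominated by Carleson densities\<close>

definition scalar_symbol :: "(complex^'n \<Rightarrow> complex) \<Rightarrow> bool" where
  "scalar_symbol c \<longleftrightarrow> c \<in> borel_measurable M \<and> (\<exists>m. carleson_density m \<and> (\<forall>z\<in>B. cmod (c z) \<le> m z))"

lemma integral_ker2: "z \<in> B \<Longrightarrow> (\<integral>\<^sup>+w. ennreal (ker2 z w) \<partial>M) = 1"
  using nn_integral_phi_nu[of z "\<lambda>_. 1"] by (simp add: emeasure_nu_ball)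

lemma carleson_density_add:
  assumes "carleson_density m" "carleson_density m'"
  shows "carleson_density (\<lambda>z. m z + m' z)"
proof -
  obtain C C' where *: "C \<ge> 0" "AE w in M. (\<integral>\<^sup>+z. ennreal (m z * ker2 w z) \<partial>M) \<le> ennreal C"
    "C' \<ge> 0" "AE w in M. (\<integral>\<^sup>+z. ennreal (m' z * ker2 w z) \<partial>M) \<le> ennreal C'"
    using assms unfolding carleson_density_def by blast
  have [measurable]: "m \<in> borel_measurable M" "m' \<in> borel_measurable M" and nn: "\<And>z. m z \<ge> 0" "\<And>z. m' z \<ge> 0"
    using assms unfolding carleson_density_def by blast+
  have "AE w in M. (\<integral>\<^sup>+z. ennreal ((m z + m' z) * ker2 w z) \<partial>M) \<le> ennreal (C + C')"
    using *(2) *(4)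
  proof eventually_elim
    case (elim w)
    have "(\<integral>\<^sup>+z. ennreal ((m z + m' z) * ker2 w z) \<partial>M) = (\<integral>\<^sup>+z. ennreal (m z * ker2 w z) + ennreal (m' z * ker2 w z) \<partial>M)"
      using nn by (intro nn_integral_cong) (simp add: distrib_right ennreal_plus)
    also have "\<dots> = (\<integral>\<^sup>+z. ennreal (m z * ker2 w z) \<partial>M) + (\<integral>\<^sup>+z. ennreal (m' z * ker2 w z) \<partial>M)"
      by (rule nn_integral_add) measurable
    also have "\<dots> \<le> ennreal C + ennreal C'" using elim by (intro add_mono)
    finally show ?case using * by simp
  qed
  then show ?thesis unfolding carleson_density_def using nn * by (intro conjI exI[of _ "C + C'"]) auto
qed

text \<open>The squared normalised kernels have total mass one.\<close>

lemma carleson_density_const: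
  assumes "C \<ge> 0" shows "carleson_density (\<lambda>_. C)"
  unfolding carleson_density_def
proof (intro conjI exI[of _ C])
  show "AE w in M. (\<integral>\<^sup>+z. ennreal (C * ker2 w z) \<partial>M) \<le> ennreal C"
    using assms by (intro AE_I2) (simp add: ennreal_mult' nn_integral_cmult integral_ker2)
qed (use assms in auto)

lemma carleson_density_sum:
  "finite I \<Longrightarrow> (\<And>i. i \<in> I \<Longrightarrow> carleson_density (m i)) \<Longrightarrow> carleson_density (\<lambda>z. \<Sum>i\<in>I. m i z)"
  by (induction I rule: finite_induct) (auto intro: carleson_density_const carleson_density_add)

lemma scalar_symbol_bounded:
  assumes "c \<in> borel_measurable M" "\<And>z. z \<in> B \<Longrightarrow> cmod (c z) \<le> C"
  shows "scalar_symbol c"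
proof -
  have "C \<ge> 0" using order_trans[OF norm_ge_zero assms(2)[of 0]] by simp
  then show ?thesis unfolding scalar_symbol_def using assms carleson_density_const by blast
qed

lemma scalar_symbol_diff:
  assumes c: "scalar_symbol c" and c': "scalar_symbol c'"
  shows "scalar_symbol (\<lambda>z. c z - c' z)"
proof -
  obtain m m' where m: "carleson_density m" "\<And>z. z \<in> B \<Longrightarrow> cmod (c z) \<le> m z"
    "carleson_density m'" "\<And>z. z \<in> B \<Longrightarrow> cmod (c' z) \<le> m' z"
    using c c' unfolding scalar_symbol_def by blast
  have "cmod (c z - c' z) \<le> m z + m' z" if "z \<in> B" for z
    using norm_triangle_ineq4[of "c z" "c' z"] m(2)[OF that] m(4)[OF that] by linarith
  moreover have "(\<lambda>z. c z - c' z) \<in> borel_measurable M"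
    using c c' unfolding scalar_symbol_def by (intro borel_measurable_diff) auto
  ultimately show ?thesis
    using carleson_density_add[OF m(1,3)] unfolding scalar_symbol_def by blast
qed

end

section \<open>Symbols with finitely many entries\<close>

text \<open>The entry \<open>c j k\<close> carries \<open>e j\<close> to \<open>e k\<close>, the
  index order of \<open>Linfty_fin\<close>.\<close>

definition fin_op :: "(nat \<Rightarrow> ell2) \<Rightarrow> nat \<Rightarrow> (nat \<Rightarrow> nat \<Rightarrow> complex) \<Rightarrow> ell2 \<Rightarrow>\<^sub>L ell2" where
  "fin_op e d c = Blinfun (\<lambda>x. \<Sum>j<d. \<Sum>k<d. (c j k * ell2_cinner x (e j)) *\<^sub>C e k)"

lemma fin_op_apply: "blinfun_apply (fin_op e d c) x = (\<Sum>j<d. \<Sum>k<d. (c j k * ell2_cinner x (e j)) *\<^sub>C e k)"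
proof -
  have "bounded_linear (\<lambda>x. \<Sum>j<d. \<Sum>k<d. (c j k * ell2_cinner x (e j)) *\<^sub>C e k)"
    by (intro bounded_linear_sum bounded_linear_compose[OF bounded_bilinear.bounded_linear_left[OF bounded_bilinear_scaleC]]
      bounded_linear_compose[OF bounded_linear_mult_right] bounded_linear_cinner)
  then show ?thesis unfolding fin_op_def by (simp add: bounded_linear_Blinfun_apply)
qed

lemma scaleC_sum: "c *\<^sub>C (\<Sum>i\<in>I. f i) = (\<Sum>i\<in>I. c *\<^sub>C (f i :: ell2))"
  by (rule bounded_linear.linear[OF bounded_bilinear.bounded_linear_right[OF bounded_bilinear_scaleC], THEN linear_sum])

lemma cinner_sum_left: "ell2_cinner (\<Sum>i\<in>I. f i) y = (\<Sum>i\<in>I. ell2_cinner (f i) y)"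
  by (rule bounded_linear.linear[OF bounded_linear_cinner, THEN linear_sum])

lemma fin_op_clinear: "fin_op e d c \<in> clinear_operators"
  by (simp add: clinear_operators_def fin_op_apply scaleC_sum scaleC_simps cinner_scaleC_left mult_ac)

lemma orthonormal_norm: "orthonormal_basis e \<Longrightarrow> norm (e j) = 1"
  by (simp add: orthonormal_basis_def norm_ell2_def inner_ell2_def)

lemma norm_fin_op:
  assumes e: "orthonormal_basis e"
  shows "norm (fin_op e d c) \<le> (\<Sum>j<d. \<Sum>k<d. cmod (c j k))"
proof (rule norm_blinfun_bound)
  show "norm (blinfun_apply (fin_op e d c) x) \<le> (\<Sum>j<d. \<Sum>k<d. cmod (c j k)) * norm x" for x
    unfolding fin_op_apply sum_distrib_right
  proof (intro sum_norm_le)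
    fix j k
    have "cmod (ell2_cinner x (e j)) \<le> norm x" using norm_cinner_le[of x "e j"] orthonormal_norm[OF e] by simp
    then show "norm ((c j k * ell2_cinner x (e j)) *\<^sub>C e k) \<le> cmod (c j k) * norm x"
      using orthonormal_norm[OF e] by (simp add: norm_mult mult_left_mono)
  qed
qed (simp add: sum_nonneg)

lemma fin_op_entry:
  assumes e: "orthonormal_basis e"
  shows "ell2_cinner (blinfun_apply (fin_op e d c) (e j)) (e k) = (if j < d \<and> k < d then c j k else 0)"
proof -
  have o: "ell2_cinner (e i) (e l) = (if i = l then 1 else 0)" for i l using e by (simp add: orthonormal_basis_def)
  have "ell2_cinner (blinfun_apply (fin_op e d c) (e j)) (e k) =
      (\<Sum>i<d. \<Sum>l<d. if i = j then (if l = k then c i l else 0) else 0)"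
    unfolding fin_op_apply cinner_sum_left cinner_scaleC_left o
    by (intro sum.cong refl) simp
  also have "\<dots> = (\<Sum>i<d. if i = j then (\<Sum>l<d. if l = k then c i l else 0) else 0)"
    by (intro sum.cong refl) (rule if_split[THEN iffD2], simp)
  finally show ?thesis by (simp only: sum.delta finite_lessThan lessThan_iff) simp
qed

lemma inner_fin_op:
  "inner (blinfun_apply (fin_op e d c) x) y = Re (\<Sum>j<d. \<Sum>k<d. c j k * (ell2_cinner x (e j) * cnj (ell2_cinner y (e k))))"
proof -
  have "inner (blinfun_apply (fin_op e d c) x) y = Re (ell2_cinner (blinfun_apply (fin_op e d c) x) y)"
    by (simp add: Re_cinner)
  also have "ell2_cinner (blinfun_apply (fin_op e d c) x) y = (\<Sum>j<d. \<Sum>k<d. c j k * (ell2_cinner x (e j) * cnj (ell2_cinner y (e k))))"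
    by (simp add: fin_op_apply cinner_sum_left cinner_scaleC_left cinner_cnj mult.assoc)
  finally show ?thesis .
qed

section \<open>Coordinate projections\<close>

definition head :: "(nat \<Rightarrow> ell2) \<Rightarrow> nat \<Rightarrow> ell2 \<Rightarrow> ell2" where
  "head e d x = (\<Sum>j<d. ell2_cinner x (e j) *\<^sub>C e j)"

lemma M_head_head: "M_head e d f = (\<lambda>z. head e d (f z))"
  by (simp add: M_head_def head_def fun_eq_iff)

lemma bounded_linear_head: "bounded_linear (head e d)"
  unfolding head_def[abs_def]
  by (intro bounded_linear_sum bounded_linear_compose[OF bounded_bilinear.bounded_linear_left[OF bounded_bilinear_scaleC]]
      bounded_linear_cinner)

lemma head_scaleC: "head e d (c *\<^sub>C x) = c *\<^sub>C head e d x"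
  by (simp add: head_def scaleC_sum scaleC_simps cinner_scaleC_left)

text \<open>The truncated expansion y satisfies <y, y> = <y, x>, so Cauchy-Schwarz gives |y|^2 <=
  |y| |x|.\<close>

lemma norm_head_le:
  assumes e: "orthonormal_basis e"
  shows "norm (head e d x) \<le> norm x"
proof -
  have o: "ell2_cinner (e i) (e l) = (if i = l then 1 else 0)" for i l using e by (simp add: orthonormal_basis_def)
  define y where "y = head e d x"
  have "ell2_cinner y (e k) = (if k < d then ell2_cinner x (e k) else 0)" for k
  proof -
    have "ell2_cinner y (e k) = (\<Sum>j<d. if j = k then ell2_cinner x (e j) else 0)"
      unfolding y_def head_def cinner_sum_left cinner_scaleC_left o by (intro sum.cong) auto
    then show ?thesis by simp
  qed
  then have yk: "ell2_cinner (e k) y = cnj (ell2_cinner x (e k))" if "k < d" for k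
    using that cinner_cnj[of y "e k"] by simp
  have yv: "ell2_cinner y v = (\<Sum>k<d. ell2_cinner x (e k) * ell2_cinner (e k) v)" for v
    by (simp add: y_def head_def cinner_sum_left cinner_scaleC_left)
  have "ell2_cinner y y = (\<Sum>k<d. ell2_cinner x (e k) * cnj (ell2_cinner x (e k)))"
    unfolding yv[of y] by (intro sum.cong refl) (simp add: yk)
  also have "\<dots> = ell2_cinner y x"
    unfolding yv[of x] by (simp add: cinner_cnj)
  finally have "inner y y = inner y x" by (simp add: inner_ell2_def)
  then have "norm y * norm y \<le> norm y * norm x"
    using norm_cauchy_schwarz[of y x] by (simp flip: power2_eq_square add: power2_norm_eq_inner)
  then show ?thesis
    by (cases "norm y = 0") (auto simp: y_def)
qed

lemma M_tail_eq:
  assumes e: "orthonormal_basis e"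
  shows "M_tail e d f = (\<lambda>z. f z - head e d (f z))"
proof
  fix z
  define a where "a j = ell2_cinner (f z) (e j) *\<^sub>C e j" for j
  have "a sums f z" using e by (simp add: orthonormal_basis_def a_def[abs_def])
  then have "(\<lambda>j. a (j + d)) sums (f z - (\<Sum>j<d. a j))" by (simp add: sums_iff_shift)
  then have "(\<Sum>j. a (d + j)) = f z - (\<Sum>j<d. a j)" by (simp add: sums_iff add.commute)
  then show "M_tail e d f z = f z - head e d (f z)"
    by (simp add: M_tail_def head_def a_def)
qed

lemma head_blinfun_head:
  assumes A: "A \<in> clinear_operators"
  shows "head e d (blinfun_apply A (head e d x)) = blinfun_apply (fin_op e d (\<lambda>j k. ell2_cinner (blinfun_apply A (e j)) (e k))) x"
proof -
  have "blinfun_apply A (head e d x) = (\<Sum>j<d. ell2_cinner x (e j) *\<^sub>C blinfun_apply A (e j))"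
    using A by (simp add: head_def blinfun.sum_right clinear_operators_def)
  then have "head e d (blinfun_apply A (head e d x)) = (\<Sum>k<d. (\<Sum>j<d. ell2_cinner x (e j) * ell2_cinner (blinfun_apply A (e j)) (e k)) *\<^sub>C e k)"
    by (simp add: head_def cinner_sum_left cinner_scaleC_left)
  also have "\<dots> = (\<Sum>k<d. \<Sum>j<d. (ell2_cinner x (e j) * ell2_cinner (blinfun_apply A (e j)) (e k)) *\<^sub>C e k)"
    by (intro sum.cong refl linear_sum bounded_linear.linear bounded_bilinear.bounded_linear_left[OF bounded_bilinear_scaleC])
  also have "\<dots> = (\<Sum>j<d. \<Sum>k<d. (ell2_cinner (blinfun_apply A (e j)) (e k) * ell2_cinner x (e j)) *\<^sub>C e k)"
    by (subst sum.swap) (simp add: mult.commute)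
  finally show ?thesis by (simp add: fin_op_apply)
qed

context bergman
begin

lemma symbol_fin_op:
  assumes e: "orthonormal_basis e" and c: "\<And>j k. j < d \<Longrightarrow> k < d \<Longrightarrow> scalar_symbol (c j k)"
  shows "symbol (\<lambda>z. fin_op e d (\<lambda>j k. c j k z))"
proof -
  have "\<forall>j k. \<exists>m. j < d \<and> k < d \<longrightarrow> carleson_density m \<and> (\<forall>z\<in>B. cmod (c j k z) \<le> m z)"
    using c unfolding scalar_symbol_def by blast
  then obtain m where m: "\<And>j k. j < d \<Longrightarrow> k < d \<Longrightarrow> carleson_density (m j k)"
    "\<And>j k z. j < d \<Longrightarrow> k < d \<Longrightarrow> z \<in> B \<Longrightarrow> cmod (c j k z) \<le> m j k z" by metis
  have cm: "c j k \<in> borel_measurable M" if "j < d" "k < d" for j k using c[OF that] by (simp add: scalar_symbol_def)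
  have "carleson_density (\<lambda>z. \<Sum>j<d. \<Sum>k<d. m j k z)"
    using m(1) by (intro carleson_density_sum) auto
  moreover have "norm (fin_op e d (\<lambda>j k. c j k z)) \<le> (\<Sum>j<d. \<Sum>k<d. m j k z)" if "z \<in> B" for z
    by (rule order_trans[OF norm_fin_op[OF e]]) (use m(2) that in \<open>auto intro!: sum_mono\<close>)
  moreover have "(\<lambda>z. blinfun_apply (fin_op e d (\<lambda>j k. c j k z)) (f z)) \<in> borel_measurable M"
    if f: "f \<in> borel_measurable M" for f
    unfolding fin_op_apply
    by (intro borel_measurable_sum borel_measurable_scaleC borel_measurable_times measurable_compose[OF f measurable_cinner] cm)
      auto
  ultimately show ?thesis
    unfolding symbol_def using fin_op_clinear by blast
qed

lemma scalar_symbol_entry: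
  assumes b: "symbol b" and e: "orthonormal_basis e"
  shows "scalar_symbol (\<lambda>z. ell2_cinner (blinfun_apply (b z) (e j)) (e k))"
proof -
  obtain m where m: "carleson_density m" "\<And>z. z \<in> B \<Longrightarrow> norm (b z) \<le> m z" using b unfolding symbol_def by blast
  have "cmod (ell2_cinner (blinfun_apply (b z) (e j)) (e k)) \<le> m z" if z: "z \<in> B" for z
    using norm_cinner_le[of "blinfun_apply (b z) (e j)" "e k"] norm_apply_le[of "b z" "e j"] m(2)[OF z]
    by (simp add: orthonormal_norm[OF e])
  moreover have "(\<lambda>z. ell2_cinner (blinfun_apply (b z) (e j)) (e k)) \<in> borel_measurable M"
    by (rule measurable_compose[OF symbol_measurable_apply[OF b] measurable_cinner]) simp
  ultimately show ?thesis unfolding scalar_symbol_def using m(1) by blast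
qed

lemma M_head_A2:
  fixes f :: "complex^'n \<Rightarrow> ell2"
  shows "f \<in> A2 \<alpha> \<Longrightarrow> M_head e d f \<in> A2 \<alpha>"
  unfolding M_head_head by (rule A2_linear[OF _ bounded_linear_head]) (simp_all add: head_scaleC)

lemma M_tail_A2:
  fixes f :: "complex^'n \<Rightarrow> ell2"
  shows "orthonormal_basis e \<Longrightarrow> f \<in> A2 \<alpha> \<Longrightarrow> M_tail e d f \<in> A2 \<alpha>"
  using A2_diff[OF _ M_head_A2, of f f e d] by (simp add: M_tail_eq M_head_head)

lemma nsq_M_head: "orthonormal_basis e \<Longrightarrow> nsq (M_head e d f) \<le> nsq f"
  unfolding M_head_head by (rule nsq_mono) (rule norm_head_le)

text \<open>The map \<open>head\<close> acts on values and is bounded and complex linear, so it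
  passes through the integral and the scalar kernel. The compression is thus again a Toeplitz
  integral.\<close>

lemma toeplitz_compress:
  assumes b: "symbol b" and f: "f \<in> A2 \<alpha>"
  shows "M_head e d (toeplitz \<alpha> b (M_head e d f)) =
    toeplitz_integral \<alpha> (\<lambda>z. fin_op e d (\<lambda>j k. ell2_cinner (blinfun_apply (b z) (e j)) (e k))) f"
proof
  fix z
  note Mf = M_head_A2[OF f, of e d]
  show "M_head e d (toeplitz \<alpha> b (M_head e d f)) z =
    toeplitz_integral \<alpha> (\<lambda>z. fin_op e d (\<lambda>j k. ell2_cinner (blinfun_apply (b z) (e j)) (e k))) f z"
  proof (cases "z \<in> B")
    case True
    have "M_head e d (toeplitz \<alpha> b (M_head e d f)) z = head e d (\<integral>w. K z w *\<^sub>C blinfun_apply (b w) (M_head e d f w) \<partial>M)"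
      using True by (simp add: M_head_head toeplitz_properties(2)[OF b Mf, unfolded M_head_head] toeplitz_integral_proj proj_def)
    also have "\<dots> = (\<integral>w. head e d (K z w *\<^sub>C blinfun_apply (b w) (M_head e d f w)) \<partial>M)"
      by (rule integral_bounded_linear[OF bounded_linear_head integrable_K_scaleC[OF symbol_apply_integrable[OF b Mf] True], symmetric])
    also have "\<dots> = (\<integral>w. K z w *\<^sub>C blinfun_apply (fin_op e d (\<lambda>j k. ell2_cinner (blinfun_apply (b w) (e j)) (e k))) (f w) \<partial>M)"
      using b by (intro Bochner_Integration.integral_cong) (simp_all add: head_scaleC M_head_head head_blinfun_head symbol_def)
    finally show ?thesis using True by (simp add: toeplitz_integral_proj proj_def)
  qed (use bounded_linear.linear[OF bounded_linear_head, THEN linear_0] in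
     \<open>simp add: M_head_head toeplitz_properties(2)[OF b Mf, unfolded M_head_head] toeplitz_integral_def\<close>)
qed

section \<open>Smoothing of scalar symbols\<close>

lemma near_mono:
  assumes "near r z w" "0 \<le> r" "r \<le> r'"
  shows "near r' z w"
  using assms(1) power_mono[OF assms(3,2), of 2] unfolding near_def by linarith

text \<open>A quantitative triangle inequality for the hyperbolic distance: by
  \<open>norm_phi\<close>, 1 - |phi_v(u)|^2 is at least (15/17)^2, which exceeds 3/4.\<close>

lemma phi_quarter:
  assumes v: "norm v \<le> 1/4" and u: "norm u < 1/4"
  shows "norm (phi v u :: complex^'n) < 1/2"
proof -
  interpret ball_point v by unfold_locales (use v in simp)
  have vb: "15/16 \<le> 1 - (norm v)\<^sup>2" "15/16 \<le> 1 - (norm u)\<^sup>2"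
    using power_mono[OF v, of 2] power_mono[of "norm u" "1/4" 2] u by (auto simp: power2_eq_square)
  have "norm u * norm v \<le> 1/4 * (1/4)" using u v by (intro mult_mono) auto
  then have q: "cmod (1 - cdot u v) \<le> 17/16" using one_minus_cdot_le[of u v] by simp
  have q0: "cmod (1 - cdot u v) > 0" using one_minus_cdot_nonpos(3)[of u v] u v by simp
  have "(15/16) * (15/16) / (17/16)\<^sup>2 \<le> (1 - (norm v)\<^sup>2) * (1 - (norm u)\<^sup>2) / (cmod (1 - cdot u v))\<^sup>2"
    using vb q q0 by (intro frac_le mult_mono power_mono) (auto intro: order_trans[OF _ vb(1)])
  also have "\<dots> = 1 - (norm (phi v u))\<^sup>2" using u by (intro norm_phi[symmetric]) simp
  finally have "(norm (phi v u))\<^sup>2 < (1/2)\<^sup>2" by (simp add: power2_eq_square)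
  then show ?thesis by (rule power2_less_imp_less) simp
qed

text \<open>The numerator bounds \<open>ker2 v\<close> for |v| <= 1/4, where |1 - <w,v>| >= 1/2; the
  denominator normalises the mean over the ball of radius 1/4.\<close>

definition quarter_const :: real where "quarter_const = 4 powr N / measure M (ball 0 (1/4))"

lemma quarter_const_pos: "quarter_const > 0"
  using measure_ball_pos[of "1/4"] by (simp add: quarter_const_def)

text \<open>The sub-mean value property at \<open>v\<close> uses a hyperbolic ball of radius 1/4
  about \<open>v\<close>, which \<open>phi_quarter\<close> places inside the ball of radius
  1/2.\<close>

lemma hol_sup_quarter:
  assumes F: "hol F" and v: "norm v \<le> 1/4"
  shows "ennreal ((cmod (F v))\<^sup>2) \<le> ennreal quarter_const * (\<integral>\<^sup>+w\<in>ball 0 (1/2). ennreal ((cmod (F w))\<^sup>2) \<partial>M)"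
proof -
  have vB: "v \<in> B" using v by simp
  interpret ball_point v by unfold_locales (use v in simp)
  define h where "h w = ennreal ((cmod (F w))\<^sup>2) * indicator (ball 0 (1/2)) w" for w
  have [measurable]: "F \<in> borel_measurable M" by (rule measurable_nu_continuous[OF hol_continuous[OF F]])
  have [measurable]: "ball 0 (1/2) \<in> sets M" by (rule ball_in_sets_nu) simp
  have hm [measurable]: "h \<in> borel_measurable M" unfolding h_def by measurable
  let ?q = "measure M (ball 0 (1/4))"
  have q: "?q > 0" by (rule measure_ball_pos) simp_all
  have "ennreal ((cmod (F v))\<^sup>2 * ?q) \<le> (\<integral>\<^sup>+u\<in>ball 0 (1/4). ennreal ((cmod (F (phi v u)))\<^sup>2) \<partial>M)"
    using submean[OF hol_phi[OF F vB], of "1/4"] by simp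
  also have "\<dots> \<le> (\<integral>\<^sup>+u. h (phi v u) \<partial>M)"
    by (intro nn_integral_mono) (use phi_quarter[OF v] in \<open>auto simp: h_def indicator_def\<close>)
  also have "\<dots> = (\<integral>\<^sup>+w. ennreal (ker2 v w) * h w \<partial>M)" by (rule nn_integral_phi_nu[OF vB hm])
  also have "\<dots> \<le> (\<integral>\<^sup>+w. ennreal (4 powr N) * h w \<partial>M)"
  proof (intro nn_integral_mono mult_right_mono ennreal_leI)
    fix w assume "w \<in> space M"
    then have w: "norm w < 1" by simp
    have "norm w * norm v \<le> 1 * (1/4)" using w v by (intro mult_mono) auto
    then have "1/2 \<le> cmod (1 - cdot w v)" using one_minus_cdot_ge[of w v] by simp
    then have "(1 - (norm v)\<^sup>2) / (cmod (1 - cdot w v))\<^sup>2 \<le> 1 / (1/2)\<^sup>2"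
      by (intro frac_le power_mono) auto
    moreover have "(1 - (norm v)\<^sup>2) / (cmod (1 - cdot w v))\<^sup>2 \<ge> 0"
      using norm_a_sq by simp
    ultimately show "ker2 v w \<le> 4 powr N"
      unfolding ker2_def using N_pos by (intro powr_mono2) (auto simp: power2_eq_square)
  qed simp
  also have "\<dots> = ennreal (4 powr N) * (\<integral>\<^sup>+w. h w \<partial>M)" by (rule nn_integral_cmult) measurable
  finally have *: "ennreal ((cmod (F v))\<^sup>2 * ?q) \<le> ennreal (4 powr N) * (\<integral>\<^sup>+w. h w \<partial>M)" .
  have "ennreal ((cmod (F v))\<^sup>2) = ennreal (1 / ?q) * ennreal ((cmod (F v))\<^sup>2 * ?q)"
    using q by (simp add: ennreal_mult'[symmetric])
  also have "\<dots> \<le> ennreal (1 / ?q) * (ennreal (4 powr N) * (\<integral>\<^sup>+w. h w \<partial>M))" by (intro mult_left_mono *) simp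
  also have "\<dots> = ennreal quarter_const * (\<integral>\<^sup>+w. h w \<partial>M)"
    using q by (simp add: mult.assoc[symmetric] ennreal_mult'[symmetric] quarter_const_def)
  finally show ?thesis by (simp add: h_def)
qed

text \<open>Schwarz's lemma on the disc of multiples of \<open>u\<close>, the vector of norm 1/4 in
  the direction of \<open>v\<close>. There \<open>v\<close> has parameter 4 |v| and increments of
  \<open>F\<close> are at most 2 A; the product gives the constant 8.\<close>

lemma hol_schwarz:
  assumes F: "hol F" and A: "\<And>v. norm v \<le> 1/4 \<Longrightarrow> cmod (F v) \<le> A" and v: "norm v < 1/4"
  shows "cmod (F v - F 0) \<le> 8 * norm v * A"
proof (cases "v = 0")
  case False
  define u where "u = of_real (1 / (4 * norm v)) *s v"
  have u: "norm u = 1/4" using False by (simp add: u_def norm_scale_vec norm_divide norm_mult)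
  have A0: "A \<ge> 0" using order_trans[OF norm_ge_zero A[of 0]] by simp
  have hs: "(\<lambda>l. F (l *s u)) holomorphic_on ball 0 1"
    by (rule holomorphic_on_subset[OF hol_slice[OF F]]) (auto simp: u)
  \<comment> \<open>The slack \<eta> makes the rescaled function strictly smaller than 1, and keeps
    the divisor positive when A = 0. It is removed at the end by
    \<open>field_le_epsilon\<close>.\<close>
  have le: "cmod (F v - F 0) \<le> 4 * norm v * (2 * A + \<eta>)" if \<eta>: "\<eta> > 0" for \<eta>
  proof -
    define K0 where "K0 = 2 * A + \<eta>"
    have K0: "K0 > 0" using A0 \<eta> by (simp add: K0_def)
    define h where "h l = (F (l *s u) - F 0) / of_real K0" for l
    have hh: "h holomorphic_on ball 0 1" unfolding h_def using K0 by (intro holomorphic_intros hs) auto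
    have h1: "norm (h l) < 1" if l: "norm l < 1" for l
    proof -
      have "norm (l *s u) \<le> 1/4" using l by (simp add: norm_scale_vec u)
      then have "cmod (F (l *s u) - F 0) \<le> A + A"
        using A[of "l *s u"] A[of 0] norm_triangle_ineq4[of "F (l *s u)" "F 0"] by simp
      then have "cmod (F (l *s u) - F 0) < K0" using \<eta> by (simp add: K0_def)
      then show ?thesis using K0 by (simp add: h_def norm_divide)
    qed
    have vu: "of_real (4 * norm v) *s u = v" using False by (simp add: u_def)
    have "norm (h (of_real (4 * norm v))) \<le> norm (complex_of_real (4 * norm v))"
      by (rule Schwarz_Lemma(1)[OF hh _ h1]) (use v in \<open>simp_all add: h_def norm_mult\<close>)
    then have "cmod (F v - F 0) / K0 \<le> 4 * norm v"
      unfolding h_def vu using K0 by (simp add: norm_divide norm_mult)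
    then show ?thesis using K0 by (simp add: K0_def divide_le_eq)
  qed
  have "cmod (F v - F 0) \<le> 8 * norm v * A + x" if "x > 0" for x
  proof -
    have "4 * norm v * (2 * A + x / (4 * norm v)) = 8 * norm v * A + x" using False by (simp add: field_simps)
    then show ?thesis using le[of "x / (4 * norm v)"] that False by simp
  qed
  then show ?thesis by (rule field_le_epsilon)
qed simp

lemma hol_oscillation:
  assumes f: "hol f" and g: "hol g" and w: "w \<in> B" and v: "norm v < \<epsilon>" and \<epsilon>: "\<epsilon> \<le> 1/4"
  shows "ennreal (cmod (f w * cnj (g w) - f (phi w v) * cnj (g (phi w v)))) \<le>
    ennreal (8 * \<epsilon> * quarter_const) * (local_mass f w + local_mass g w)"
proof -
  interpret ball_point w by unfold_locales (use w in simp)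
  have e0: "\<epsilon> > 0" using v norm_ge_zero[of v] by linarith
  \<comment> \<open>\<open>A\<close> is the supremum bound of \<open>hol_sup_quarter\<close> in the
    coordinate centred at \<open>w\<close>. The local mass is finite because f o phi_w is bounded on
    the ball of radius 1/2.\<close>
  have sup: "\<exists>A\<ge>0. (\<forall>v. norm v \<le> 1/4 \<longrightarrow> cmod (f (phi w v)) \<le> A) \<and> ennreal (A\<^sup>2) = ennreal quarter_const * local_mass f w"
    if f: "hol f" for f
  proof -
    have F: "hol (\<lambda>v. f (phi w v))" by (rule hol_phi[OF f w])
    have "hol (\<lambda>v. f (phi w v) * f (phi w v))" by (rule hol_mult[OF F F])
    from hol_integrable_ball[OF this, of "1/2"]
    have "(\<integral>\<^sup>+v. ennreal (norm (indicator (ball 0 (1/2)) v *\<^sub>R (f (phi w v) * f (phi w v)))) \<partial>M) < \<infinity>"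
      unfolding integrable_iff_bounded by simp
    also have "(\<integral>\<^sup>+v. ennreal (norm (indicator (ball 0 (1/2)) v *\<^sub>R (f (phi w v) * f (phi w v)))) \<partial>M) = local_mass f w"
      unfolding local_mass_def by (intro nn_integral_cong) (simp add: norm_mult power2_eq_square indicator_def)
    finally have fin: "local_mass f w < \<infinity>" .
    define s where "s = enn2real (local_mass f w)"
    have s: "local_mass f w = ennreal s" "s \<ge> 0" using fin by (simp_all add: s_def)
    define A where "A = sqrt (quarter_const * s)"
    have A2: "A\<^sup>2 = quarter_const * s" using quarter_const_pos s by (simp add: A_def)
    have "cmod (f (phi w v)) \<le> A" if "norm v \<le> 1/4" for v
    proof -
      have "ennreal ((cmod (f (phi w v)))\<^sup>2) \<le> ennreal quarter_const * local_mass f w"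
        using hol_sup_quarter[OF F that] by (simp add: local_mass_def)
      also have "\<dots> = ennreal (A\<^sup>2)" using quarter_const_pos s by (simp add: A2 ennreal_mult')
      finally have "(cmod (f (phi w v)))\<^sup>2 \<le> A\<^sup>2" by (simp add: ennreal_le_iff)
      then show ?thesis by (rule power2_le_imp_le) (use quarter_const_pos s in \<open>simp add: A_def\<close>)
    qed
    then show ?thesis using quarter_const_pos s
      by (intro exI[of _ A]) (auto simp: A2 ennreal_mult' A_def)
  qed
  obtain A where A: "A \<ge> 0" "\<And>v. norm v \<le> 1/4 \<Longrightarrow> cmod (f (phi w v)) \<le> A" "ennreal (A\<^sup>2) = ennreal quarter_const * local_mass f w"
    using sup[OF f] by blast
  obtain A' where A': "A' \<ge> 0" "\<And>v. norm v \<le> 1/4 \<Longrightarrow> cmod (g (phi w v)) \<le> A'" "ennreal (A'\<^sup>2) = ennreal quarter_const * local_mass g w"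
    using sup[OF g] by blast
  have vq: "norm v < 1/4" using v \<epsilon> by simp
  have df: "cmod (f (phi w v) - f w) \<le> 8 * \<epsilon> * A"
    using hol_schwarz[OF hol_phi[OF f w] A(2) vq] mult_right_mono[of "8 * norm v" "8 * \<epsilon>" A] v A(1) by simp
  have dg: "cmod (g (phi w v) - g w) \<le> 8 * \<epsilon> * A'"
    using hol_schwarz[OF hol_phi[OF g w] A'(2) vq] mult_right_mono[of "8 * norm v" "8 * \<epsilon>" A'] v A'(1) by simp
  \<comment> \<open>One factor is changed at a time; each change costs 8 \<epsilon> times the
    supremum bound of that factor. The resulting 2 A A' is then split into squares.\<close>
  have "f w * cnj (g w) - f (phi w v) * cnj (g (phi w v)) = - ((f (phi w v) - f w) * cnj (g (phi w v)) + f w * cnj (g (phi w v) - g w))"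
    by (simp add: algebra_simps)
  then have "cmod (f w * cnj (g w) - f (phi w v) * cnj (g (phi w v))) \<le>
      cmod (f (phi w v) - f w) * cmod (g (phi w v)) + cmod (f w) * cmod (g (phi w v) - g w)"
    by (metis complex_mod_cnj norm_minus_cancel norm_mult norm_triangle_ineq)
  also have "\<dots> \<le> (8 * \<epsilon> * A) * A' + A * (8 * \<epsilon> * A')"
    using df dg A(1) A'(1) A(2)[of 0] A'(2)[of v] vq e0 by (intro add_mono mult_mono) auto
  also have "\<dots> = 8 * \<epsilon> * (2 * A * A')" by (simp add: algebra_simps)
  also have "\<dots> \<le> 8 * \<epsilon> * (A\<^sup>2 + A'\<^sup>2)" using e0 sum_squares_bound[of A A'] by (intro mult_left_mono) auto
  finally have "ennreal (cmod (f w * cnj (g w) - f (phi w v) * cnj (g (phi w v)))) \<le> ennreal (8 * \<epsilon> * (A\<^sup>2 + A'\<^sup>2))"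
    by (rule ennreal_leI)
  also have "\<dots> = ennreal (8 * \<epsilon>) * (ennreal (A\<^sup>2) + ennreal (A'\<^sup>2))"
    using e0 by (simp add: ennreal_mult')
  also have "\<dots> = ennreal (8 * \<epsilon> * quarter_const) * (local_mass f w + local_mass g w)"
    unfolding A(3) A'(3) using e0 quarter_const_pos by (simp add: ennreal_mult' distrib_left mult.assoc)
  finally show ?thesis .
qed

lemma abs_mult_le_sq: "cmod (x * cnj y) \<le> (cmod x)\<^sup>2 + (cmod y)\<^sup>2"
proof -
  have "cmod x * cmod y \<le> 2 * cmod x * cmod y" by simp
  also have "\<dots> \<le> (cmod x)\<^sup>2 + (cmod y)\<^sup>2" by (rule sum_squares_bound)
  finally show ?thesis by (simp add: norm_mult)
qed

lemma scalar_form_integrable: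
  assumes c: "scalar_symbol c" and f: "hol f" "nsq f < \<infinity>" and g: "hol g" "nsq g < \<infinity>"
  shows "integrable M (\<lambda>z. c z * (f z * cnj (g z)))"
proof -
  obtain m where m: "carleson_density m" "\<And>z. z \<in> B \<Longrightarrow> cmod (c z) \<le> m z" using c unfolding scalar_symbol_def by blast
  obtain C where C: "C \<ge> 0" "AE w in M. (\<integral>\<^sup>+z. ennreal (m z * ker2 w z) \<partial>M) \<le> ennreal C"
    using m(1) unfolding carleson_density_def by blast
  have mm: "m \<in> borel_measurable M" "\<And>z. m z \<ge> 0" using m(1) unfolding carleson_density_def by blast+
  have [measurable]: "c \<in> borel_measurable M" "f \<in> borel_measurable M" "g \<in> borel_measurable M"
    using c f g by (auto simp: scalar_symbol_def intro: measurable_nu_continuous hol_continuous)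
  have [measurable]: "(\<lambda>z. cnj (g z)) \<in> borel_measurable M"
    by (intro measurable_nu_continuous continuous_on_cnj hol_continuous g)
  have i: "integrable M (\<lambda>z. m z * (cmod (f z))\<^sup>2)" if f: "hol f" "nsq f < \<infinity>" for f
  proof (rule integrableI_bounded)
    have [measurable]: "f \<in> borel_measurable M" using f by (auto intro: measurable_nu_continuous hol_continuous)
    show "(\<lambda>z. m z * (cmod (f z))\<^sup>2) \<in> borel_measurable M" using mm(1) by measurable
    have "(\<integral>\<^sup>+z. ennreal (norm (m z * (cmod (f z))\<^sup>2)) \<partial>M) = (\<integral>\<^sup>+z. ennreal (m z * (cmod (f z))\<^sup>2) \<partial>M)"
      by (simp add: mm(2))
    also have "\<dots> \<le> ennreal (carleson_const * C) * nsq f" by (rule carleson_scalar[OF mm C(2,1) f(1)])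
    also have "\<dots> < \<infinity>" using f(2) by (simp add: ennreal_mult_less_top)
    finally show "(\<integral>\<^sup>+z. ennreal (norm (m z * (cmod (f z))\<^sup>2)) \<partial>M) < \<infinity>" .
  qed
  show ?thesis
  proof (rule Bochner_Integration.integrable_bound)
    show "integrable M (\<lambda>z. m z * (cmod (f z))\<^sup>2 + m z * (cmod (g z))\<^sup>2)" using i[OF f] i[OF g] by simp
    show "AE z in M. norm (c z * (f z * cnj (g z))) \<le> norm (m z * (cmod (f z))\<^sup>2 + m z * (cmod (g z))\<^sup>2)"
    proof (rule AE_I2)
      fix z assume "z \<in> space M"
      then have "cmod (c z) * cmod (f z * cnj (g z)) \<le> m z * ((cmod (f z))\<^sup>2 + (cmod (g z))\<^sup>2)"
        using m(2) mm(2) abs_mult_le_sq by (intro mult_mono) auto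
      then have "norm (c z * (f z * cnj (g z))) \<le> m z * (cmod (f z))\<^sup>2 + m z * (cmod (g z))\<^sup>2"
        by (simp only: norm_mult[of "c z"] distrib_left)
      then show "norm (c z * (f z * cnj (g z))) \<le> norm (m z * (cmod (f z))\<^sup>2 + m z * (cmod (g z))\<^sup>2)"
        unfolding real_norm_def by (rule order_trans[OF _ abs_ge_self])
    qed
  qed measurable
qed

text \<open>For fixed \<open>w\<close> this is the density of the push-forward under phi_w of the
  normalised measure on the ball of radius \<epsilon>, so it is normalised in \<open>z\<close>.
  Averaging \<open>c\<close> in the variable \<open>w\<close> then has the exact mean over
  phi_w(\<epsilon> B) as its adjoint, see \<open>avg_kernel_ball\<close>.\<close>

definition avg_kernel :: "real \<Rightarrow> complex^'n \<Rightarrow> complex^'n \<Rightarrow> real" where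
  "avg_kernel \<epsilon> z w = (if near \<epsilon> z w then ker2 w z else 0) / measure M (ball 0 \<epsilon>)"

lemma avg_kernel_nonneg: "avg_kernel \<epsilon> z w \<ge> 0"
  by (simp add: avg_kernel_def)

lemma measurable_avg_kernel [measurable]:
  "(\<lambda>(z, w). avg_kernel \<epsilon> z w) \<in> borel_measurable (M \<Otimes>\<^sub>M M)"
proof -
  have [measurable]: "(\<lambda>(z, w). cdot w z) \<in> borel_measurable (M \<Otimes>\<^sub>M M)"
    using measurable_compose[OF measurable_pair_swap' measurable_cdot_pair] by (simp add: case_prod_beta)
  have [measurable]: "(\<lambda>(z, w). ker2 w z) \<in> borel_measurable (M \<Otimes>\<^sub>M M)"
    using measurable_compose[OF measurable_pair_swap' measurable_ker2_pair] by (simp add: case_prod_beta)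
  show ?thesis unfolding avg_kernel_def near_def by measurable
qed

text \<open>Exchanging the arguments of \<open>ker2\<close> for near points makes the average of |c|
  comparable with the Carleson integral centred at \<open>z\<close>; this is why averages are
  bounded.\<close>

lemma avg_kernel_le:
  assumes z: "z \<in> B" and w: "w \<in> B" and \<epsilon>: "0 < \<epsilon>" "\<epsilon> \<le> 1/2"
  shows "avg_kernel \<epsilon> z w \<le> 4 powr N / measure M (ball 0 \<epsilon>) * ker2 z w"
proof -
  have \<mu>: "measure M (ball 0 \<epsilon>) > 0" using \<epsilon> by (intro measure_ball_pos) auto
  show ?thesis
  proof (cases "near \<epsilon> z w")
    case True
    then have "near (1/2) w z" using near_mono[of \<epsilon> w z "1/2"] \<epsilon> near_commute by auto
    then show ?thesis using ker2_near[OF w z] True \<mu> by (simp add: avg_kernel_def divide_right_mono)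
  qed (simp add: avg_kernel_def)
qed

lemma avg_kernel_ball:
  fixes p :: "complex^'n \<Rightarrow> complex"
  assumes w: "w \<in> B" and [measurable]: "p \<in> borel_measurable M" and \<epsilon>: "0 < \<epsilon>" "\<epsilon> \<le> 1"
  shows "(\<integral>z. avg_kernel \<epsilon> z w *\<^sub>R p z \<partial>M) =
    (1 / measure M (ball 0 \<epsilon>)) *\<^sub>R (\<integral>v. indicator (ball 0 \<epsilon>) v *\<^sub>R p (phi w v) \<partial>M)"
proof -
  interpret ball_point w by unfold_locales (use w in simp)
  let ?\<mu> = "measure M (ball 0 \<epsilon>)"
  define h where "h z = (if near \<epsilon> w z then p z else 0)" for z
  have hm: "h \<in> borel_measurable M"
    unfolding h_def near_def by measurable
  have "(\<integral>z. avg_kernel \<epsilon> z w *\<^sub>R p z \<partial>M) = (\<integral>z. (1 / ?\<mu>) *\<^sub>R (ker2 w z *\<^sub>R h z) \<partial>M)"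
    by (intro Bochner_Integration.integral_cong) (auto simp: avg_kernel_def h_def near_commute[of \<epsilon> w])
  also have "\<dots> = (1 / ?\<mu>) *\<^sub>R (\<integral>z. h (phi w z) \<partial>M)"
    by (simp only: integral_scaleR_right integral_phi_nu(1)[OF w hm])
  also have "(\<integral>z. h (phi w z) \<partial>M) = (\<integral>v. indicator (ball 0 \<epsilon>) v *\<^sub>R p (phi w v) \<partial>M)"
  proof (rule Bochner_Integration.integral_cong[OF refl])
    fix v assume "v \<in> space M"
    then have "near \<epsilon> w (phi w v) \<longleftrightarrow> norm v < \<epsilon>"
      using near_iff[OF w _ less_imp_le[OF \<epsilon>(1)], of "phi w v"] phi_in_ball[of v] phi_phi[of v] by simp
    then show "h (phi w v) = indicator (ball 0 \<epsilon>) v *\<^sub>R p (phi w v)" by (simp add: h_def indicator_def)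
  qed
  finally show ?thesis .
qed

lemma smoothing:
  assumes c: "scalar_symbol c" and \<epsilon>: "0 < \<epsilon>" "\<epsilon> \<le> 1/4"
    and m: "carleson_density m" "\<And>z. z \<in> B \<Longrightarrow> cmod (c z) \<le> m z"
    and C: "C \<ge> 0" "AE w in M. (\<integral>\<^sup>+z. ennreal (m z * ker2 w z) \<partial>M) \<le> ennreal C"
  obtains u U where "u \<in> borel_measurable M" "\<And>z. cmod (u z) \<le> U"
    "\<And>f g. hol f \<Longrightarrow> nsq f < \<infinity> \<Longrightarrow> hol g \<Longrightarrow> nsq g < \<infinity> \<Longrightarrow>
      ennreal (cmod (\<integral>z. (c z - u z) * (f z * cnj (g z)) \<partial>M)) \<le>
      ennreal (8 * \<epsilon> * quarter_const * (4 powr N * C)) * (nsq f + nsq g)"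
proof -
  interpret P: pair_sigma_finite M M by unfold_locales
  let ?\<mu> = "measure M (ball 0 \<epsilon>)"
  have \<mu>: "?\<mu> > 0" using \<epsilon> by (intro measure_ball_pos) auto
  have mm [measurable]: "m \<in> borel_measurable M" and m0: "\<And>z. m z \<ge> 0" using m(1) unfolding carleson_density_def by blast+
  have cm [measurable]: "c \<in> borel_measurable M" using c by (simp add: scalar_symbol_def)
  have bs [measurable]: "ball 0 \<epsilon> \<in> sets M" using \<epsilon> by (intro ball_in_sets_nu) simp
  define u0 where "u0 z = (\<integral>w. avg_kernel \<epsilon> z w *\<^sub>R c w \<partial>M)" for z
  have u0m [measurable]: "u0 \<in> borel_measurable M"
    unfolding u0_def by (rule borel_measurable_lebesgue_integral) measurable
  \<comment> \<open>The factor of \<open>avg_kernel_le\<close> times the Carleson constant.\<close>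
  define U where "U = 4 powr N / ?\<mu> * C"
  have U: "U \<ge> 0" using \<mu> C by (simp add: U_def)
  have [measurable]: "(\<lambda>w. avg_kernel \<epsilon> z w) \<in> borel_measurable M" "(\<lambda>z. avg_kernel \<epsilon> z w) \<in> borel_measurable M" for z w
    unfolding avg_kernel_def near_def by measurable
  have u0b: "AE z in M. cmod (u0 z) \<le> U"
    using C(2) AE_space
  proof eventually_elim
    case (elim z)
    then have z: "z \<in> B" by simp
    have le: "(\<integral>\<^sup>+w. ennreal (cmod (avg_kernel \<epsilon> z w *\<^sub>R c w)) \<partial>M) \<le> ennreal U"
    proof -
      have "(\<integral>\<^sup>+w. ennreal (cmod (avg_kernel \<epsilon> z w *\<^sub>R c w)) \<partial>M) \<le> (\<integral>\<^sup>+w. ennreal (4 powr N / ?\<mu>) * ennreal (m w * ker2 z w) \<partial>M)"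
      proof (rule nn_integral_mono)
        fix w assume "w \<in> space M"
        then have w: "w \<in> B" by simp
        have "avg_kernel \<epsilon> z w * cmod (c w) \<le> (4 powr N / ?\<mu> * ker2 z w) * m w"
          using avg_kernel_le[OF z w \<epsilon>(1)] \<epsilon>(2) m(2)[OF w] \<mu> by (intro mult_mono) auto
        then have "cmod (avg_kernel \<epsilon> z w *\<^sub>R c w) \<le> 4 powr N / ?\<mu> * (m w * ker2 z w)"
          using avg_kernel_nonneg by (simp add: mult_ac)
        then have "ennreal (cmod (avg_kernel \<epsilon> z w *\<^sub>R c w)) \<le> ennreal (4 powr N / ?\<mu> * (m w * ker2 z w))"
          by (rule ennreal_leI)
        also have "\<dots> = ennreal (4 powr N / ?\<mu>) * ennreal (m w * ker2 z w)" by (rule ennreal_mult') simp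
        finally show "ennreal (cmod (avg_kernel \<epsilon> z w *\<^sub>R c w)) \<le> ennreal (4 powr N / ?\<mu>) * ennreal (m w * ker2 z w)" .
      qed
      also have "\<dots> = ennreal (4 powr N / ?\<mu>) * (\<integral>\<^sup>+w. ennreal (m w * ker2 z w) \<partial>M)"
        by (rule nn_integral_cmult) measurable
      also have "\<dots> \<le> ennreal (4 powr N / ?\<mu>) * ennreal C" using elim by (intro mult_left_mono) auto
      also have "\<dots> = ennreal U" using \<mu> by (simp add: U_def ennreal_mult'[symmetric])
      finally show ?thesis .
    qed
    have "integrable M (\<lambda>w. avg_kernel \<epsilon> z w *\<^sub>R c w)"
    proof (rule integrableI_bounded)
      show "(\<lambda>w. avg_kernel \<epsilon> z w *\<^sub>R c w) \<in> borel_measurable M"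
        by (intro borel_measurable_scaleR cm) fact
      show "(\<integral>\<^sup>+w. ennreal (cmod (avg_kernel \<epsilon> z w *\<^sub>R c w)) \<partial>M) < \<infinity>"
        by (rule order_le_less_trans[OF le]) simp
    qed
    then have "ennreal (cmod (u0 z)) \<le> (\<integral>\<^sup>+w. ennreal (cmod (avg_kernel \<epsilon> z w *\<^sub>R c w)) \<partial>M)"
      unfolding u0_def by (rule integral_norm_bound_ennreal)
    also note le
    finally show ?case using U by (simp add: ennreal_le_iff)
  qed
  \<comment> \<open>The bound on \<open>u0\<close> holds only almost everywhere. Cutting off the
    exceptional set gives the pointwise bound that \<open>Linfty_fin\<close> demands and leaves all
    integrals unchanged.\<close>
  define u where "u z = (if cmod (u0 z) \<le> U then u0 z else 0)" for z
  have um [measurable]: "u \<in> borel_measurable M" unfolding u_def by measurable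
  have ub: "cmod (u z) \<le> U" for z using U by (simp add: u_def)
  have uu0: "AE z in M. u z = u0 z" using u0b by eventually_elim (simp add: u_def)
  have us: "scalar_symbol u" by (rule scalar_symbol_bounded[OF um ub])
  define Q where "Q = 8 * \<epsilon> * quarter_const"
  have Q: "Q \<ge> 0" using \<epsilon> quarter_const_pos by (simp add: Q_def)
  have "ennreal (cmod (\<integral>z. (c z - u z) * (f z * cnj (g z)) \<partial>M)) \<le> ennreal (Q * (4 powr N * C)) * (nsq f + nsq g)"
    if f: "hol f" "nsq f < \<infinity>" and g: "hol g" "nsq g < \<infinity>" for f g
  proof -
    have fm [measurable]: "f \<in> borel_measurable M" and gm [measurable]: "g \<in> borel_measurable M"
      by (auto intro: measurable_nu_continuous hol_continuous f g)
    define p where "p z = f z * cnj (g z)" for z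
    have pm [measurable]: "p \<in> borel_measurable M"
      unfolding p_def by (intro measurable_nu_continuous continuous_intros hol_continuous f g)
    \<comment> \<open>Integrating \<open>F\<close> over \<open>w\<close> gives
      \<open>u0 z * p z\<close>, over \<open>z\<close> it gives \<open>c w\<close> times the mean of
      \<open>p\<close> over phi_w(\<epsilon> B); Fubini equates the two.\<close>
    define F where "F z w = avg_kernel \<epsilon> z w *\<^sub>R (c w * p z)" for z w
    have Fm [measurable]: "(\<lambda>(z, w). F z w) \<in> borel_measurable (M \<Otimes>\<^sub>M M)" unfolding F_def by measurable
    have lm: "(\<integral>\<^sup>+w. ennreal (m w) * local_mass f w \<partial>M) \<le> ennreal (4 powr N * C) * nsq f"
      if "f \<in> borel_measurable M" for f :: "complex^'n \<Rightarrow> complex"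
      by (rule local_mass_integral[OF mm that m0 C(2)])
    have local_measurable [measurable]: "local_mass f \<in> borel_measurable M" if f: "hol f" for f
    proof -
      have [measurable]: "f \<in> borel_measurable M" using f by (auto intro: measurable_nu_continuous hol_continuous)
      have "local_mass f z = (\<integral>\<^sup>+w. ennreal (ker2 z w) * (ennreal ((cmod (f w))\<^sup>2) * indicator {w. near (1/2) z w} w) \<partial>M)" if "z \<in> B" for z
        unfolding local_mass_def using that by (intro nn_integral_local) auto
      moreover have "(\<lambda>z. \<integral>\<^sup>+w. ennreal (ker2 z w) * (ennreal ((cmod (f w))\<^sup>2) * indicator {w. near (1/2) z w} w) \<partial>M) \<in> borel_measurable M"
        by (rule borel_measurable_nn_integral) measurable
      ultimately show ?thesis by (subst measurable_cong) auto
    qed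
    \<comment> \<open>Points near at scale \<epsilon> are near at scale 1/2, so for fixed
      \<open>w\<close> the integral of |F| is at most \<open>m w\<close> times the local masses of
      \<open>f\<close> and \<open>g\<close>, divided by the mass of the \<epsilon>-ball.\<close>
    have iF: "integrable (M \<Otimes>\<^sub>M M) (\<lambda>(z, w). F z w)"
    proof (rule integrableI_bounded[OF Fm])
      have "(\<integral>\<^sup>+x. ennreal (norm (case x of (z, w) \<Rightarrow> F z w)) \<partial>(M \<Otimes>\<^sub>M M)) = (\<integral>\<^sup>+w. (\<integral>\<^sup>+z. ennreal (cmod (F z w)) \<partial>M) \<partial>M)"
        by (subst P.nn_integral_snd[symmetric]) (use Fm in \<open>auto simp: case_prod_beta\<close>)
      also have "\<dots> \<le> (\<integral>\<^sup>+w. ennreal (1 / ?\<mu>) * (ennreal (m w) * local_mass f w + ennreal (m w) * local_mass g w) \<partial>M)"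
      proof (rule nn_integral_mono)
        fix w assume "w \<in> space M"
        then have w: "w \<in> B" by simp
        have [measurable]: "(\<lambda>z. indicator {z. near (1/2) w z} z :: ennreal) \<in> borel_measurable M"
          using measurable_compose[OF measurable_Pair1'[of w M M] near_measurable] w by simp
        have "(\<integral>\<^sup>+z. ennreal (cmod (F z w)) \<partial>M) \<le> (\<integral>\<^sup>+z. ennreal (m w / ?\<mu>) *
            (ennreal (ker2 w z) * (ennreal ((cmod (f z))\<^sup>2) * indicator {z. near (1/2) w z} z) +
             ennreal (ker2 w z) * (ennreal ((cmod (g z))\<^sup>2) * indicator {z. near (1/2) w z} z)) \<partial>M)"
        proof (rule nn_integral_mono)
          fix z
          show "ennreal (cmod (F z w)) \<le> ennreal (m w / ?\<mu>) *
            (ennreal (ker2 w z) * (ennreal ((cmod (f z))\<^sup>2) * indicator {z. near (1/2) w z} z) +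
             ennreal (ker2 w z) * (ennreal ((cmod (g z))\<^sup>2) * indicator {z. near (1/2) w z} z))"
          proof (cases "near \<epsilon> z w")
            case True
            then have n: "near (1/2) w z" using near_mono[of \<epsilon> w z "1/2"] \<epsilon> near_commute by auto
            have "cmod (F z w) = ker2 w z / ?\<mu> * (cmod (c w) * cmod (p z))"
              using True \<mu> by (simp add: F_def avg_kernel_def norm_mult)
            also have "\<dots> \<le> ker2 w z / ?\<mu> * (m w * ((cmod (f z))\<^sup>2 + (cmod (g z))\<^sup>2))"
              unfolding p_def using m(2)[OF w] m0 \<mu> abs_mult_le_sq by (intro mult_left_mono mult_mono) auto
            also have "\<dots> = m w / ?\<mu> * (ker2 w z * (cmod (f z))\<^sup>2 + ker2 w z * (cmod (g z))\<^sup>2)"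
              using \<mu> by (simp add: field_simps)
            finally have "ennreal (cmod (F z w)) \<le> ennreal (m w / ?\<mu> * (ker2 w z * (cmod (f z))\<^sup>2 + ker2 w z * (cmod (g z))\<^sup>2))"
              by (rule ennreal_leI)
            also have "\<dots> = ennreal (m w / ?\<mu>) * ennreal (ker2 w z * (cmod (f z))\<^sup>2 + ker2 w z * (cmod (g z))\<^sup>2)"
              using m0[of w] \<mu> by (intro ennreal_mult') simp
            finally show ?thesis using n by (simp add: ennreal_mult')
          qed (simp add: F_def avg_kernel_def)
        qed
        also have "\<dots> = ennreal (m w / ?\<mu>) * (local_mass f w + local_mass g w)"
          unfolding local_mass_def using w
          by (subst (1 2) nn_integral_local) (auto simp: nn_integral_cmult nn_integral_add)
        also have "\<dots> = ennreal (1 / ?\<mu>) * (ennreal (m w) * local_mass f w + ennreal (m w) * local_mass g w)"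
        proof -
          have "ennreal (m w / ?\<mu>) = ennreal (1 / ?\<mu>) * ennreal (m w)" using m0 \<mu> by (simp add: ennreal_mult'[symmetric])
          then show ?thesis by (simp add: distrib_left mult.assoc)
        qed
        finally show "(\<integral>\<^sup>+z. ennreal (cmod (F z w)) \<partial>M) \<le> ennreal (1 / ?\<mu>) * (ennreal (m w) * local_mass f w + ennreal (m w) * local_mass g w)" .
      qed
      also have "\<dots> = ennreal (1 / ?\<mu>) * ((\<integral>\<^sup>+w. ennreal (m w) * local_mass f w \<partial>M) + (\<integral>\<^sup>+w. ennreal (m w) * local_mass g w \<partial>M))"
        using local_measurable[OF f(1)] local_measurable[OF g(1)] by (simp add: nn_integral_cmult nn_integral_add)
      also have "\<dots> \<le> ennreal (1 / ?\<mu>) * (ennreal (4 powr N * C) * nsq f + ennreal (4 powr N * C) * nsq g)"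
        by (intro mult_left_mono add_mono lm) simp_all
      also have "\<dots> < \<infinity>" using f g by (simp add: ennreal_mult_less_top)
      finally show "(\<integral>\<^sup>+x. ennreal (norm (case x of (z, w) \<Rightarrow> F z w)) \<partial>(M \<Otimes>\<^sub>M M)) < \<infinity>" .
    qed
    define avg where "avg w = (1 / ?\<mu>) *\<^sub>R (\<integral>v. indicator (ball 0 \<epsilon>) v *\<^sub>R p (phi w v) \<partial>M)" for w
    have Fz: "(\<integral>z. F z w \<partial>M) = c w * avg w" if w: "w \<in> B" for w
    proof -
      have "(\<integral>z. F z w \<partial>M) = (\<integral>z. c w * (avg_kernel \<epsilon> z w *\<^sub>R p z) \<partial>M)"
        by (intro Bochner_Integration.integral_cong) (simp_all add: F_def)
      also have "\<dots> = c w * (\<integral>z. avg_kernel \<epsilon> z w *\<^sub>R p z \<partial>M)" by (rule integral_mult_right_zero)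
      also have "\<dots> = c w * avg w" unfolding avg_def using \<epsilon> by (subst avg_kernel_ball[OF w pm]) auto
      finally show ?thesis .
    qed
    have Fw: "(\<integral>w. F z w \<partial>M) = u0 z * p z" for z
    proof -
      have "(\<integral>w. F z w \<partial>M) = (\<integral>w. (avg_kernel \<epsilon> z w *\<^sub>R c w) * p z \<partial>M)"
        by (intro Bochner_Integration.integral_cong) (simp_all add: F_def)
      then show ?thesis by (simp only: integral_mult_left_zero u0_def)
    qed
    have i1: "integrable M (\<lambda>z. c z * p z)" unfolding p_def by (rule scalar_form_integrable[OF c f g])
    have i2: "integrable M (\<lambda>z. u z * p z)" unfolding p_def by (rule scalar_form_integrable[OF us f g])
    have "integrable M (\<lambda>w. \<integral>z. F z w \<partial>M)" using P.integrable_snd[OF iF] .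
    then have i3: "integrable M (\<lambda>w. c w * avg w)"
      by (subst (asm) Bochner_Integration.integrable_cong[OF refl Fz]) simp_all
    have "(\<integral>z. u z * p z \<partial>M) = (\<integral>z. u0 z * p z \<partial>M)"
      using uu0 by (intro integral_cong_AE) (measurable, auto elim!: eventually_mono)
    also have "\<dots> = (\<integral>z. (\<integral>w. F z w \<partial>M) \<partial>M)" by (simp add: Fw)
    also have "\<dots> = (\<integral>w. (\<integral>z. F z w \<partial>M) \<partial>M)" by (rule P.Fubini_integral[OF iF, symmetric])
    also have "\<dots> = (\<integral>w. c w * avg w \<partial>M)" by (intro Bochner_Integration.integral_cong) (simp_all add: Fz)
    \<comment> \<open>The factor \<open>c w\<close> is common to both terms; all the smallness must
      now come from the oscillation of \<open>p\<close>.\<close>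
    finally have "(\<integral>z. (c z - u z) * p z \<partial>M) = (\<integral>w. c w * p w - c w * avg w \<partial>M)"
      using i1 i2 i3 by (simp add: left_diff_distrib)
    also have "ennreal (cmod \<dots>) \<le> (\<integral>\<^sup>+w. ennreal (cmod (c w * p w - c w * avg w)) \<partial>M)"
      using i1 i3 by (intro integral_norm_bound_ennreal) simp
    also have "\<dots> \<le> (\<integral>\<^sup>+w. ennreal Q * (ennreal (m w) * local_mass f w + ennreal (m w) * local_mass g w) \<partial>M)"
    proof (rule nn_integral_mono)
      fix w assume "w \<in> space M"
      then have w: "w \<in> B" by simp
      have hf: "hol (\<lambda>v. f (phi w v))" "hol (\<lambda>v. g (phi w v))" by (rule hol_phi[OF f(1) w], rule hol_phi[OF g(1) w])
      define S where "S = local_mass f w + local_mass g w"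
      have osc: "ennreal (cmod (p w - p (phi w v))) \<le> ennreal Q * S" if "norm v < \<epsilon>" for v
        unfolding p_def S_def Q_def by (rule hol_oscillation[OF f(1) g(1) w that \<epsilon>(2)])
      have ip: "integrable M (\<lambda>v. indicator (ball 0 \<epsilon>) v *\<^sub>R p (phi w v))"
      proof -
        obtain A where A: "\<And>v. norm v \<le> \<epsilon> \<Longrightarrow> cmod (f (phi w v)) \<le> A" using hol_bounded_ball[OF hf(1), of \<epsilon>] \<epsilon> by auto
        obtain A' where A': "\<And>v. norm v \<le> \<epsilon> \<Longrightarrow> cmod (g (phi w v)) \<le> A'" using hol_bounded_ball[OF hf(2), of \<epsilon>] \<epsilon> by auto
        have [measurable]: "(\<lambda>v. p (phi w v)) \<in> borel_measurable M" by (rule measurable_compose[OF measurable_phi_nu[OF w] pm])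
        have A0: "A \<ge> 0" using order_trans[OF norm_ge_zero A[of 0]] \<epsilon> by simp
        have A'0: "A' \<ge> 0" using order_trans[OF norm_ge_zero A'[of 0]] \<epsilon> by simp
        have "cmod (p (phi w v)) \<le> A * A'" if "norm v \<le> \<epsilon>" for v
          unfolding p_def norm_mult complex_mod_cnj using A[OF that] A'[OF that] A0 by (intro mult_mono) auto
        then show ?thesis using A0 A'0 by (intro integrable_const_bound[of _ "A * A'"]) (auto simp: indicator_def)
      qed
      \<comment> \<open>Writing \<open>p w\<close> as its own mean over the ball turns the
        difference into a mean of increments, each bounded by \<open>osc\<close>.\<close>
      have "p w - avg w = (1 / ?\<mu>) *\<^sub>R (\<integral>v. indicator (ball 0 \<epsilon>) v *\<^sub>R (p w - p (phi w v)) \<partial>M)"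
      proof -
        have b: "ball 0 \<epsilon> \<inter> B = ball 0 \<epsilon>" using \<epsilon> by auto
        have i: "integrable M (\<lambda>v. indicator (ball 0 \<epsilon>) v *\<^sub>R p w)"
          by (intro integrable_const_bound[of _ "cmod (p w)"]) (auto simp: indicator_def)
        have "(\<integral>v. indicator (ball 0 \<epsilon>) v *\<^sub>R p w \<partial>M) = ?\<mu> *\<^sub>R p w" using b by (simp add: emeasure_eq_measure)
        then have "(\<integral>v. indicator (ball 0 \<epsilon>) v *\<^sub>R (p w - p (phi w v)) \<partial>M) = ?\<mu> *\<^sub>R p w - (\<integral>v. indicator (ball 0 \<epsilon>) v *\<^sub>R p (phi w v) \<partial>M)"
          using i ip by (simp add: scaleR_diff_right)
        then show ?thesis using \<mu> by (simp add: avg_def scaleR_diff_right)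
      qed
      then have "ennreal (cmod (p w - avg w)) = ennreal (1 / ?\<mu>) * ennreal (cmod (\<integral>v. indicator (ball 0 \<epsilon>) v *\<^sub>R (p w - p (phi w v)) \<partial>M))"
        using \<mu> by (simp add: ennreal_mult'[symmetric])
      also have "\<dots> \<le> ennreal (1 / ?\<mu>) * (\<integral>\<^sup>+v. ennreal (cmod (indicator (ball 0 \<epsilon>) v *\<^sub>R (p w - p (phi w v)))) \<partial>M)"
      proof (intro mult_left_mono integral_norm_bound_ennreal)
        have "integrable M (\<lambda>v. indicator (ball 0 \<epsilon>) v *\<^sub>R p w)"
          by (intro integrable_const_bound[of _ "cmod (p w)"]) (auto simp: indicator_def)
        then show "integrable M (\<lambda>v. indicator (ball 0 \<epsilon>) v *\<^sub>R (p w - p (phi w v)))"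
          using ip by (simp add: scaleR_diff_right)
      qed simp
      also have "\<dots> \<le> ennreal (1 / ?\<mu>) * (\<integral>\<^sup>+v. (ennreal Q * S) * indicator (ball 0 \<epsilon>) v \<partial>M)"
        by (intro mult_left_mono nn_integral_mono) (use osc in \<open>auto simp: indicator_def\<close>)
      also have "\<dots> = ennreal (1 / ?\<mu>) * ((ennreal Q * S) * ennreal ?\<mu>)"
        by (simp add: nn_integral_cmult_indicator emeasure_eq_measure)
      also have "\<dots> = ennreal Q * S * (ennreal (1 / ?\<mu>) * ennreal ?\<mu>)" by (simp add: mult_ac)
      also have "ennreal (1 / ?\<mu>) * ennreal ?\<mu> = 1" using \<mu> by (simp add: ennreal_mult'[symmetric])
      finally have pa: "ennreal (cmod (p w - avg w)) \<le> ennreal Q * S" by simp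
      have "ennreal (cmod (c w * p w - c w * avg w)) = ennreal (cmod (c w)) * ennreal (cmod (p w - avg w))"
        by (simp add: right_diff_distrib[symmetric] norm_mult ennreal_mult'[symmetric] del: right_diff_distrib)
      also have "\<dots> \<le> ennreal (m w) * (ennreal Q * S)" by (intro mult_mono pa ennreal_leI m(2)[OF w]) auto
      also have "\<dots> = ennreal Q * (ennreal (m w) * local_mass f w + ennreal (m w) * local_mass g w)"
        by (simp add: S_def distrib_left mult_ac)
      finally show "ennreal (cmod (c w * p w - c w * avg w)) \<le> ennreal Q * (ennreal (m w) * local_mass f w + ennreal (m w) * local_mass g w)" .
    qed
    also have "\<dots> = ennreal Q * ((\<integral>\<^sup>+w. ennreal (m w) * local_mass f w \<partial>M) + (\<integral>\<^sup>+w. ennreal (m w) * local_mass g w \<partial>M))"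
      using local_measurable[OF f(1)] local_measurable[OF g(1)] by (simp add: nn_integral_cmult nn_integral_add)
    also have "\<dots> \<le> ennreal Q * (ennreal (4 powr N * C) * nsq f + ennreal (4 powr N * C) * nsq g)"
      by (intro mult_left_mono add_mono lm) simp_all
    also have "\<dots> = ennreal (Q * (4 powr N * C)) * (nsq f + nsq g)"
      using Q by (simp add: ennreal_mult'[of Q] distrib_left mult.assoc)
    finally show ?thesis unfolding p_def .
  qed
  then show ?thesis using um ub unfolding Q_def by (intro that[of u U]) auto
qed

section \<open>Norm approximation\<close>

text \<open>Closeness of the associated sesquilinear forms, with a sum of squared norms on the right
  because \<open>dual_bound\<close> works with such sums.\<close>

definition weakly_close :: "real \<Rightarrow> (complex^'n \<Rightarrow> complex) \<Rightarrow> (complex^'n \<Rightarrow> complex) \<Rightarrow> bool" where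
  "weakly_close \<delta> c u \<longleftrightarrow> (\<forall>f g. hol f \<longrightarrow> nsq f < \<infinity> \<longrightarrow> hol g \<longrightarrow> nsq g < \<infinity> \<longrightarrow>
      ennreal (cmod (\<integral>z. (c z - u z) * (f z * cnj (g z)) \<partial>M)) \<le> ennreal \<delta> * (nsq f + nsq g))"

lemma scalar_approx:
  assumes c: "scalar_symbol c" and \<delta>: "\<delta> > 0"
  shows "\<exists>u U. u \<in> borel_measurable M \<and> (\<forall>z. cmod (u z) \<le> U) \<and> weakly_close \<delta> c u"
proof -
  obtain m where m: "carleson_density m" "\<And>z. z \<in> B \<Longrightarrow> cmod (c z) \<le> m z" using c unfolding scalar_symbol_def by blast
  obtain C where C: "C \<ge> 0" "AE w in M. (\<integral>\<^sup>+z. ennreal (m z * ker2 w z) \<partial>M) \<le> ennreal C"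
    using m(1) unfolding carleson_density_def by blast
  \<comment> \<open>The factor multiplying \<epsilon> in the bound of \<open>smoothing\<close>,
    increased by 1 to make it a valid divisor.\<close>
  define R where "R = 8 * quarter_const * (4 powr N * C) + 1"
  have R: "R > 0" using quarter_const_pos C(1) by (simp add: R_def add_nonneg_pos)
  define \<epsilon> where "\<epsilon> = min (1/4) (\<delta> / R)"
  have \<epsilon>: "0 < \<epsilon>" "\<epsilon> \<le> 1/4" unfolding \<epsilon>_def using \<delta> R by (simp_all only: min.cobounded1) simp
  have "8 * \<epsilon> * quarter_const * (4 powr N * C) \<le> \<epsilon> * R" using \<epsilon> by (simp add: R_def algebra_simps)
  also have "\<dots> \<le> \<delta> / R * R" using R by (intro mult_right_mono) (auto simp: \<epsilon>_def)
  finally have le: "ennreal (8 * \<epsilon> * quarter_const * (4 powr N * C)) \<le> ennreal \<delta>" using R by (intro ennreal_leI) simp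
  show ?thesis
  proof (rule smoothing[OF c \<epsilon> m C])
    fix u U assume u: "u \<in> borel_measurable M" "\<And>z. cmod (u z) \<le> U"
      "\<And>f g. hol f \<Longrightarrow> nsq f < \<infinity> \<Longrightarrow> hol g \<Longrightarrow> nsq g < \<infinity> \<Longrightarrow>
      ennreal (cmod (\<integral>z. (c z - u z) * (f z * cnj (g z)) \<partial>M)) \<le>
      ennreal (8 * \<epsilon> * quarter_const * (4 powr N * C)) * (nsq f + nsq g)"
    show ?thesis
      unfolding weakly_close_def
      by (intro exI[of _ u] exI[of _ U] conjI allI impI u(1) u(2) order_trans[OF u(3) mult_right_mono[OF le]]) simp_all
  qed
qed

text \<open>The form is a sum of d^2 scalar forms in the coordinates of \<open>f\<close> and
  \<open>h\<close>, and no coordinate function exceeds the whole function in norm.\<close>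

lemma form_bound:
  assumes e: "orthonormal_basis e" and c: "\<And>j k. j < d \<Longrightarrow> k < d \<Longrightarrow> scalar_symbol (c j k)" and \<delta>: "\<delta> \<ge> 0"
    and small: "\<And>j k f g. j < d \<Longrightarrow> k < d \<Longrightarrow> hol f \<Longrightarrow> nsq f < \<infinity> \<Longrightarrow> hol g \<Longrightarrow> nsq g < \<infinity> \<Longrightarrow>
      ennreal (cmod (\<integral>z. c j k z * (f z * cnj (g z)) \<partial>M)) \<le> ennreal \<delta> * (nsq f + nsq g)"
    and f: "f \<in> A2 \<alpha>" and h: "h \<in> A2 \<alpha>"
  shows "(\<integral>z. inner (blinfun_apply (fin_op e d (\<lambda>j k. c j k z)) (f z)) (h z) \<partial>M) \<le>
    (real d)\<^sup>2 * \<delta> * ((\<integral>z. (norm (f z))\<^sup>2 \<partial>M) + (\<integral>z. (norm (h z))\<^sup>2 \<partial>M))"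
proof -
  define fj where "fj g j z = ell2_cinner (g z) (e j)" for g :: "complex^'n \<Rightarrow> ell2" and j z
  have fj: "hol (fj g j)" "nsq (fj g j) \<le> nsq g" "nsq (fj g j) < \<infinity>" if g: "g \<in> A2 \<alpha>" for g j
  proof -
    show "hol (fj g j)" unfolding fj_def[abs_def] by (rule hol_cinner[OF A2D(1)[OF g]])
    show "nsq (fj g j) \<le> nsq g"
      by (rule nsq_mono) (use norm_cinner_le[of _ "e j"] orthonormal_norm[OF e] in \<open>simp add: fj_def\<close>)
    then show "nsq (fj g j) < \<infinity>" using A2D(3)[OF g] by order
  qed
  define X where "X = (\<integral>z. (norm (f z))\<^sup>2 \<partial>M) + (\<integral>z. (norm (h z))\<^sup>2 \<partial>M)"
  have X: "X \<ge> 0" "nsq f + nsq h = ennreal X"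
    unfolding X_def by (simp_all add: integrable_sq(2)[OF A2D(4,3)[OF f]] integrable_sq(2)[OF A2D(4,3)[OF h]])
  have int: "integrable M (\<lambda>z. c j k z * (fj f j z * cnj (fj h k z)))" if "j < d" "k < d" for j k
    by (rule scalar_form_integrable[OF c[OF that] fj(1,3)[OF f] fj(1,3)[OF h]])
  have le: "cmod (\<integral>z. c j k z * (fj f j z * cnj (fj h k z)) \<partial>M) \<le> \<delta> * X" if "j < d" "k < d" for j k
  proof -
    have "ennreal (cmod (\<integral>z. c j k z * (fj f j z * cnj (fj h k z)) \<partial>M)) \<le> ennreal \<delta> * (nsq (fj f j) + nsq (fj h k))"
      by (rule small[OF that fj(1,3)[OF f] fj(1,3)[OF h]])
    also have "\<dots> \<le> ennreal \<delta> * (nsq f + nsq h)" by (intro mult_left_mono add_mono fj f h) simp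
    also have "\<dots> = ennreal (\<delta> * X)" using \<delta> by (simp add: X(2) ennreal_mult')
    finally show ?thesis using \<delta> X(1) by (simp add: ennreal_le_iff)
  qed
  have "(\<integral>z. inner (blinfun_apply (fin_op e d (\<lambda>j k. c j k z)) (f z)) (h z) \<partial>M) =
      (\<integral>z. Re (\<Sum>j<d. \<Sum>k<d. c j k z * (fj f j z * cnj (fj h k z))) \<partial>M)"
    by (simp add: inner_fin_op fj_def)
  also have "\<dots> = Re (\<integral>z. (\<Sum>j<d. \<Sum>k<d. c j k z * (fj f j z * cnj (fj h k z))) \<partial>M)"
    by (rule integral_Re) (intro Bochner_Integration.integrable_sum int, auto)
  also have "(\<integral>z. (\<Sum>j<d. \<Sum>k<d. c j k z * (fj f j z * cnj (fj h k z))) \<partial>M) =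
      (\<Sum>j<d. \<Sum>k<d. \<integral>z. c j k z * (fj f j z * cnj (fj h k z)) \<partial>M)"
  proof -
    have "(\<integral>z. (\<Sum>j<d. \<Sum>k<d. c j k z * (fj f j z * cnj (fj h k z))) \<partial>M) =
      (\<Sum>j<d. \<integral>z. (\<Sum>k<d. c j k z * (fj f j z * cnj (fj h k z))) \<partial>M)"
      by (rule Bochner_Integration.integral_sum) (intro Bochner_Integration.integrable_sum int, auto)
    also have "\<dots> = (\<Sum>j<d. \<Sum>k<d. \<integral>z. c j k z * (fj f j z * cnj (fj h k z)) \<partial>M)"
      by (intro sum.cong refl Bochner_Integration.integral_sum int) auto
    finally show ?thesis .
  qed
  also have "Re \<dots> \<le> cmod (\<Sum>j<d. \<Sum>k<d. \<integral>z. c j k z * (fj f j z * cnj (fj h k z)) \<partial>M)" by (rule complex_Re_le_cmod)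
  also have "\<dots> \<le> (\<Sum>j<d. \<Sum>k<d. \<delta> * X)" by (intro sum_norm_le le) auto
  also have "\<dots> = (real d)\<^sup>2 * \<delta> * X" by (simp add: power2_eq_square mult_ac)
  finally show ?thesis unfolding X_def .
qed

lemma compress_approx:
  assumes b: "symbol b" and e: "orthonormal_basis e" and \<delta>: "\<delta> > 0"
  shows "\<exists>u\<in>Linfty_fin e. symbol u \<and> (\<forall>f\<in>A2 \<alpha>.
    nsq (\<lambda>z. M_head e d (toeplitz \<alpha> b (M_head e d f)) z - toeplitz \<alpha> u f z) \<le> ennreal \<delta> * nsq f)"
proof -
  define c where "c j k z = ell2_cinner (blinfun_apply (b z) (e j)) (e k)" for j k z
  have c: "scalar_symbol (c j k)" for j k unfolding c_def[abs_def] by (rule scalar_symbol_entry[OF b e])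
  \<comment> \<open>Chosen so that d^2 \<delta>' is at most min(\<delta>, 1) / 2. The 1 keeps the
    coefficient of |h|^2 within the 1/2 allowed by \<open>dual_bound\<close>, and \<delta> makes the
    resulting bound 2 d^2 \<delta>' at most \<delta>. The 1 in the denominator covers d = 0.\<close>
  define \<delta>' where "\<delta>' = min \<delta> 1 / (2 * ((real d)\<^sup>2 + 1))"
  have d0: "2 * ((real d)\<^sup>2 + 1) > 0" by (simp add: add_nonneg_pos)
  have \<delta>': "\<delta>' > 0" unfolding \<delta>'_def using \<delta> d0 by (intro divide_pos_pos) auto
  have d': "(real d)\<^sup>2 * \<delta>' \<le> min \<delta> 1 / 2"
  proof -
    have "(real d)\<^sup>2 * \<delta>' \<le> ((real d)\<^sup>2 + 1) * \<delta>'" using \<delta>' by (intro mult_right_mono) auto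
    also have "\<dots> = min \<delta> 1 / 2" unfolding \<delta>'_def using d0 by (simp add: field_simps)
    finally show ?thesis .
  qed
  have "\<exists>u U. u \<in> borel_measurable M \<and> (\<forall>z. cmod (u z) \<le> U) \<and> weakly_close \<delta>' (c j k) u" for j k
    by (rule scalar_approx[OF c \<delta>'])
  then obtain v U where v: "\<And>j k. v j k \<in> borel_measurable M" "\<And>j k z. cmod (v j k z) \<le> U j k"
    "\<And>j k. weakly_close \<delta>' (c j k) (v j k)"
    by metis
  have vs: "scalar_symbol (v j k)" for j k by (rule scalar_symbol_bounded[OF v(1,2)])
  define u where "u z = fin_op e d (\<lambda>j k. v j k z)" for z
  have us: "symbol u" unfolding u_def[abs_def] by (rule symbol_fin_op[OF e vs])
  have entry: "ell2_cinner (blinfun_apply (u z) (e j)) (e k) = (if j < d \<and> k < d then v j k z else 0)" for j k z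
    unfolding u_def by (rule fin_op_entry[OF e])
  have "u \<in> Linfty_fin e"
    unfolding Linfty_fin_def mem_Collect_eq entry
  proof (intro conjI allI ballI)
    show "u z \<in> clinear_operators" for z unfolding u_def by (rule fin_op_clinear)
    show "finite {(j, k). \<exists>z\<in>B. (if j < d \<and> k < d then v j k z else 0) \<noteq> 0}"
      by (rule finite_subset[of _ "{..<d} \<times> {..<d}"]) (auto split: if_splits)
    fix j k
    show "bounded ((\<lambda>z. if j < d \<and> k < d then v j k z else 0) ` B)"
      using v(2) by (intro boundedI[of _ "max (U j k) 0"]) (auto simp: le_max_iff_disj split: if_splits)
    show "(\<lambda>z. if j < d \<and> k < d then v j k z else 0) \<in> borel_measurable (lebesgue_on B)"
      using v(1)[of j k] by (cases "j < d \<and> k < d") (simp_all add: measurable_cong_sets[OF sets_nu refl])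
  qed
  moreover have "nsq (\<lambda>z. M_head e d (toeplitz \<alpha> b (M_head e d f)) z - toeplitz \<alpha> u f z) \<le> ennreal \<delta> * nsq f" if f: "f \<in> A2 \<alpha>" for f
  proof -
    have bs: "symbol (\<lambda>z. fin_op e d (\<lambda>j k. c j k z))" by (rule symbol_fin_op[OF e c])
    define w where "w z = fin_op e d (\<lambda>j k. c j k z - v j k z)" for z
    have ws: "symbol w" unfolding w_def[abs_def] by (rule symbol_fin_op[OF e scalar_symbol_diff[OF c vs]])
    have weq: "blinfun_apply (w z) x = blinfun_apply (fin_op e d (\<lambda>j k. c j k z)) x - blinfun_apply (u z) x" for z x
      by (simp add: w_def u_def fin_op_apply sum_subtractf[symmetric] scaleC_simps left_diff_distrib)
    \<comment> \<open>Both operators are Toeplitz integrals, so their difference at \<open>f\<close>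
      is the projection of the difference symbol \<open>w\<close> applied to
      \<open>f\<close>.\<close>
    have "nsq (\<lambda>z. M_head e d (toeplitz \<alpha> b (M_head e d f)) z - toeplitz \<alpha> u f z) = nsq (proj (\<lambda>z. blinfun_apply (w z) (f z)))"
      unfolding toeplitz_compress[OF b f] toeplitz_properties(2)[OF us f] toeplitz_integral_proj c_def[symmetric] weq
      by (rule arg_cong[where f = nsq, OF proj_diff[OF symbol_apply_integrable[OF bs f] symbol_apply_integrable[OF us f], symmetric]])
    also have "\<dots> \<le> ennreal (2 * ((real d)\<^sup>2 * \<delta>' * (\<integral>z. (norm (f z))\<^sup>2 \<partial>M)))"
    proof (rule dual_bound[OF symbol_apply_integrable[OF ws f]])
      fix h :: "complex^'n \<Rightarrow> ell2" assume h: "h \<in> A2 \<alpha>"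
      have "(\<integral>z. inner (blinfun_apply (w z) (f z)) (h z) \<partial>M) \<le>
        (real d)\<^sup>2 * \<delta>' * ((\<integral>z. (norm (f z))\<^sup>2 \<partial>M) + (\<integral>z. (norm (h z))\<^sup>2 \<partial>M))"
        unfolding w_def
        by (rule form_bound[OF e scalar_symbol_diff[OF c vs] less_imp_le[OF \<delta>'] v(3)[unfolded weakly_close_def, rule_format] f h])
      also have "\<dots> \<le> (real d)\<^sup>2 * \<delta>' * (\<integral>z. (norm (f z))\<^sup>2 \<partial>M) + 1/2 * (\<integral>z. (norm (h z))\<^sup>2 \<partial>M)"
        unfolding distrib_left using d' by (intro add_left_mono mult_right_mono) auto
      finally show "(\<integral>z. inner (blinfun_apply (w z) (f z)) (h z) \<partial>M) \<le>
        (real d)\<^sup>2 * \<delta>' * (\<integral>z. (norm (f z))\<^sup>2 \<partial>M) + (\<integral>z. (norm (h z))\<^sup>2 \<partial>M) / 2" by simp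
    qed
    also have "\<dots> \<le> ennreal (\<delta> * (\<integral>z. (norm (f z))\<^sup>2 \<partial>M))"
    proof (rule ennreal_leI)
      have "2 * ((real d)\<^sup>2 * \<delta>') \<le> \<delta>" using d' by simp
      from mult_right_mono[OF this, of "\<integral>z. (norm (f z))\<^sup>2 \<partial>M"]
      show "2 * ((real d)\<^sup>2 * \<delta>' * (\<integral>z. (norm (f z))\<^sup>2 \<partial>M)) \<le> \<delta> * (\<integral>z. (norm (f z))\<^sup>2 \<partial>M)" by (simp add: mult_ac)
    qed
    also have "\<dots> = ennreal \<delta> * nsq f"
      using \<delta> by (simp add: integrable_sq(2)[OF A2D(4,3)[OF f]] ennreal_mult')
    finally show ?thesis .
  qed
  ultimately show ?thesis using us by blast
qed

section \<open>Membership in the Toeplitz algebra\<close>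

lemma toeplitz_polynomials_single:
  assumes "u \<in> Linfty_fin e"
  shows "toeplitz \<alpha> u \<in> toeplitz_polynomials \<alpha> e"
  unfolding toeplitz_polynomials_def mem_Collect_eq
  using assms by (intro exI[of _ "1::nat"] exI[of _ "\<lambda>_ _. u"]) (simp add: fun_eq_iff)

lemma operator_norm_le:
  fixes T :: "'n operator"
  assumes T: "\<And>f. f \<in> A2 \<alpha> \<Longrightarrow> T f \<in> A2 \<alpha>" and s: "s \<ge> 0"
    and le: "\<And>f. f \<in> A2 \<alpha> \<Longrightarrow> nsq (T f) \<le> ennreal (s\<^sup>2) * nsq f"
  shows "operator_norm \<alpha> T \<le> s"
  unfolding operator_norm_def
proof (rule cSUP_least)
  show "A2 \<alpha> \<noteq> ({} :: (complex^'n \<Rightarrow> ell2) set)" using A2_zero by blast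
  fix f :: "complex^'n \<Rightarrow> ell2" assume f: "f \<in> A2 \<alpha>"
  have "Lp_norm \<alpha> 2 (T f) \<le> s * Lp_norm \<alpha> 2 f" using Lp_norm_le_iff[OF T[OF f] f s] le[OF f] by simp
  \<comment> \<open>If \<open>f\<close> has norm zero the quotient is 0 by the convention for
    division, which lies below \<open>s\<close>.\<close>
  then show "Lp_norm \<alpha> 2 (T f) / Lp_norm \<alpha> 2 f \<le> s"
    using Lp_norm_nonneg[of f] s by (cases "Lp_norm \<alpha> 2 f = 0") (auto simp: divide_le_eq)
qed

text \<open>The supremum in \<open>operator_norm\<close> dominates its quotients only if they are
  bounded above. The a priori constant \<open>C\<close> ensures this, and it forces T f to have norm
  zero whenever f has.\<close>

lemma nsq_le_operator_norm:
  fixes T :: "'n operator"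
  assumes T: "\<And>f. f \<in> A2 \<alpha> \<Longrightarrow> T f \<in> A2 \<alpha>" and C: "C \<ge> 0"
    and le: "\<And>f. f \<in> A2 \<alpha> \<Longrightarrow> nsq (T f) \<le> ennreal (C\<^sup>2) * nsq f"
    and s: "operator_norm \<alpha> T \<le> s" "s \<ge> 0" and f: "f \<in> A2 \<alpha>"
  shows "nsq (T f) \<le> ennreal (s\<^sup>2) * nsq f"
proof -
  have leC: "Lp_norm \<alpha> 2 (T f) \<le> C * Lp_norm \<alpha> 2 f" if f: "f \<in> A2 \<alpha>" for f
    using Lp_norm_le_iff[OF T[OF f] f C] le[OF f] by simp
  have "Lp_norm \<alpha> 2 (T f) / Lp_norm \<alpha> 2 f \<le> C" if f: "f \<in> A2 \<alpha>" for f
    using leC[OF f] Lp_norm_nonneg[of f] C by (cases "Lp_norm \<alpha> 2 f = 0") (auto simp: divide_le_eq)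
  then have bdd: "bdd_above ((\<lambda>f. Lp_norm \<alpha> 2 (T f) / Lp_norm \<alpha> 2 f) ` A2 \<alpha>)"
    by (intro bdd_aboveI2[of _ _ C])
  have "Lp_norm \<alpha> 2 (T f) / Lp_norm \<alpha> 2 f \<le> s"
    using cSUP_upper[OF f bdd] s(1) unfolding operator_norm_def by linarith
  then have "Lp_norm \<alpha> 2 (T f) \<le> s * Lp_norm \<alpha> 2 f"
    using leC[OF f] Lp_norm_nonneg[of f] by (cases "Lp_norm \<alpha> 2 f = 0") (auto simp: divide_le_eq)
  then show ?thesis using Lp_norm_le_iff[OF T[OF f] f s(2)] by simp
qed

lemma bounded_operators_cong:
  fixes S T :: "'n operator"
  assumes T: "T \<in> bounded_operators \<alpha>" and eq: "\<And>f. f \<in> A2 \<alpha> \<Longrightarrow> S f = T f"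
  shows "S \<in> bounded_operators \<alpha>"
  using T unfolding bounded_operators_def mem_Collect_eq
  by (simp add: eq A2_add A2_scaleC cong: ball_cong)

lemma algebraI:
  fixes T :: "'n operator"
  assumes T: "T \<in> bounded_operators \<alpha>"
    and approx: "\<And>\<delta>. \<delta> > 0 \<Longrightarrow> \<exists>u\<in>Linfty_fin e. symbol u \<and> (\<forall>f\<in>A2 \<alpha>. nsq (\<lambda>z. T f z - toeplitz \<alpha> u f z) \<le> ennreal \<delta> * nsq f)"
  shows "T \<in> toeplitz_algebra \<alpha> e"
  unfolding toeplitz_algebra_def mem_Collect_eq
proof (intro conjI T allI impI)
  fix \<epsilon> :: real assume \<epsilon>: "\<epsilon> > 0"
  \<comment> \<open>Squared because \<open>approx\<close> measures squared norms, halved to leave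
    room for the strict inequality.\<close>
  then obtain u where u: "u \<in> Linfty_fin e" "symbol u"
    "\<And>f. f \<in> A2 \<alpha> \<Longrightarrow> nsq (\<lambda>z. T f z - toeplitz \<alpha> u f z) \<le> ennreal ((\<epsilon> / 2)\<^sup>2) * nsq f"
    using approx[of "(\<epsilon> / 2)\<^sup>2"] by auto
  have "operator_norm \<alpha> (\<lambda>f z. T f z - toeplitz \<alpha> u f z) \<le> \<epsilon> / 2"
  proof (rule operator_norm_le)
    fix f :: "complex^'n \<Rightarrow> ell2" assume f: "f \<in> A2 \<alpha>"
    have "T f \<in> A2 \<alpha>" using T f unfolding bounded_operators_def by blast
    then show "(\<lambda>z. T f z - toeplitz \<alpha> u f z) \<in> A2 \<alpha>"
      unfolding toeplitz_properties(2)[OF u(2) f] by (intro A2_diff toeplitz_integral_A2 u f)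
  qed (use \<epsilon> u(3) in auto)
  also have "\<dots> < \<epsilon>" using \<epsilon> by simp
  finally show "\<exists>S\<in>toeplitz_polynomials \<alpha> e. operator_norm \<alpha> (\<lambda>f z. T f z - S f z) < \<epsilon>"
    using toeplitz_polynomials_single[OF u(1)] by blast
qed

text \<open>Boundedness is inherited from the Toeplitz operator of the compressed symbol, which
  agrees with the compression on \<open>A2\<close>.\<close>

lemma compress_in_algebra:
  assumes b: "symbol b" and e: "orthonormal_basis e"
  shows "M_head e d \<circ> toeplitz \<alpha> b \<circ> M_head e d \<in> toeplitz_algebra \<alpha> e"
proof (rule algebraI)
  define c where "c z = fin_op e d (\<lambda>j k. ell2_cinner (blinfun_apply (b z) (e j)) (e k))" for z
  have c: "symbol c" unfolding c_def[abs_def] by (rule symbol_fin_op[OF e scalar_symbol_entry[OF b e]])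
  show "M_head e d \<circ> toeplitz \<alpha> b \<circ> M_head e d \<in> bounded_operators \<alpha>"
    by (rule bounded_operators_cong[OF toeplitz_properties(1)[OF c]])
      (simp add: toeplitz_compress[OF b] toeplitz_properties(2)[OF c], simp add: c_def[abs_def])
  show "\<exists>u\<in>Linfty_fin e. symbol u \<and> (\<forall>f\<in>A2 \<alpha>. nsq (\<lambda>z. (M_head e d \<circ> toeplitz \<alpha> b \<circ> M_head e d) f z - toeplitz \<alpha> u f z) \<le> ennreal \<delta> * nsq f)"
    if "\<delta> > 0" for \<delta>
    using compress_approx[OF b e that, of d] by simp
qed

lemma toeplitz_in_algebra:
  assumes b: "symbol b" and e: "orthonormal_basis e"
    and lim1: "(\<lambda>d. operator_norm \<alpha> (toeplitz \<alpha> b \<circ> M_tail e d)) \<longlonglongrightarrow> 0"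
    and lim2: "(\<lambda>d. operator_norm \<alpha> (M_tail e d \<circ> toeplitz \<alpha> b)) \<longlonglongrightarrow> 0"
  shows "toeplitz \<alpha> b \<in> toeplitz_algebra \<alpha> e"
proof (rule algebraI)
  define T where "T = toeplitz \<alpha> b"
  show Tb: "toeplitz \<alpha> b \<in> bounded_operators \<alpha>" by (rule toeplitz_properties(1)[OF b])
  have TA: "T f \<in> A2 \<alpha>" if "f \<in> A2 \<alpha>" for f using Tb that unfolding bounded_operators_def T_def by blast
  note tail = M_tail_A2[OF e] and head = M_head_A2
  obtain C where C: "C \<ge> 0" "\<And>f. f \<in> A2 \<alpha> \<Longrightarrow> nsq (T f) \<le> ennreal C * nsq f"
    using bounded_operators_nsq[OF Tb] unfolding T_def by blast
  \<comment> \<open>The tail is the identity minus a contraction, so it at most doubles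
    norms.\<close>
  have tail4: "nsq (M_tail e d f) \<le> 4 * nsq f" if f: "f \<in> A2 \<alpha>" for d and f :: "complex^'n \<Rightarrow> ell2"
  proof -
    have "norm (M_tail e d f z) \<le> norm (2 *\<^sub>C f z)" for z
      using norm_triangle_ineq4[of "f z" "head e d (f z)"] norm_head_le[OF e, of d "f z"] by (simp add: M_tail_eq[OF e])
    then have "nsq (M_tail e d f) \<le> nsq (\<lambda>z. 2 *\<^sub>C f z)" by (intro nsq_mono)
    then show ?thesis by (simp add: nsq_scaleC[OF A2D(4)[OF f]])
  qed
  \<comment> \<open>An a priori bound for both products with the tail;
    \<open>nsq_le_operator_norm\<close> asks for it before the smallness of the operator norm can be
    used.\<close>
  define D where "D = sqrt (4 * C)"
  have D: "D \<ge> 0" "ennreal (D\<^sup>2) = 4 * ennreal C" using C(1) by (simp_all add: D_def ennreal_mult')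
  fix \<delta> :: real assume \<delta>: "\<delta> > 0"
  \<comment> \<open>Two uses of \<open>nsq_add_le\<close> weight each of the two tail terms by 4 and
    the compression error by 2. With \<eta>^2 = \<delta>/16 and compression error \<delta>/4 the two
    kinds of terms contribute \<delta>/2 each.\<close>
  define \<eta> where "\<eta> = sqrt (\<delta> / 16)"
  have \<eta>: "\<eta> > 0" "\<eta>\<^sup>2 = \<delta> / 16" using \<delta> by (simp_all add: \<eta>_def)
  have "\<forall>\<^sub>F d in sequentially. operator_norm \<alpha> (T \<circ> M_tail e d) < \<eta> \<and> operator_norm \<alpha> (M_tail e d \<circ> T) < \<eta>"
    using order_tendstoD(2)[OF lim1 \<eta>(1)] order_tendstoD(2)[OF lim2 \<eta>(1)] unfolding T_def by eventually_elim simp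
  then obtain d where d: "operator_norm \<alpha> (T \<circ> M_tail e d) < \<eta>" "operator_norm \<alpha> (M_tail e d \<circ> T) < \<eta>"
    unfolding eventually_sequentially by blast
  have le1: "nsq (T (M_tail e d f)) \<le> ennreal (\<eta>\<^sup>2) * nsq f" if f: "f \<in> A2 \<alpha>" for f
  proof -
    have "nsq ((T \<circ> M_tail e d) f) \<le> ennreal (\<eta>\<^sup>2) * nsq f"
    proof (rule nsq_le_operator_norm[OF _ D(1) _ less_imp_le[OF d(1)] less_imp_le[OF \<eta>(1)] f])
      fix f :: "complex^'n \<Rightarrow> ell2" assume f: "f \<in> A2 \<alpha>"
      show "(T \<circ> M_tail e d) f \<in> A2 \<alpha>" using TA tail f by simp
      have "nsq (T (M_tail e d f)) \<le> ennreal C * (4 * nsq f)"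
        by (rule order_trans[OF C(2)[OF tail[OF f]] mult_left_mono[OF tail4[OF f]]]) simp
      then show "nsq ((T \<circ> M_tail e d) f) \<le> ennreal (D\<^sup>2) * nsq f" by (simp add: D mult_ac)
    qed
    then show ?thesis by simp
  qed
  have le2: "nsq (M_tail e d (T f)) \<le> ennreal (\<eta>\<^sup>2) * nsq f" if f: "f \<in> A2 \<alpha>" for f
  proof -
    have "nsq ((M_tail e d \<circ> T) f) \<le> ennreal (\<eta>\<^sup>2) * nsq f"
    proof (rule nsq_le_operator_norm[OF _ D(1) _ less_imp_le[OF d(2)] less_imp_le[OF \<eta>(1)] f])
      fix f :: "complex^'n \<Rightarrow> ell2" assume f: "f \<in> A2 \<alpha>"
      show "(M_tail e d \<circ> T) f \<in> A2 \<alpha>" using TA tail f by simp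
      have "nsq (M_tail e d (T f)) \<le> 4 * (ennreal C * nsq f)"
        by (rule order_trans[OF tail4[OF TA[OF f]] mult_left_mono[OF C(2)[OF f]]]) simp
      then show "nsq ((M_tail e d \<circ> T) f) \<le> ennreal (D\<^sup>2) * nsq f" by (simp add: D mult_ac)
    qed
    then show ?thesis by simp
  qed
  obtain u where u: "u \<in> Linfty_fin e" "symbol u"
    "\<And>f. f \<in> A2 \<alpha> \<Longrightarrow> nsq (\<lambda>z. M_head e d (T (M_head e d f)) z - toeplitz \<alpha> u f z) \<le> ennreal (\<delta> / 4) * nsq f"
    using compress_approx[OF b e, of "\<delta> / 4" d] \<delta> unfolding T_def by auto
  have "nsq (\<lambda>z. T f z - toeplitz \<alpha> u f z) \<le> ennreal \<delta> * nsq f" if f: "f \<in> A2 \<alpha>" for f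
  proof -
    define f1 f2 where "f1 = T (M_tail e d f)" and "f2 = M_tail e d (T (M_head e d f))"
    define f3 where "f3 z = M_head e d (T (M_head e d f)) z - toeplitz \<alpha> u f z" for z
    have uA: "toeplitz \<alpha> u f \<in> A2 \<alpha>"
      unfolding toeplitz_properties(2)[OF u(2) f] by (rule toeplitz_integral_A2[OF u(2) f])
    have A: "f1 \<in> A2 \<alpha>" "f2 \<in> A2 \<alpha>" "f3 \<in> A2 \<alpha>"
      unfolding f1_def f2_def f3_def[abs_def] by (intro TA tail head f A2_diff uA)+
    have "T (M_tail e d f) = (\<lambda>z. T f z - T (M_head e d f) z)"
      using bounded_operators_diff[OF Tb f head[OF f, of e d]] unfolding T_def by (simp add: M_tail_eq[OF e] M_head_head)
    then have eq: "(\<lambda>z. T f z - toeplitz \<alpha> u f z) = (\<lambda>z. (f1 z + f2 z) + f3 z)"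
      by (simp add: fun_eq_iff f1_def f2_def f3_def M_tail_eq[OF e] M_head_head)
    have n2: "nsq f2 \<le> ennreal (\<eta>\<^sup>2) * nsq f"
      unfolding f2_def by (rule order_trans[OF le2[OF head[OF f]] mult_left_mono[OF nsq_M_head[OF e]]]) simp
    have "nsq (\<lambda>z. T f z - toeplitz \<alpha> u f z) \<le> 2 * nsq (\<lambda>z. f1 z + f2 z) + 2 * nsq f3"
      unfolding eq by (rule nsq_add_le) (use A2D(4) A A2_add in auto)
    also have "\<dots> \<le> 2 * (2 * nsq f1 + 2 * nsq f2) + 2 * nsq f3"
      by (intro add_right_mono mult_left_mono nsq_add_le) (use A2D(4) A in auto)
    also have "\<dots> \<le> 2 * (2 * (ennreal (\<eta>\<^sup>2) * nsq f) + 2 * (ennreal (\<eta>\<^sup>2) * nsq f)) + 2 * (ennreal (\<delta> / 4) * nsq f)"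
      unfolding f1_def f3_def[abs_def] by (intro add_mono mult_left_mono n2 le1 u(3) f) auto
    also have "\<dots> = (8 * ennreal (\<delta> / 16) + 2 * ennreal (\<delta> / 4)) * nsq f"
      unfolding \<eta>(2) by (simp add: distrib_right mult.assoc[symmetric] flip: distrib_right)
    also have "8 * ennreal (\<delta> / 16) + 2 * ennreal (\<delta> / 4) = ennreal \<delta>"
      using \<delta> by (simp add: ennreal_mult'[symmetric] flip: ennreal_numeral ennreal_plus)
    finally show ?thesis .
  qed
  then show "\<exists>u\<in>Linfty_fin e. symbol u \<and> (\<forall>f\<in>A2 \<alpha>. nsq (\<lambda>z. toeplitz \<alpha> b f z - toeplitz \<alpha> u f z) \<le> ennreal \<delta> * nsq f)"
    using u unfolding T_def by blast
qed

end

theorem proposition1p16: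
  fixes \<alpha> :: real
    and e :: "nat \<Rightarrow> ell2"
    and b :: "complex^'n::finite \<Rightarrow> ell2 \<Rightarrow>\<^sub>L ell2"
  assumes "\<alpha> > -1"
    and "orthonormal_basis e"
    and "\<forall>z\<in>unit_ball. b z \<in> clinear_operators"
    and "b \<in> BMO1 \<alpha>"
    and "berezin \<alpha> b \<in> Linfty \<alpha>"
  shows "(\<forall>d\<ge>1. M_head e d \<circ> toeplitz \<alpha> b \<circ> M_head e d \<in> toeplitz_algebra \<alpha> e) \<and>
    ((\<lambda>d. operator_norm \<alpha> (toeplitz \<alpha> b \<circ> M_tail e d)) \<longlonglongrightarrow> 0 \<and>
     (\<lambda>d. operator_norm \<alpha> (M_tail e d \<circ> toeplitz \<alpha> b)) \<longlonglongrightarrow> 0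
     \<longrightarrow> toeplitz \<alpha> b \<in> toeplitz_algebra \<alpha> e)"
proof -
  interpret bergman \<alpha> "TYPE('n)" by unfold_locales (rule assms(1))
  have "symbol b" by (rule symbol_BMO[OF assms(3-5)])
  then show ?thesis
    using compress_in_algebra[OF _ assms(2)] toeplitz_in_algebra[OF _ assms(2)] by blast
qed

end
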